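(* Let $N\ge1$, $a>0$, $0<\beta\le2$, let $J_0$, $G$, $A$ be as in the context, and let $\alpha=\frac{\beta}{N+1}$. Assume moreover that $A$ is one of: (i) $A=\Delta$ (then $\beta=2$); (ii) $A=-(-\Delta)^{\beta/2}$ with $0<\beta<2$; (iii) $Au=J*u-u$ for a nonnegative $J\in L^1(\mathbb R^N)\cap L^\infty(\mathbb R^N)$ with $\hat J(\xi)=1-a|\xi|^\beta+o(|\xi|^\beta)$ as $\xi\to0$, $J(x',-x_N)=J(x',x_N)$, $J(-x',x_N)=J(x',x_N)$, and such that for every $z'\in\mathbb R^{N-1}$ the map $z_N\mapsto J(z',z_N)$ is nonincreasing on $(0,\infty)$. Then for every initial datum $u_0$ satisfying the initial-data assumption, the solution of $$\partial_t u = Au+|u|^\alpha u \text{ in } (0,T)\times\mathbb R^N_+,\quad u(0,\cdot)=u_0,\quad u(t,x',0)=0$$ blows up in finite time.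
   Context: Notation: $x=(x',x_N)\in\mathbb R^{N-1}\times\mathbb R$, $\mathbb R^N_+=\mathbb R^{N-1}\times(0,+\infty)$. Fourier transform: $\hat f(\xi)=\int_{\mathbb R^N}e^{-ix\cdot\xi}f(x)\,dx$ (extended to bounded measures). $\mathcal M_b(\mathbb R^N)$ is the space of bounded measures; a measure is even in $x_N$ (resp. $x'$) if it annihilates every $\phi\in C_b(\mathbb R^N)$ odd in $x_N$ (resp. in $x'$). Assumption on $J_0$: $J_0\in C(\mathbb R^N;\mathbb R)$, $J_0(\xi)=1-a|\xi|^\beta+o(|\xi|^\beta)$ as $\xi\to0$, $a>0$, $0<\beta\le2$, and $\sup_{|\xi|\ge r}J_0(\xi)<1$ for all $r>0$. Assumption on $G$: $G\in C((0,\infty);\mathcal M_b(\mathbb R^N))$, $G(t)\ge0$, $G(t)(\mathbb R^N)=1$, $G(t)$ even in $x_N$ and in $x'$, $\mathcal F(G(t))(\xi)=e^{t(J_0(\xi)-1)}$. Assumption on $A$: for every $v_0\in\mathcal M_b(\mathbb R^N)$ the unique solution of $\partial_tv=Av$, $v(0)=v_0$, is $v(t)=G(t)*v_0$ (so $A$ is self-adjoint). (In case (iii), $J_0=\hat J$.) Initial-data assumption: $u_0\in L^\infty(\mathbb R^N_+)\cap L^1(\mathbb R^N_+)$, $u_0\ge0$, $u_0\not\equiv0$, $m_1(u_0):=\int_{\mathbb R^N_+}x_Nu_0\,dx<\infty$. Half-space problems are solved via odd extension in $x_N$ ($\tilde w(x)=w(x)$ for $x_N>0$, $\tilde w(x)=-w(x',-x_N)$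 for $x_N<0$): the solution is the restriction to $\mathbb R^N_+$ of the weak solution on $\mathbb R^N$ of $\partial_t\tilde u=A\tilde u+|\tilde u|^\alpha\tilde u$, $\tilde u(0)=\tilde u_0$, which exists on a maximal interval $[0,T)$; blow-up in finite time means $T<\infty$ and $\|u(t)\|_{L^\infty}\to\infty$ as $t\to T$. *)

theory Defs
  imports "HOL-Probability.Probability" "HOL-Library.Landau_Symbols"
begin

text \<open>Points of R^N are vectors of type real^'n; N = CARD('n) (so N >= 1).
  A fixed index k plays the role of the last coordinate x_N; the remaining
  coordinates form x'.\<close>

definition reflN :: "'n \<Rightarrow> real^'n \<Rightarrow> real^'n" where
  "reflN k x = (\<chi> i. if i = k then - (x$i) else x$i)"

definition reflP :: "'n \<Rightarrow> real^'n \<Rightarrow> real^'n" where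
  "reflP k x = (\<chi> i. if i = k then x$i else - (x$i))"

definition upd :: "real^'n \<Rightarrow> 'n \<Rightarrow> real \<Rightarrow> real^'n" where
  "upd z k s = (\<chi> i. if i = k then s else z$i)"

definition halfspace :: "'n \<Rightarrow> (real^'n) set" where
  "halfspace k = {x. 0 < x$k}"

definition oddext :: "'n \<Rightarrow> (real^'n \<Rightarrow> real) \<Rightarrow> real^'n \<Rightarrow> real" where
  "oddext k w x = (if 0 < x$k then w x else if x$k < 0 then - w (reflN k x) else 0)"

definition mfourier :: "(real^'n) measure \<Rightarrow> real^'n \<Rightarrow> complex" where
  "mfourier \<mu> \<xi> = integral\<^sup>L \<mu> (\<lambda>x. cis (- (x \<bullet> \<xi>)))"

definition ffourier :: "(real^'n \<Rightarrow> real) \<Rightarrow> real^'n \<Rightarrow> complex" where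
  "ffourier f \<xi> = integral\<^sup>L lborel (\<lambda>x. complex_of_real (f x) * cis (- (x \<bullet> \<xi>)))"

definition meas_even :: "(real^'n \<Rightarrow> real^'n) \<Rightarrow> (real^'n) measure \<Rightarrow> bool" where
  "meas_even \<rho> \<mu> \<longleftrightarrow> (\<forall>\<phi>::real^'n \<Rightarrow> real. continuous_on UNIV \<phi> \<longrightarrow> bounded (range \<phi>)
      \<longrightarrow> (\<forall>x. \<phi> (\<rho> x) = - \<phi> x) \<longrightarrow> integral\<^sup>L \<mu> \<phi> = 0)"

definition mconv :: "(real^'n) measure \<Rightarrow> (real^'n \<Rightarrow> real) \<Rightarrow> real^'n \<Rightarrow> real" where
  "mconv \<mu> g x = integral\<^sup>L \<mu> (\<lambda>y. g (x - y))"

text \<open>Solution on [0,T) of  u_t = A u + |u|^\<alpha> u, u(0) = v0, on R^N, where A generates the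
  semigroup v0 \<mapsto> G(t) * v0, in Duhamel (mild) form; bounded on [0,\<tau>] x R^N for \<tau> < T.\<close>
definition mild_sol :: "(real \<Rightarrow> (real^'n) measure) \<Rightarrow> real \<Rightarrow> (real^'n \<Rightarrow> real) \<Rightarrow> real
    \<Rightarrow> (real \<Rightarrow> real^'n \<Rightarrow> real) \<Rightarrow> bool" where
  "mild_sol G \<alpha> v0 T u \<longleftrightarrow>
     (\<lambda>(t, x). u t x) \<in> borel_measurable borel \<and>
     (\<forall>\<tau>. 0 \<le> \<tau> \<and> \<tau> < T \<longrightarrow> (\<exists>C. \<forall>t\<in>{0..\<tau>}. AE x in lborel. \<bar>u t x\<bar> \<le> C)) \<and>
     (AE x in lborel. u 0 x = v0 x) \<and>
     (\<forall>t. 0 < t \<and> t < T \<longrightarrow>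
        (AE x in lborel. u t x = mconv (G t) v0 x
            + (LBINT s:{0..t}. mconv (G (t - s)) (\<lambda>y. \<bar>u s y\<bar> powr \<alpha> * u s y) x)))"

definition hs_norm :: "'n \<Rightarrow> (real^'n \<Rightarrow> real) \<Rightarrow> ereal" where
  "hs_norm k w = esssup lborel (\<lambda>x. if 0 < x$k then ereal \<bar>w x\<bar> else 0)"

end

theory Submission
  imports Defs
begin

text \<open>After odd extension in $x_k$ everything lives in the cone of odd functions that are nonnegative
  for $x_k > 0$. Convolution with an integrable kernel that is even and decreasing in $x_k$ preserves
  this cone; on the Fourier side the corresponding multipliers are closed under sums, products,
  limits, mixtures and the exponential, and in each of the three cases this class contains the
  symbol \<open>exp (t * (J0 \<xi> - 1))\<close>, so the semigroup preserves the cone.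

  Suppose the solution \<open>u\<close> were global, and put \<open>w\<^sub>t x = x $ k * exp (- |x|\<^sup>2 / (2 * R\<^sup>2))\<close> with
  \<open>R = t powr (1 / \<beta>)\<close>. Pairing \<open>u (t\<^sub>0 + s)\<close> with \<open>P (t - s) w\<^sub>t\<close> and using Jensen's inequality
  (the mass of \<open>w\<^sub>t\<close> is a multiple of \<open>R ^ (N + 1) = t powr (1 / \<alpha>)\<close>) gives an inequality
  \<open>Z' \<ge> C * Z powr (1 + \<alpha>) / t\<close> on an interval of length \<open>t\<close>, hence a bound on \<open>Z\<close> independent of
  \<open>t\<close> and \<open>t\<^sub>0\<close>. As \<open>t\<close> tends to infinity, \<open>P (t + s) w\<^sub>t\<close> tends to a positive multiple of \<open>x $ k\<close>,
  so the space-time integral of \<open>u powr (1 + \<alpha>) * x $ k\<close> is finite. The same pairing bounds the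
  integral at time \<open>t\<close> below by a multiple of \<open>1 / t\<close>, a contradiction: this is where the critical
  exponent is used.\<close>

section \<open>Reflection, Lebesgue measure and the cone\<close>

text \<open>What is given about \<open>G t\<close> is its Fourier transform and its symmetries. In
  the convolution case it has an atom at the origin, so there is no density to estimate; positivity
  is therefore proved for multipliers and carried over to the measures by duality. The cone stands
  in for a comparison principle in the half-space. The scale t^(1/\<beta>) is the one on which t
  (J0(\<xi>/R) - 1) has the limit -a |\<xi>|^\<beta>. In the mass of the test function the factor
  \<open>x $ k\<close> accounts for the extra 1 in N + 1. The criticality shows twice: the length of
  the interval cancels exactly, and the lower bound 1/t has an integral that diverges only
  logarithmically. Solutions are known up to null sets and are bounded only on compact time
  intervals. They are compared with solutions of a truncated, globally Lipschitz problem, which are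
  defined at every point. The time by which a solution can be extended depends on its current
  supremum alone, and this turns the nonexistence of global solutions into divergence of the norm at
  the maximal time.\<close>

lemma reflN_nth [simp]: "reflN k x $ i = (if i = k then - (x $ i) else x $ i)"
  by (simp add: reflN_def)

lemma reflN_reflN [simp]: "reflN k (reflN k x) = x"
  by (simp add: vec_eq_iff)

lemma reflN_diff: "reflN k (x - y) = reflN k x - reflN k y"
  by (simp add: vec_eq_iff)

lemma reflN_scaleR: "reflN k (c *\<^sub>R x) = c *\<^sub>R reflN k x"
  by (simp add: vec_eq_iff)

lemma inner_reflN: "reflN k x \<bullet> reflN k y = x \<bullet> y"
  by (auto simp: inner_vec_def intro!: sum.cong)

lemma norm_reflN [simp]: "norm (reflN k x) = norm x"
  by (simp add: norm_eq_sqrt_inner inner_reflN)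

lemma continuous_on_reflN [continuous_intros]:
  "continuous_on S f \<Longrightarrow> continuous_on S (\<lambda>x. reflN k (f x))"
  unfolding reflN_def
  by (intro continuous_on_vec_lambda, case_tac "i = k") (auto intro!: continuous_intros)

lemma borel_measurable_reflN [measurable]: "reflN k \<in> borel_measurable borel"
  by (intro borel_measurable_continuous_onI continuous_on_reflN continuous_on_id)

lemma reflN_fixed: "x $ k = 0 \<Longrightarrow> reflN k x = x"
  by (simp add: vec_eq_iff)

lemma reflP_eq: "reflP k x = - reflN k x"
  by (simp add: vec_eq_iff reflP_def)

section \<open>Lebesgue measure under reflections, translations and dilations\<close>

text \<open>The reflection is diagonal in the standard basis with entries 1 and -1, so the affine
  change of variables has factor 1.\<close>

lemma lborel_distr_reflN: "distr lborel borel (reflN k) = (lborel :: (real^'n) measure)"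
proof -
  define c :: "real^'n \<Rightarrow> real" where "c = (\<lambda>j. if j = axis k 1 then -1 else 1)"
  have T: "(\<lambda>x. 0 + (\<Sum>j\<in>Basis. (c j * (x \<bullet> j)) *\<^sub>R j)) = reflN k"
  proof (rule ext, rule euclidean_eqI)
    fix x b :: "real^'n" assume b: "b \<in> Basis"
    then obtain i where i: "b = axis i 1" by (auto simp: Basis_vec_def)
    have "(0 + (\<Sum>j\<in>Basis. (c j * (x \<bullet> j)) *\<^sub>R j)) \<bullet> b = c b * (x \<bullet> b)"
      using b by simp
    also have "\<dots> = reflN k x \<bullet> b"
      by (auto simp: c_def i inner_axis axis_eq_axis)
    finally show "(0 + (\<Sum>j\<in>Basis. (c j * (x \<bullet> j)) *\<^sub>R j)) \<bullet> b = reflN k x \<bullet> b" .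
  qed
  have "lborel = density (distr lborel borel (\<lambda>x. 0 + (\<Sum>j\<in>Basis. (c j * (x \<bullet> j)) *\<^sub>R j)))
      (\<lambda>_. (\<Prod>j\<in>Basis. \<bar>c j\<bar>))"
    by (rule lborel_affine_euclidean) (auto simp: c_def)
  also have "(\<Prod>j\<in>Basis. \<bar>c j\<bar>) = 1"
    by (rule prod.neutral) (auto simp: c_def)
  finally show ?thesis unfolding T by (simp add: density_1)
qed

lemma lborel_distr_minus: "distr lborel borel (\<lambda>x. c - x) = (lborel :: 'a::euclidean_space measure)"
  by (subst lborel_affine[of "-1" c]) (auto simp: density_1)

lemma integrable_lborel_reflN:
  fixes f :: "real^'n \<Rightarrow> 'b::{banach, second_countable_topology}"
  assumes "integrable lborel f"
  shows "integrable lborel (\<lambda>x. f (reflN k x))"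
  using assms by (subst (asm) lborel_distr_reflN[of k, symmetric]) (rule integrable_distr[rotated], auto)

lemma integral_lborel_reflN:
  fixes f :: "real^'n \<Rightarrow> 'b::{banach, second_countable_topology}"
  assumes [measurable]: "f \<in> borel_measurable borel"
  shows "(\<integral>x. f (reflN k x) \<partial>lborel) = (\<integral>x. f x \<partial>lborel)"
  by (subst (2) lborel_distr_reflN[of k, symmetric]) (simp add: integral_distr)

lemma AE_lborel_reflN:
  assumes "AE x in lborel. P x"
  shows "AE x in lborel. P (reflN k x)"
  using assms by (subst (asm) lborel_distr_reflN[of k, symmetric]) (auto dest: AE_distrD[rotated])

lemma integrable_lborel_minus:
  fixes f :: "'a::euclidean_space \<Rightarrow> 'b::{banach, second_countable_topology}"
  assumes "integrable lborel f"
  shows "integrable lborel (\<lambda>x. f (c - x))"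
  using assms by (subst (asm) lborel_distr_minus[of c, symmetric]) (rule integrable_distr[rotated], auto)

lemma integral_lborel_minus:
  fixes f :: "'a::euclidean_space \<Rightarrow> 'b::{banach, second_countable_topology}"
  assumes [measurable]: "f \<in> borel_measurable borel"
  shows "(\<integral>x. f (c - x) \<partial>lborel) = (\<integral>x. f x \<partial>lborel)"
  by (subst (2) lborel_distr_minus[of c, symmetric]) (simp add: integral_distr)

lemma lborel_plus_eq: "distr lborel borel (\<lambda>x. x + c) = (lborel :: 'a::euclidean_space measure)"
  using lborel_distr_plus[of c] by (simp add: add.commute[of _ c])

lemma nn_integral_lborel_plus:
  fixes c :: "'a::euclidean_space"
  assumes [measurable]: "f \<in> borel_measurable borel"
  shows "(\<integral>\<^sup>+x. f (x + c) \<partial>lborel) = (\<integral>\<^sup>+x. f x \<partial>lborel)"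
  by (subst (2) lborel_plus_eq[of c, symmetric]) (simp add: nn_integral_distr)

lemma integral_lborel_plus:
  fixes f :: "'a::euclidean_space \<Rightarrow> 'b::{banach, second_countable_topology}"
  assumes [measurable]: "f \<in> borel_measurable borel"
  shows "(\<integral>x. f (x + c) \<partial>lborel) = (\<integral>x. f x \<partial>lborel)"
  by (subst (2) lborel_plus_eq[of c, symmetric]) (simp add: integral_distr)

lemma integrable_lborel_plus:
  fixes f :: "'a::euclidean_space \<Rightarrow> 'b::{banach, second_countable_topology}"
  assumes "integrable lborel f"
  shows "integrable lborel (\<lambda>x. f (x + c))"
  using assms by (subst (asm) lborel_plus_eq[of c, symmetric]) (rule integrable_distr[rotated], auto)

lemma integral_lborel_scaleR:
  fixes f :: "'a::euclidean_space \<Rightarrow> 'b::{banach, second_countable_topology}"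
  assumes [measurable]: "f \<in> borel_measurable borel" and "c \<noteq> 0"
  shows "(\<integral>x. f x \<partial>lborel) = \<bar>c\<bar> ^ DIM('a) *\<^sub>R (\<integral>x. f (c *\<^sub>R x) \<partial>lborel)"
  by (subst lborel_affine[OF \<open>c \<noteq> 0\<close>, of 0]) (simp add: integral_density integral_distr)

lemma integrable_lborel_scaleR:
  fixes f :: "'a::euclidean_space \<Rightarrow> 'b::{banach, second_countable_topology}"
  assumes f: "integrable lborel f" and "c \<noteq> 0"
  shows "integrable lborel (\<lambda>x. f (c *\<^sub>R x))"
proof -
  have [measurable]: "f \<in> borel_measurable borel" using f by (simp add: borel_measurable_integrable)
  have "integrable lborel (\<lambda>x. \<bar>c\<bar> ^ DIM('a) *\<^sub>R f (c *\<^sub>R x))"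
    using f by (subst (asm) lborel_affine[OF \<open>c \<noteq> 0\<close>, of 0]) (simp add: integrable_density integrable_distr_eq)
  then have "integrable lborel (\<lambda>x. (1 / \<bar>c\<bar> ^ DIM('a)) *\<^sub>R (\<bar>c\<bar> ^ DIM('a) *\<^sub>R f (c *\<^sub>R x)))"
    by (rule integrable_scaleR_right)
  then show ?thesis using \<open>c \<noteq> 0\<close> by simp
qed

text \<open>Used to split integrals at \<open>x $ k = 0\<close>, and to exclude
  \<open>y $ k = x $ k\<close>, where a kernel decreasing in the k-th coordinate is
  uncontrolled.\<close>

lemma AE_lborel_component_ne: "AE x in lborel. (x :: real^'n) $ k \<noteq> c"
proof -
  have "{x::real^'n. x $ k = c} \<in> null_sets lborel"
  proof -
    have "negligible {x::real^'n. x \<bullet> axis k 1 = c}"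
      by (rule negligible_standard_hyperplane) (auto simp: Basis_vec_def)
    then have "{x::real^'n. x $ k = c} \<in> null_sets lebesgue"
      by (simp add: negligible_iff_null_sets inner_axis)
    moreover have "{x::real^'n. x $ k = c} \<in> sets borel" by measurable
    ultimately show ?thesis by (simp add: null_sets_completion_iff)
  qed
  then show ?thesis by (rule AE_I') auto
qed

text \<open>The product of two members is nonnegative everywhere, which allows all pairings below to be
  taken over the whole space.\<close>

definition cone :: "'n \<Rightarrow> (real^'n \<Rightarrow> real) \<Rightarrow> bool" where
  "cone k f \<longleftrightarrow> f \<in> borel_measurable borel \<and> (\<forall>x. f (reflN k x) = - f x) \<and> (\<forall>x. 0 < x $ k \<longrightarrow> 0 \<le> f x)"

lemma coneD:
  assumes "cone k f"
  shows cone_measurable: "f \<in> borel_measurable borel"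
    and cone_odd: "f (reflN k x) = - f x"
    and cone_nonneg: "0 < x $ k \<Longrightarrow> 0 \<le> f x"
  using assms by (auto simp: cone_def)

lemma cone_zero: "cone k f \<Longrightarrow> x $ k = 0 \<Longrightarrow> f x = 0"
  using cone_odd[of k f x] by (simp add: reflN_fixed)

lemma cone_nonpos: "cone k f \<Longrightarrow> x $ k < 0 \<Longrightarrow> f x \<le> 0"
  using cone_odd[of k f x] cone_nonneg[of k f "reflN k x"] by simp

lemma cone_mult_nonneg: "cone k f \<Longrightarrow> cone k g \<Longrightarrow> 0 \<le> f x * g x"
  by (cases "x $ k" "0::real" rule: linorder_cases)
     (auto simp: cone_zero cone_nonneg intro: mult_nonpos_nonpos cone_nonpos)

lemma cone_lim:
  assumes "\<And>n. cone k (f n)" and lim: "\<And>x. (\<lambda>n::nat. f n x) \<longlonglongrightarrow> g x"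
  shows "cone k g"
  unfolding cone_def
proof (intro conjI allI impI)
  show "g \<in> borel_measurable borel"
    by (rule borel_measurable_LIMSEQ_real[OF lim]) (use assms in \<open>auto simp: cone_def\<close>)
  fix x
  have "(\<lambda>n. - f n x) \<longlonglongrightarrow> - g x" by (intro tendsto_intros lim)
  moreover have "(\<lambda>n. - f n x) \<longlonglongrightarrow> g (reflN k x)"
    using lim[of "reflN k x"] assms(1) by (simp add: cone_def)
  ultimately show "g (reflN k x) = - g x" by (rule LIMSEQ_unique[rotated])
  assume "0 < x $ k"
  then show "0 \<le> g x" using assms(1) by (intro LIMSEQ_le_const[OF lim[of x]]) (auto simp: cone_def)
qed

section \<open>Convolution of odd functions with kernels decreasing in the k-th coordinate\<close>

text \<open>Method of images: folding the lower half-space onto the upper one produces the kernel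
  \<open>J (x - y) - J (x - reflN k y)\<close>.\<close>

lemma integral_odd_pairing:
  fixes f :: "real^'n \<Rightarrow> real"
  assumes J: "integrable lborel (\<lambda>y. J (x - y) * f y)"
    and odd: "\<And>y. f (reflN k y) = - f y"
  shows "(\<integral>y. J (x - y) * f y \<partial>lborel)
    = (\<integral>y. (if 0 < y $ k then (J (x - y) - J (x - reflN k y)) * f y else 0) \<partial>lborel)"
proof -
  let ?g = "\<lambda>y. J (x - y) * f y"
  have [measurable]: "?g \<in> borel_measurable borel" using J by (simp add: borel_measurable_integrable)
  have i1: "integrable lborel (\<lambda>y. if 0 < y $ k then ?g y else 0)"
    by (rule Bochner_Integration.integrable_bound[OF J]) auto
  have i2: "integrable lborel (\<lambda>y. if y $ k < 0 then ?g y else 0)"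
    by (rule Bochner_Integration.integrable_bound[OF J]) auto
  have "(\<integral>y. ?g y \<partial>lborel)
      = (\<integral>y. (if 0 < y $ k then ?g y else 0) + (if y $ k < 0 then ?g y else 0) \<partial>lborel)"
    by (rule integral_cong_AE) (use AE_lborel_component_ne[of k 0] in auto)
  also have "\<dots> = (\<integral>y. (if 0 < y $ k then ?g y else 0) \<partial>lborel) + (\<integral>y. (if y $ k < 0 then ?g y else 0) \<partial>lborel)"
    by (rule Bochner_Integration.integral_add[OF i1 i2])
  also have "(\<integral>y. (if y $ k < 0 then ?g y else 0) \<partial>lborel)
      = (\<integral>y. (if 0 < y $ k then ?g (reflN k y) else 0) \<partial>lborel)"
    by (subst integral_lborel_reflN[of _ k, symmetric]) (auto cong: if_cong)
  also have "(\<integral>y. (if 0 < y $ k then ?g y else 0) \<partial>lborel) + \<dots>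
     = (\<integral>y. (if 0 < y $ k then ?g y else 0) + (if 0 < y $ k then ?g (reflN k y) else 0) \<partial>lborel)"
    using integrable_lborel_reflN[OF i2, of k]
    by (intro Bochner_Integration.integral_add[OF i1, symmetric]) (simp cong: if_cong)
  also have "\<dots> = (\<integral>y. (if 0 < y $ k then (J (x - y) - J (x - reflN k y)) * f y else 0) \<partial>lborel)"
    by (intro Bochner_Integration.integral_cong) (auto simp: odd algebra_simps)
  finally show ?thesis .
qed

text \<open>Only positive k-th coordinates are compared, so the values of \<open>J\<close> on the
  hyperplane are left free; evenness carries the monotonicity over to |z_k|.\<close>

definition xk_decreasing :: "'n \<Rightarrow> (real^'n \<Rightarrow> real) \<Rightarrow> bool" where
  "xk_decreasing k J \<longleftrightarrow> (\<forall>x. J (reflN k x) = J x) \<and>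
     (\<forall>z s t. 0 < s \<and> s \<le> t \<longrightarrow> J (upd z k t) \<le> J (upd z k s))"

text \<open>The two arguments differ in the k-th coordinate alone, and |x_k - y_k| is at most x_k +
  y_k when both are positive. Equal coordinates are excluded because \<open>J\<close> would then be
  evaluated on the hyperplane.\<close>

lemma xk_decreasing_reflN_le:
  assumes J: "xk_decreasing k J" and "0 < x $ k" "0 < y $ k" "x $ k \<noteq> y $ k"
  shows "J (x - reflN k y) \<le> J (x - y)"
proof -
  define d where "d = x $ k - y $ k"
  have eq: "x - reflN k y = upd (x - y) k (x $ k + y $ k)" by (simp add: vec_eq_iff upd_def)
  have "J (x - y) = J (upd (x - y) k \<bar>d\<bar>)"
  proof (cases "d > 0")
    case True
    then have "upd (x - y) k \<bar>d\<bar> = x - y" by (auto simp: vec_eq_iff upd_def d_def)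
    then show ?thesis by simp
  next
    case False
    then have "upd (x - y) k \<bar>d\<bar> = reflN k (x - y)" by (auto simp: vec_eq_iff upd_def d_def)
    then show ?thesis using J by (simp add: xk_decreasing_def)
  qed
  moreover have "J (upd (x - y) k (x $ k + y $ k)) \<le> J (upd (x - y) k \<bar>d\<bar>)"
    using J assms by (auto simp: xk_decreasing_def d_def)
  ultimately show ?thesis by (simp add: eq)
qed

lemma integrable_mult_bounded:
  fixes f :: "'a \<Rightarrow> 'b::{real_normed_algebra, second_countable_topology, banach}"
  assumes "integrable M f" "g \<in> borel_measurable M" "\<And>x. x \<in> space M \<Longrightarrow> norm (g x) \<le> B"
  shows "integrable M (\<lambda>x. f x * g x)"
proof (rule Bochner_Integration.integrable_bound)
  show "integrable M (\<lambda>x. B * norm (f x))" using assms by auto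
  show "AE x in M. norm (f x * g x) \<le> norm (B * norm (f x))"
  proof (rule AE_I2)
    fix x assume "x \<in> space M"
    then have "norm (g x) \<le> B" "B \<ge> 0" using assms(3)[of x] norm_ge_zero[of "g x"] by linarith+
    then show "norm (f x * g x) \<le> norm (B * norm (f x))"
      using norm_mult_ineq[of "f x" "g x"] mult_left_mono[of "norm (g x)" B "norm (f x)"]
      by (auto simp: mult.commute)
  qed
  show "(\<lambda>x. f x * g x) \<in> borel_measurable M"
    using assms by (intro borel_measurable_times) (auto simp: borel_measurable_integrable)
qed

text \<open>For \<open>0 < x $ k\<close> the folded integrand is nonnegative almost everywhere;
  oddness comes from the substitution of \<open>reflN k y\<close> for \<open>y\<close>.\<close>

lemma cone_convolution:
  fixes f :: "real^'n \<Rightarrow> real"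
  assumes J: "xk_decreasing k J" "integrable lborel J"
    and f: "cone k f" "\<And>x. \<bar>f x\<bar> \<le> B"
  shows "cone k (\<lambda>x. \<integral>y. J (x - y) * f y \<partial>lborel)"
proof -
  have [measurable]: "f \<in> borel_measurable borel" "J \<in> borel_measurable borel"
    using f J by (auto simp: cone_def borel_measurable_integrable)
  have int: "integrable lborel (\<lambda>y. J (x - y) * f y)" for x
    by (rule integrable_mult_bounded[OF integrable_lborel_minus[OF J(2)]]) (use f in auto)
  have odd: "f (reflN k x) = - f x" for x using f(1) by (rule cone_odd)
  show ?thesis unfolding cone_def
  proof (intro conjI allI impI)
    show "(\<lambda>x. \<integral>y. J (x - y) * f y \<partial>lborel) \<in> borel_measurable borel"
      by measurable
    fix x
    have "(\<integral>y. J (reflN k x - y) * f y \<partial>lborel) = (\<integral>y. J (reflN k x - reflN k y) * f (reflN k y) \<partial>lborel)"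
      by (rule integral_lborel_reflN[symmetric]) measurable
    also have "\<dots> = - (\<integral>y. J (x - y) * f y \<partial>lborel)"
      using J by (simp add: reflN_diff[symmetric] xk_decreasing_def odd)
    finally show "(\<integral>y. J (reflN k x - y) * f y \<partial>lborel) = - (\<integral>y. J (x - y) * f y \<partial>lborel)" .
    assume x: "0 < x $ k"
    show "0 \<le> (\<integral>y. J (x - y) * f y \<partial>lborel)"
      unfolding integral_odd_pairing[OF int odd]
    proof (rule integral_nonneg_AE)
      show "AE y in lborel. 0 \<le> (if 0 < y $ k then (J (x - y) - J (x - reflN k y)) * f y else 0)"
        using AE_lborel_component_ne[of k "x $ k"]
        by eventually_elim
           (use x xk_decreasing_reflN_le[OF J(1)] cone_nonneg[OF f(1)] in \<open>auto intro!: mult_nonneg_nonneg\<close>)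
    qed
  qed
qed

section \<open>Gaussians and Fourier uniqueness\<close>

lemma continuous_on_infdist_compl:
  "continuous_on UNIV (\<lambda>x. min 1 (real n * infdist x S))"
  by (intro continuous_intros continuous_on_infdist)

text \<open>The case \<open>U = UNIV\<close> is separate because \<open>infdist x {} = 0\<close>.\<close>

definition open_approx :: "'a::metric_space set \<Rightarrow> nat \<Rightarrow> 'a \<Rightarrow> real" where
  "open_approx U n x = (if U = UNIV then 1 else min 1 (real n * infdist x (- U)))"

lemma open_approx_bounds: "0 \<le> open_approx U n x" "open_approx U n x \<le> 1"
  by (auto simp: open_approx_def infdist_nonneg)

lemma continuous_on_open_approx: "continuous_on UNIV (open_approx U n)"
proof (cases "U = UNIV")
  case True
  then have "open_approx U n = (\<lambda>x. 1)" by (auto simp: open_approx_def)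
  then show ?thesis by simp
next
  case False
  then have "open_approx U n = (\<lambda>x. min 1 (real n * infdist x (- U)))" by (simp add: open_approx_def fun_eq_iff)
  then show ?thesis using continuous_on_infdist_compl by simp
qed

lemma open_approx_outside: "x \<notin> U \<Longrightarrow> open_approx U n x = 0"
  by (auto simp: open_approx_def)

lemma open_approx_tendsto:
  assumes "open U"
  shows "(\<lambda>n. open_approx U n x) \<longlonglongrightarrow> indicator U x"
proof (cases "x \<in> U \<and> U \<noteq> UNIV")
  case True
  then have ne: "- U \<noteq> {}" and cl: "closed (- U)" using assms by auto
  then have pos: "infdist x (- U) > 0"
    using True in_closed_iff_infdist_zero[OF cl ne, of x] infdist_nonneg[of x "- U"] by auto
  then obtain n0 :: nat where n0: "1 \<le> real n0 * infdist x (- U)"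
    by (metis ex_less_of_nat_mult less_imp_le)
  have "eventually (\<lambda>n. open_approx U n x = 1) sequentially"
    using eventually_ge_at_top[of n0]
  proof eventually_elim
    case (elim n)
    then have "real n0 * infdist x (- U) \<le> real n * infdist x (- U)"
      using pos by (intro mult_right_mono) auto
    then show ?case using True n0 by (simp add: open_approx_def)
  qed
  then show ?thesis using True by (simp add: tendsto_eventually)
next
  case False
  then have "open_approx U n x = indicator U x" for n
    by (auto simp: open_approx_def indicator_def)
  then show ?thesis by simp
qed

text \<open>Indicators of open sets are bounded pointwise limits of continuous functions, and the
  open sets form an intersection-stable generator. Finiteness lets the whole space serve as the
  exhausting sequence.\<close>

lemma measure_eqI_continuous:
  fixes \<mu> \<nu> :: "'a::metric_space measure"
  assumes fin: "finite_measure \<mu>" "finite_measure \<nu>"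
    and sets [measurable_cong]: "sets \<mu> = sets borel" "sets \<nu> = sets borel"
    and eq: "\<And>\<phi>::'a \<Rightarrow> real. continuous_on UNIV \<phi> \<Longrightarrow> bounded (range \<phi>) \<Longrightarrow> integral\<^sup>L \<mu> \<phi> = integral\<^sup>L \<nu> \<phi>"
  shows "\<mu> = \<nu>"
proof -
  interpret M: finite_measure \<mu> by fact
  interpret N: finite_measure \<nu> by fact
  have lim: "(\<lambda>n. integral\<^sup>L \<rho> (open_approx U n)) \<longlonglongrightarrow> measure \<rho> U"
    if "finite_measure \<rho>" "sets \<rho> = sets borel" "open U" for \<rho> :: "'a measure" and U
  proof -
    interpret R: finite_measure \<rho> by fact
    note [measurable_cong] = that(2)
    have [measurable]: "open_approx U n \<in> borel_measurable \<rho>" for n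
      using borel_measurable_continuous_onI[OF continuous_on_open_approx[of U n]]
      by (simp add: measurable_cong_sets[OF that(2) refl])
    have [measurable]: "U \<in> sets \<rho>" using that by simp
    have "(\<lambda>n. integral\<^sup>L \<rho> (open_approx U n)) \<longlonglongrightarrow> integral\<^sup>L \<rho> (indicator U)"
      by (rule integral_dominated_convergence[where w="\<lambda>_. 1"])
         (auto intro!: open_approx_tendsto that simp: open_approx_bounds abs_of_nonneg)
    moreover have "U \<inter> space \<rho> = U" using sets_eq_imp_space_eq[OF that(2)] by simp
    ultimately show ?thesis by simp
  qed
  have "emeasure \<mu> U = emeasure \<nu> U" if "open U" for U
  proof -
    have "integral\<^sup>L \<mu> (open_approx U n) = integral\<^sup>L \<nu> (open_approx U n)" for n
      by (intro eq continuous_on_open_approx boundedI[where B=1]) (auto simp: open_approx_bounds abs_of_nonneg)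
    then have "measure \<mu> U = measure \<nu> U"
      using lim[OF fin(1) sets(1) that] lim[OF fin(2) sets(2) that] by (simp add: LIMSEQ_unique)
    then show ?thesis by (simp add: M.emeasure_eq_measure N.emeasure_eq_measure)
  qed
  then show ?thesis
    by (intro measure_eqI_generator_eq[where E="{S. open S}" and \<Omega>=UNIV and A="\<lambda>_. UNIV"])
       (auto simp: Int_stable_def sets borel_def)
qed

section \<open>Gaussian integrals\<close>

text \<open>Left unnormalised: the values lie in (0, 1], and the Fourier transform reproduces the
  function up to the factor \<open>gauss_const\<close>.\<close>

definition gauss :: "'a::real_normed_vector \<Rightarrow> real" where
  "gauss x = exp (- (norm x)\<^sup>2 / 2)"

lemma gauss_pos: "0 < gauss x" by (simp add: gauss_def)

lemma gauss_nonneg [simp]: "0 \<le> gauss x" by (simp add: gauss_def)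

lemma gauss_le_1: "gauss x \<le> 1" by (simp add: gauss_def)

lemma gauss_reflN [simp]: "gauss (reflN k x) = gauss x" by (simp add: gauss_def)

lemma continuous_on_gauss [continuous_intros]: "continuous_on S f \<Longrightarrow> continuous_on S (\<lambda>x. gauss (f x))"
  unfolding gauss_def by (intro continuous_intros) auto

lemma borel_measurable_gauss [measurable]: "gauss \<in> borel_measurable borel"
  by (intro borel_measurable_continuous_onI continuous_on_gauss continuous_on_id)

lemma borel_measurable_cis [measurable]: "cis \<in> borel_measurable borel"
  by (intro borel_measurable_continuous_onI continuous_intros continuous_on_cis)

lemma integrable_gauss_real: "integrable lborel (\<lambda>x::real. exp (- x\<^sup>2 / 2))"
  using integrable_mult_right[OF integrable_std_normal_moment[of 0], of "sqrt (2 * pi)"]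
  by (simp add: std_normal_density_def)

lemma integrable_id_gauss_real: "integrable lborel (\<lambda>x::real. x * exp (- x\<^sup>2 / 2))"
  using integrable_mult_right[OF integrable_std_normal_moment[of 1], of "sqrt (2 * pi)"]
  by (simp add: std_normal_density_def mult_ac)

lemma integrable_of_real_cis:
  assumes "integrable M f" "g \<in> borel_measurable M"
  shows "integrable M (\<lambda>x. complex_of_real (f x) * cis (g x))"
  by (rule integrable_mult_bounded[where B=1]) (use assms in auto)

lemma integral_cis_gauss_real:
  "(\<integral>s. complex_of_real (exp (- s\<^sup>2 / 2)) * cis (x * s) \<partial>lborel) = sqrt (2 * pi) * exp (- x\<^sup>2 / 2)"
proof -
  have "complex_of_real (exp (- x\<^sup>2 / 2)) = char std_normal_distribution x"
    by (simp add: char_std_normal_distribution)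
  also have "\<dots> = (\<integral>s. std_normal_density s *\<^sub>R iexp (x * s) \<partial>lborel)"
    unfolding char_def by (subst integral_density) (auto simp: normal_density_nonneg)
  also have "\<dots> = (\<integral>s. complex_of_real (1 / sqrt (2 * pi)) * (complex_of_real (exp (- s\<^sup>2 / 2)) * cis (x * s)) \<partial>lborel)"
    by (intro Bochner_Integration.integral_cong) (auto simp: std_normal_density_def scaleR_conv_of_real cis_conv_exp)
  also have "\<dots> = complex_of_real (1 / sqrt (2 * pi)) * (\<integral>s. complex_of_real (exp (- s\<^sup>2 / 2)) * cis (x * s) \<partial>lborel)"
    by simp
  finally show ?thesis by (simp add: field_simps)
qed

text \<open>The derivative of -exp(-s^2/2) e^(ixs) is this integrand minus ix times the integrand
  without the factor \<open>s\<close>. The primitive vanishes at both ends, so the first moment is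
  ix times the zeroth.\<close>

lemma integral_cis_id_gauss_real:
  "(\<integral>s. complex_of_real (s * exp (- s\<^sup>2 / 2)) * cis (x * s) \<partial>lborel) = \<i> * x * (sqrt (2 * pi) * exp (- x\<^sup>2 / 2))"
proof -
  define F where "F = (\<lambda>s. - (complex_of_real (exp (- s\<^sup>2 / 2)) * cis (x * s)))"
  define f where "f = (\<lambda>s. complex_of_real (s * exp (- s\<^sup>2 / 2)) * cis (x * s)
      - \<i> * x * (complex_of_real (exp (- s\<^sup>2 / 2)) * cis (x * s)))"
  have i1: "integrable lborel (\<lambda>s. complex_of_real (s * exp (- s\<^sup>2 / 2)) * cis (x * s))"
    by (rule integrable_of_real_cis[OF integrable_id_gauss_real]) measurable
  have i2: "integrable lborel (\<lambda>s. complex_of_real (exp (- s\<^sup>2 / 2)) * cis (x * s))"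
    by (rule integrable_of_real_cis[OF integrable_gauss_real]) measurable
  have intf: "integrable lborel f" unfolding f_def
    by (intro Bochner_Integration.integrable_diff i1 integrable_mult_right i2)
  have d: "(F has_vector_derivative f s) (at s)" for s
  proof -
    have "(F has_vector_derivative (- (complex_of_real (exp (- s\<^sup>2 / 2)) * (x *\<^sub>R (\<i> * cis (x * s)))
        + complex_of_real (exp (- s\<^sup>2 / 2) * (- s)) * cis (x * s)))) (at s)"
      unfolding F_def
    proof (intro has_vector_derivative_minus has_vector_derivative_mult)
      show "((\<lambda>s. complex_of_real (exp (- s\<^sup>2 / 2))) has_vector_derivative complex_of_real (exp (- s\<^sup>2 / 2) * (- s))) (at s)"
        by (rule has_vector_derivative_of_real)
           (auto intro!: derivative_eq_intros simp flip: has_real_derivative_iff_has_vector_derivative)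
      have "((\<lambda>s. exp ((\<i> * x) * complex_of_real s)) has_vector_derivative (\<i> * x) * exp ((\<i> * x) * s)) (at s)"
        by (rule has_vector_derivative_real_field) (auto intro!: derivative_eq_intros)
      then show "((\<lambda>s. cis (x * s)) has_vector_derivative x *\<^sub>R (\<i> * cis (x * s))) (at s)"
        by (simp add: cis_conv_exp mult_ac scaleR_conv_of_real)
    qed
    also have "(- (complex_of_real (exp (- s\<^sup>2 / 2)) * (x *\<^sub>R (\<i> * cis (x * s)))
        + complex_of_real (exp (- s\<^sup>2 / 2) * (- s)) * cis (x * s))) = f s"
      by (simp add: f_def algebra_simps scaleR_conv_of_real)
    finally show ?thesis .
  qed
  have lim: "(F \<longlongrightarrow> 0) at_top" "(F \<longlongrightarrow> 0) at_bot"
  proof -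
    have "filterlim (\<lambda>s::real. s\<^sup>2 * (1 / 2)) at_top at_top" "filterlim (\<lambda>s::real. s\<^sup>2 * (1 / 2)) at_top at_bot"
      by (rule filterlim_at_top_mult_tendsto_pos[OF tendsto_const]; simp add: filterlim_pow_at_top filterlim_ident
          filterlim_pow_at_bot_even)+
    then have "filterlim (\<lambda>s::real. - s\<^sup>2 / 2) at_bot at_top" "filterlim (\<lambda>s::real. - s\<^sup>2 / 2) at_bot at_bot"
      by (simp_all add: filterlim_uminus_at_bot)
    then have *: "((\<lambda>s::real. exp (- s\<^sup>2 / 2)) \<longlongrightarrow> 0) at_top" "((\<lambda>s::real. exp (- s\<^sup>2 / 2)) \<longlongrightarrow> 0) at_bot"
      by (auto intro: filterlim_compose[OF exp_at_bot])
    show "(F \<longlongrightarrow> 0) at_top"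
      by (rule Lim_null_comparison[OF _ *(1)]) (auto simp: F_def norm_mult)
    show "(F \<longlongrightarrow> 0) at_bot"
      by (rule Lim_null_comparison[OF _ *(2)]) (auto simp: F_def norm_mult)
  qed
  have "(LBINT s=-\<infinity>..\<infinity>. f s) = 0 - 0"
  proof (rule interval_integral_FTC_integrable[where F=F])
    have "continuous_on UNIV f" unfolding f_def
      by (intro continuous_intros continuous_on_cis continuous_on_of_real) auto
    then show "isCont f s" for s by (simp add: continuous_on_eq_continuous_at)
  qed (use d intf lim in \<open>auto simp: set_integrable_def ereal_tendsto_simps\<close>)
  then have "(\<integral>s. f s \<partial>lborel) = 0" by (simp add: interval_lebesgue_integral_def set_lebesgue_integral_def)
  then have "(\<integral>s. complex_of_real (s * exp (- s\<^sup>2 / 2)) * cis (x * s) \<partial>lborel)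
     = \<i> * x * (\<integral>s. complex_of_real (exp (- s\<^sup>2 / 2)) * cis (x * s) \<partial>lborel)"
    unfolding f_def by (subst (asm) Bochner_Integration.integral_diff[OF i1 integrable_mult_right[OF i2]]) simp
  then show ?thesis unfolding integral_cis_gauss_real by simp
qed

text \<open>Lebesgue measure on \<open>real^'n\<close> is the image of a product measure indexed by
  basis vectors, so the factors have to be reindexed from coordinates to basis vectors.\<close>

lemma
  fixes f :: "'n::finite \<Rightarrow> real \<Rightarrow> complex"
  assumes f: "\<And>i. integrable lborel (f i)"
  shows integral_lborel_vec_prod: "(\<integral>(x::real^'n). (\<Prod>i\<in>UNIV. f i (x $ i)) \<partial>lborel) = (\<Prod>i\<in>UNIV. (\<integral>s. f i s \<partial>lborel))"
    and integrable_lborel_vec_prod: "integrable lborel (\<lambda>x::real^'n. \<Prod>i\<in>UNIV. f i (x $ i))"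
proof -
  interpret product_sigma_finite "\<lambda>_::real^'n. lborel :: real measure" ..
  \<comment> \<open>\<open>THE\<close> recovers the coordinate from its basis vector; off the basis
    the value is irrelevant.\<close>
  define g where "g b = f (THE i. b = axis i (1::real))" for b :: "real^'n"
  have g: "g (axis i 1) = f i" for i by (simp add: g_def axis_eq_axis)
  have [measurable]: "f i \<in> borel_measurable borel" for i using f[of i] by (simp add: borel_measurable_integrable)
  have bij: "bij_betw (\<lambda>i. axis i (1::real)) (UNIV::'n set) Basis"
    by (auto simp: bij_betw_def inj_on_def axis_eq_axis Basis_vec_def)
  have comp: "(\<Sum>b\<in>Basis. h b *\<^sub>R b) $ i = h (axis i 1)" for h :: "real^'n \<Rightarrow> real" and i
  proof -
    have "(\<Sum>b\<in>Basis. h b *\<^sub>R b) $ i = (\<Sum>b\<in>Basis. h b *\<^sub>R b) \<bullet> axis i 1" by (simp add: inner_axis)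
    also have "\<dots> = h (axis i 1)" by (intro inner_sum_left_Basis) (auto simp: Basis_vec_def)
    finally show ?thesis .
  qed
  have eq: "(\<Prod>i\<in>UNIV. f i ((\<Sum>b\<in>Basis. h b *\<^sub>R b) $ i)) = (\<Prod>b\<in>Basis. g b (h b))" for h :: "real^'n \<Rightarrow> real"
    unfolding comp by (rule prod.reindex_bij_betw[OF bij, of "\<lambda>b. g b (h b)", symmetric, unfolded g, symmetric])
  have intg: "integrable lborel (g b)" for b using f by (simp add: g_def)
  have "(\<integral>(x::real^'n). (\<Prod>i\<in>UNIV. f i (x $ i)) \<partial>lborel) = (\<integral>h. (\<Prod>b\<in>Basis. g b (h b)) \<partial>(\<Pi>\<^sub>M b\<in>Basis. lborel))"
    by (subst lborel_eq, subst integral_distr) (auto simp: eq[symmetric] cong: Bochner_Integration.integral_cong)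
  also have "\<dots> = (\<Prod>b\<in>Basis. integral\<^sup>L lborel (g b))"
    by (intro product_integral_prod intg) auto
  also have "\<dots> = (\<Prod>i\<in>UNIV. integral\<^sup>L lborel (f i))"
    by (subst prod.reindex_bij_betw[OF bij, symmetric]) (simp add: g)
  finally show "(\<integral>(x::real^'n). (\<Prod>i\<in>UNIV. f i (x $ i)) \<partial>lborel) = (\<Prod>i\<in>UNIV. (\<integral>s. f i s \<partial>lborel))" .
  have "integrable (\<Pi>\<^sub>M b\<in>Basis. lborel) (\<lambda>h. \<Prod>b\<in>Basis. g b (h b))"
    by (intro product_integrable_prod intg) auto
  then show "integrable lborel (\<lambda>x::real^'n. \<Prod>i\<in>UNIV. f i (x $ i))"
    by (subst lborel_eq, subst integrable_distr_eq) (measurable, simp add: eq del: sum_component)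
qed

lemma gauss_vec: "gauss (x :: real^'n) = (\<Prod>i\<in>UNIV. exp (- (x $ i)\<^sup>2 / 2))"
  by (simp add: gauss_def norm_eq_sqrt_inner inner_vec_def exp_sum[symmetric] sum_nonneg
      sum_negf[symmetric] sum_divide_distrib power2_eq_square)

lemma cis_inner_vec: "cis ((x::real^'n) \<bullet> y) = (\<Prod>i\<in>UNIV. cis (x $ i * y $ i))"
  by (simp add: cis_conv_exp inner_vec_def exp_sum[symmetric] sum_distrib_left)

text \<open>This is (2 \<pi>)^(N/2); the type argument carries the dimension.\<close>

definition gauss_const :: "'n::finite itself \<Rightarrow> real" where
  "gauss_const _ = sqrt (2 * pi) ^ CARD('n)"

lemma gauss_const_pos: "0 < gauss_const TYPE('n::finite)"
  by (simp add: gauss_const_def)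

lemma integrable_cis_gauss: "integrable lborel (\<lambda>\<xi>::real^'n. complex_of_real (gauss \<xi>) * cis (x \<bullet> \<xi>))"
  and integral_cis_gauss: "(\<integral>(\<xi>::real^'n). complex_of_real (gauss \<xi>) * cis (x \<bullet> \<xi>) \<partial>lborel) = gauss_const TYPE('n) * gauss x"
proof -
  define f where "f i s = complex_of_real (exp (- s\<^sup>2 / 2)) * cis (x $ i * s)" for i s
  have f: "integrable lborel (f i)" for i unfolding f_def
    by (rule integrable_of_real_cis[OF integrable_gauss_real]) measurable
  have int_f: "(\<integral>s. f i s \<partial>lborel) = complex_of_real (sqrt (2 * pi) * exp (- (x $ i)\<^sup>2 / 2))" for i
    using integral_cis_gauss_real[of "x $ i"] by (simp add: f_def)
  have eq: "complex_of_real (gauss \<xi>) * cis (x \<bullet> \<xi>) = (\<Prod>i\<in>UNIV. f i (\<xi> $ i))" for \<xi> :: "real^'n"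
    by (simp add: f_def gauss_vec cis_inner_vec prod.distrib)
  show "integrable lborel (\<lambda>\<xi>::real^'n. complex_of_real (gauss \<xi>) * cis (x \<bullet> \<xi>))"
    unfolding eq by (rule integrable_lborel_vec_prod[OF f])
  show "(\<integral>(\<xi>::real^'n). complex_of_real (gauss \<xi>) * cis (x \<bullet> \<xi>) \<partial>lborel) = gauss_const TYPE('n) * gauss x"
    unfolding eq integral_lborel_vec_prod[OF f] int_f
    by (simp add: prod.distrib gauss_vec gauss_const_def)
qed

lemma integrable_cis_nth_gauss: "integrable lborel (\<lambda>\<xi>::real^'n. complex_of_real (\<xi> $ k * gauss \<xi>) * cis (x \<bullet> \<xi>))"
  and integral_cis_nth_gauss: "(\<integral>(\<xi>::real^'n). complex_of_real (\<xi> $ k * gauss \<xi>) * cis (x \<bullet> \<xi>) \<partial>lborel)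
     = \<i> * complex_of_real (gauss_const TYPE('n) * (x $ k * gauss x))"
proof -
  define f where "f i s = complex_of_real ((if i = k then s else 1) * exp (- s\<^sup>2 / 2)) * cis (x $ i * s)" for i s
  have f: "integrable lborel (f i)" for i unfolding f_def
    by (rule integrable_of_real_cis, cases "i = k")
       (use integrable_gauss_real integrable_id_gauss_real in auto)
  have int_f: "(\<integral>s. f i s \<partial>lborel) = (if i = k then \<i> * complex_of_real (x $ k) else 1)
      * complex_of_real (sqrt (2 * pi) * exp (- (x $ i)\<^sup>2 / 2))" for i
    using integral_cis_gauss_real[of "x $ i"] integral_cis_id_gauss_real[of "x $ i"]
    by (cases "i = k") (auto simp: f_def)
  have eq: "complex_of_real (\<xi> $ k * gauss \<xi>) * cis (x \<bullet> \<xi>) = (\<Prod>i\<in>UNIV. f i (\<xi> $ i))" for \<xi> :: "real^'n"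
  proof -
    have "(\<Prod>i\<in>UNIV. f i (\<xi> $ i)) = (\<Prod>i\<in>UNIV. (if i = k then complex_of_real (\<xi> $ i) else 1)
        * (complex_of_real (exp (- (\<xi> $ i)\<^sup>2 / 2)) * cis (x $ i * \<xi> $ i)))"
      by (intro prod.cong) (auto simp: f_def)
    also have "\<dots> = complex_of_real (\<xi> $ k) * (complex_of_real (gauss \<xi>) * cis (x \<bullet> \<xi>))"
      by (simp add: prod.distrib gauss_vec cis_inner_vec prod.delta)
    finally show ?thesis by simp
  qed
  show "integrable lborel (\<lambda>\<xi>::real^'n. complex_of_real (\<xi> $ k * gauss \<xi>) * cis (x \<bullet> \<xi>))"
    unfolding eq by (rule integrable_lborel_vec_prod[OF f])
  show "(\<integral>(\<xi>::real^'n). complex_of_real (\<xi> $ k * gauss \<xi>) * cis (x \<bullet> \<xi>) \<partial>lborel)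
     = \<i> * complex_of_real (gauss_const TYPE('n) * (x $ k * gauss x))"
    unfolding eq integral_lborel_vec_prod[OF f] int_f
    by (simp add: prod.distrib prod.delta gauss_vec gauss_const_def)
qed

lemma integrable_gauss: "integrable lborel (gauss :: real^'n \<Rightarrow> real)"
  and integral_gauss: "(\<integral>x. gauss (x :: real^'n) \<partial>lborel) = gauss_const TYPE('n)"
proof -
  have "integrable lborel (\<lambda>x::real^'n. complex_of_real (gauss x))"
    using integrable_cis_gauss[of 0] by simp
  then show "integrable lborel (gauss :: real^'n \<Rightarrow> real)" by (simp add: complex_of_real_integrable_eq)
  have "complex_of_real (\<integral>x. gauss (x :: real^'n) \<partial>lborel) = complex_of_real (gauss_const TYPE('n))"
    using integral_cis_gauss[of "0::real^'n"] by (simp add: gauss_def integral_complex_of_real)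
  then show "(\<integral>x. gauss (x :: real^'n) \<partial>lborel) = gauss_const TYPE('n)" by (simp only: of_real_eq_iff)
qed

lemma integrable_nth_gauss: "integrable lborel (\<lambda>x::real^'n. x $ k * gauss x)"
proof -
  have "integrable lborel (\<lambda>x::real^'n. complex_of_real (x $ k * gauss x))"
    using integrable_cis_nth_gauss[of k 0] by simp
  then show ?thesis by (simp only: complex_of_real_integrable_eq)
qed

section \<open>Transforms of integrable functions and convolution\<close>

text \<open>An inverse Fourier transform without normalising factor. Its sign is opposite to that of
  \<open>mfourier\<close> and \<open>ffourier\<close>, so convolving the transform with a measure
  multiplies \<Phi> by the Fourier transform of the measure.\<close>

definition ftrans :: "(real^'n \<Rightarrow> complex) \<Rightarrow> real^'n \<Rightarrow> complex" where
  "ftrans \<Phi> x = (\<integral>\<xi>. \<Phi> \<xi> * cis (x \<bullet> \<xi>) \<partial>lborel)"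

lemma integrable_trans:
  assumes "integrable lborel \<Phi>"
  shows "integrable lborel (\<lambda>\<xi>. \<Phi> \<xi> * cis (x \<bullet> \<xi>))"
  by (rule integrable_mult_bounded[where B=1]) (use assms in auto)

lemma borel_measurable_trans [measurable]:
  assumes [measurable]: "\<Phi> \<in> borel_measurable borel"
  shows "ftrans \<Phi> \<in> borel_measurable borel"
  unfolding ftrans_def by measurable

lemma norm_trans_le: "norm (ftrans \<Phi> x) \<le> (\<integral>\<xi>. norm (\<Phi> \<xi>) \<partial>lborel)"
  unfolding ftrans_def by (rule order_trans[OF integral_norm_bound]) (simp add: norm_mult)

lemma ftrans_cmult: "ftrans (\<lambda>\<xi>. c * \<Phi> \<xi>) x = c * ftrans \<Phi> x"
  by (simp add: ftrans_def mult.assoc)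

lemma ftrans_add:
  assumes "integrable lborel \<Phi>" "integrable lborel \<Psi>"
  shows "ftrans (\<lambda>\<xi>. \<Phi> \<xi> + \<Psi> \<xi>) x = ftrans \<Phi> x + ftrans \<Psi> x"
  unfolding ftrans_def
  using Bochner_Integration.integral_add[OF integrable_trans[OF assms(1), of x] integrable_trans[OF assms(2), of x]]
  by (simp add: distrib_right)

lemma cis_inner_diff: "cis ((x - y) \<bullet> z) = cis (x \<bullet> z) * cis (- (y \<bullet> z))"
  by (simp add: cis_mult inner_diff_left)

text \<open>Fubini. The density \<open>g\<close> against \<open>M\<close> makes one statement cover
  finite measures (\<open>g\<close> constant 1) as well as integrable kernels (\<open>M\<close>
  Lebesgue measure).\<close>

lemma ftrans_convolution:
  fixes \<Phi> :: "real^'n \<Rightarrow> complex"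
  assumes M: "sigma_finite_measure M" and sets [measurable_cong]: "sets M = sets borel"
    and g: "integrable M g" and \<Phi>: "integrable lborel \<Phi>"
  shows "(\<integral>y. g y * ftrans \<Phi> (x - y) \<partial>M) = ftrans (\<lambda>\<xi>. (\<integral>y. g y * cis (- (y \<bullet> \<xi>)) \<partial>M) * \<Phi> \<xi>) x"
proof -
  interpret M: sigma_finite_measure M by fact
  interpret pair_sigma_finite M "lborel :: (real^'n) measure" ..
  have [measurable]: "\<Phi> \<in> borel_measurable borel" "g \<in> borel_measurable M"
    using g \<Phi> by (auto simp: borel_measurable_integrable)
  have int: "integrable (M \<Otimes>\<^sub>M lborel) (\<lambda>(y, \<xi>). g y * (\<Phi> \<xi> * cis ((x - y) \<bullet> \<xi>)))"
  proof (rule Fubini_integrable)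
    have "(\<lambda>y. \<integral>\<xi>. norm (case (y, \<xi>) of (y, \<xi>) \<Rightarrow> g y * (\<Phi> \<xi> * cis ((x - y) \<bullet> \<xi>))) \<partial>lborel)
        = (\<lambda>y. norm (g y) * (\<integral>\<xi>. norm (\<Phi> \<xi>) \<partial>lborel))"
      by (simp add: norm_mult)
    then show "integrable M (\<lambda>y. \<integral>\<xi>. norm (case (y, \<xi>) of (y, \<xi>) \<Rightarrow> g y * (\<Phi> \<xi> * cis ((x - y) \<bullet> \<xi>))) \<partial>lborel)"
      using g by simp
    show "AE y in M. integrable lborel (\<lambda>\<xi>. case (y, \<xi>) of (y, \<xi>) \<Rightarrow> g y * (\<Phi> \<xi> * cis ((x - y) \<bullet> \<xi>)))"
      using integrable_trans[OF \<Phi>] by auto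
  qed measurable
  have "(\<integral>y. g y * ftrans \<Phi> (x - y) \<partial>M) = (\<integral>y. (\<integral>\<xi>. g y * (\<Phi> \<xi> * cis ((x - y) \<bullet> \<xi>)) \<partial>lborel) \<partial>M)"
    by (simp add: ftrans_def)
  also have "\<dots> = (\<integral>\<xi>. (\<integral>y. g y * (\<Phi> \<xi> * cis ((x - y) \<bullet> \<xi>)) \<partial>M) \<partial>lborel)"
    by (rule Fubini_integral[symmetric]) (rule int)
  also have "\<dots> = (\<integral>\<xi>. (\<integral>y. (g y * cis (- (y \<bullet> \<xi>))) * (\<Phi> \<xi> * cis (x \<bullet> \<xi>)) \<partial>M) \<partial>lborel)"
    by (intro Bochner_Integration.integral_cong refl) (simp add: cis_inner_diff mult_ac del: inner_diff_left)
  also have "\<dots> = ftrans (\<lambda>\<xi>. (\<integral>y. g y * cis (- (y \<bullet> \<xi>)) \<partial>M) * \<Phi> \<xi>) x"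
    unfolding ftrans_def by (simp, simp only: mult_ac)
  finally show ?thesis .
qed

lemma mconv_trans:
  fixes \<Phi> :: "real^'n \<Rightarrow> complex"
  assumes "finite_measure \<mu>" and [measurable_cong]: "sets \<mu> = sets borel" and "integrable lborel \<Phi>"
  shows "(\<integral>y. ftrans \<Phi> (x - y) \<partial>\<mu>) = ftrans (\<lambda>\<xi>. mfourier \<mu> \<xi> * \<Phi> \<xi>) x"
proof -
  interpret finite_measure \<mu> by fact
  show ?thesis
    using ftrans_convolution[of \<mu> "\<lambda>_. 1" \<Phi> x] assms by (simp add: mfourier_def sigma_finite_measure_axioms)
qed

text \<open>The substitution \<xi> = s \<eta> in the self-reproducing formula; the denominator
  collects the normalisation and the Jacobian s^N.\<close>

lemma gauss_scaleR_trans: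
  fixes w :: "real^'n"
  assumes s: "s > 0"
  defines "\<Psi> \<equiv> \<lambda>\<xi>::real^'n. complex_of_real (gauss ((1 / s) *\<^sub>R \<xi>) / (gauss_const TYPE('n) * s ^ CARD('n)))"
  shows "integrable lborel \<Psi>" "complex_of_real (gauss (s *\<^sub>R w)) = ftrans \<Psi> w"
proof -
  let ?f = "\<lambda>\<eta>::real^'n. complex_of_real (gauss \<eta>) * cis ((s *\<^sub>R w) \<bullet> \<eta>)"
  have "integrable lborel (\<lambda>\<xi>::real^'n. gauss ((1 / s) *\<^sub>R \<xi>))"
    by (rule integrable_lborel_scaleR[OF integrable_gauss]) (use s in auto)
  then show "integrable lborel \<Psi>" unfolding \<Psi>_def by (simp add: complex_of_real_integrable_eq del: of_real_divide)
  have "complex_of_real (gauss_const TYPE('n) * gauss (s *\<^sub>R w)) = (\<integral>\<eta>. ?f \<eta> \<partial>lborel)"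
    unfolding integral_cis_gauss by simp
  also have "\<dots> = \<bar>1 / s\<bar> ^ DIM(real^'n) *\<^sub>R (\<integral>\<xi>. ?f ((1 / s) *\<^sub>R \<xi>) \<partial>lborel)"
    by (rule integral_lborel_scaleR) (use s in auto)
  also have "(\<integral>\<xi>. ?f ((1 / s) *\<^sub>R \<xi>) \<partial>lborel) = (\<integral>\<xi>. complex_of_real (gauss_const TYPE('n) * s ^ CARD('n)) * (\<Psi> \<xi> * cis (w \<bullet> \<xi>)) \<partial>lborel)"
    using s gauss_const_pos[where 'n='n]
    by (intro Bochner_Integration.integral_cong) (auto simp: \<Psi>_def)
  also have "\<dots> = complex_of_real (gauss_const TYPE('n) * s ^ CARD('n)) * ftrans \<Psi> w"
    by (simp add: ftrans_def)
  finally show "complex_of_real (gauss (s *\<^sub>R w)) = ftrans \<Psi> w"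
    using s gauss_const_pos[where 'n='n] by (simp add: scaleR_conv_of_real power_divide)
qed

lemma abs_mult_gauss_le: "\<bar>a\<bar> \<le> B \<Longrightarrow> \<bar>a * gauss x\<bar> \<le> B"
  using mult_mono[of "\<bar>a\<bar>" B "gauss x" 1] gauss_le_1[of x] by (simp add: abs_mult)

text \<open>Cut off and mollified by Gaussians, a bounded continuous function becomes the transform of an
  integrable one; a single parameter suffices for both operations.\<close>

definition reg :: "nat \<Rightarrow> (real^'n \<Rightarrow> real) \<Rightarrow> real^'n \<Rightarrow> real" where
  "reg n h x = real (Suc n) ^ CARD('n) / gauss_const TYPE('n) *
     (\<integral>y. gauss (real (Suc n) *\<^sub>R (x - y)) * (h y * gauss ((1 / real (Suc n)) *\<^sub>R y)) \<partial>lborel)"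

text \<open>The substitution y = x - z/(n+1) moves all dependence on \<open>n\<close> into a factor
  bounded like \<open>h\<close>; both the uniform bound and the limit are read off from this
  form.\<close>

lemma reg_eq:
  fixes h :: "real^'n \<Rightarrow> real"
  assumes [measurable]: "h \<in> borel_measurable borel"
  shows "reg n h x = (1 / gauss_const TYPE('n)) * (\<integral>z. gauss z * (h (x - (1 / real (Suc n)) *\<^sub>R z)
      * gauss ((1 / real (Suc n)) *\<^sub>R (x - (1 / real (Suc n)) *\<^sub>R z))) \<partial>lborel)"
proof -
  let ?s = "real (Suc n)"
  let ?F = "\<lambda>y. gauss (?s *\<^sub>R (x - y)) * (h y * gauss ((1 / ?s) *\<^sub>R y))"
  have "(\<integral>y. ?F y \<partial>lborel) = (\<integral>y. ?F (x - y) \<partial>lborel)"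
    by (rule integral_lborel_minus[symmetric]) measurable
  also have "\<dots> = \<bar>1 / ?s\<bar> ^ DIM(real^'n) *\<^sub>R (\<integral>z. ?F (x - (1 / ?s) *\<^sub>R z) \<partial>lborel)"
    by (rule integral_lborel_scaleR) auto
  finally have "(\<integral>y. ?F y \<partial>lborel) = (1 / ?s ^ CARD('n)) * (\<integral>z. ?F (x - (1 / ?s) *\<^sub>R z) \<partial>lborel)"
    by (simp add: power_divide del: of_nat_Suc)
  then show ?thesis unfolding reg_def by (simp del: of_nat_Suc)
qed

lemma abs_reg_le:
  fixes h :: "real^'n \<Rightarrow> real"
  assumes [measurable]: "h \<in> borel_measurable borel" and B: "\<And>x. \<bar>h x\<bar> \<le> B"
  shows "\<bar>reg n h x\<bar> \<le> B"
proof -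
  have B0: "0 \<le> B" using B[of 0] by simp
  let ?g = "\<lambda>z. h (x - (1 / real (Suc n)) *\<^sub>R z) * gauss ((1 / real (Suc n)) *\<^sub>R (x - (1 / real (Suc n)) *\<^sub>R z))"
  have g: "\<bar>?g z\<bar> \<le> B" for z
    by (rule abs_mult_gauss_le[OF B])
  have "\<bar>\<integral>z. gauss z * ?g z \<partial>lborel\<bar> \<le> (\<integral>z. \<bar>gauss z * ?g z\<bar> \<partial>lborel)" by (rule integral_abs_bound)
  also have "\<dots> \<le> (\<integral>(z::real^'n). gauss z * B \<partial>lborel)"
  proof (rule integral_mono)
    show "integrable lborel (\<lambda>z. \<bar>gauss z * ?g z\<bar>)"
      by (intro integrable_abs integrable_mult_bounded[OF integrable_gauss, where B=B]) (use g in auto)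
    show "integrable lborel (\<lambda>z::real^'n. gauss z * B)" by (intro integrable_mult_left integrable_gauss)
    show "\<bar>gauss z * ?g z\<bar> \<le> gauss z * B" for z
      using mult_left_mono[OF g[of z], of "gauss z"] by (simp add: abs_mult)
  qed
  also have "\<dots> = gauss_const TYPE('n) * B" by (simp add: integral_gauss)
  finally show ?thesis unfolding reg_eq[OF assms(1)] abs_mult
    using gauss_const_pos[where 'n='n] by (simp add: field_simps)
qed

lemma reg_tendsto:
  fixes h :: "real^'n \<Rightarrow> real"
  assumes cont: "continuous_on UNIV h" and B: "\<And>x. \<bar>h x\<bar> \<le> B"
  shows "(\<lambda>n. reg n h x) \<longlonglongrightarrow> h x"
proof -
  have [measurable]: "h \<in> borel_measurable borel" using cont by (rule borel_measurable_continuous_onI)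
  have B0: "0 \<le> B" using B[of 0] by simp
  let ?g = "\<lambda>n z. h (x - (1 / real (Suc n)) *\<^sub>R z) * gauss ((1 / real (Suc n)) *\<^sub>R (x - (1 / real (Suc n)) *\<^sub>R z))"
  have "(\<lambda>n. (\<integral>z. gauss z * ?g n z \<partial>lborel)) \<longlonglongrightarrow> (\<integral>(z::real^'n). gauss z * h x \<partial>lborel)"
  proof (rule integral_dominated_convergence)
    show "integrable lborel (\<lambda>z::real^'n. gauss z * B)" by (intro integrable_mult_left integrable_gauss)
    show "AE z in lborel. norm (gauss z * ?g n z) \<le> gauss z * B" for n
      using mult_left_mono[OF abs_mult_gauss_le[OF B] gauss_nonneg] by (auto simp: abs_mult mult.assoc)
    show "AE z in lborel. (\<lambda>n. gauss z * ?g n z) \<longlonglongrightarrow> gauss z * h x"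
    proof (rule AE_I2)
      fix z :: "real^'n"
      have s: "(\<lambda>n. 1 / real (Suc n)) \<longlonglongrightarrow> 0" using LIMSEQ_inverse_real_of_nat by (simp add: inverse_eq_divide)
      have a: "(\<lambda>n. x - (1 / real (Suc n)) *\<^sub>R z) \<longlonglongrightarrow> x - 0 *\<^sub>R z"
        by (intro tendsto_intros s)
      have b: "(\<lambda>n. (1 / real (Suc n)) *\<^sub>R (x - (1 / real (Suc n)) *\<^sub>R z)) \<longlonglongrightarrow> 0 *\<^sub>R (x - 0 *\<^sub>R z)"
        by (intro tendsto_intros s)
      have "(\<lambda>n. gauss z * ?g n z) \<longlonglongrightarrow> gauss z * (h (x - 0 *\<^sub>R z) * gauss (0 *\<^sub>R (x - 0 *\<^sub>R z)))"
      proof (intro tendsto_intros)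
        show "(\<lambda>n. h (x - (1 / real (Suc n)) *\<^sub>R z)) \<longlonglongrightarrow> h (x - 0 *\<^sub>R z)"
          using cont a by (intro isCont_tendsto_compose[of _ h]) (auto simp: continuous_on_eq_continuous_at)
        have "continuous_on UNIV (gauss :: real^'n \<Rightarrow> real)" by (intro continuous_intros)
        then show "(\<lambda>n. gauss ((1 / real (Suc n)) *\<^sub>R (x - (1 / real (Suc n)) *\<^sub>R z))) \<longlonglongrightarrow> gauss (0 *\<^sub>R (x - 0 *\<^sub>R z))"
          using b by (intro isCont_tendsto_compose[of _ gauss]) (auto simp: continuous_on_eq_continuous_at)
      qed
      then show "(\<lambda>n. gauss z * ?g n z) \<longlonglongrightarrow> gauss z * h x" by (simp add: gauss_def)
    qed
  qed auto
  then have "(\<lambda>n. (1 / gauss_const TYPE('n)) * (\<integral>z. gauss z * ?g n z \<partial>lborel)) \<longlonglongrightarrow>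
      (1 / gauss_const TYPE('n)) * (\<integral>(z::real^'n). gauss z * h x \<partial>lborel)"
    by (intro tendsto_intros)
  then show ?thesis
    using gauss_const_pos[where 'n='n] unfolding reg_eq[OF \<open>h \<in> borel_measurable borel\<close>, symmetric]
    by (simp add: integral_gauss)
qed

text \<open>The wide Gaussian makes the cut-off function integrable and the narrow one is itself a
  transform, so their convolution is again a transform.\<close>

lemma reg_trans:
  fixes h :: "real^'n \<Rightarrow> real"
  assumes [measurable]: "h \<in> borel_measurable borel" and B: "\<And>x. \<bar>h x\<bar> \<le> B"
  obtains \<Phi> where "integrable lborel \<Phi>" "\<And>x. complex_of_real (reg n h x) = ftrans \<Phi> x"
proof -
  let ?s = "real (Suc n)"
  have s: "?s > 0" by simp
  define \<Psi> where "\<Psi> = (\<lambda>\<xi>::real^'n. complex_of_real (gauss ((1 / ?s) *\<^sub>R \<xi>) / (gauss_const TYPE('n) * ?s ^ CARD('n))))"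
  note \<Psi> = gauss_scaleR_trans[where 'n='n, OF s, folded \<Psi>_def]
  define g where "g y = complex_of_real (h y * gauss ((1 / ?s) *\<^sub>R y))" for y
  have "integrable lborel (\<lambda>y::real^'n. gauss ((1 / ?s) *\<^sub>R y))"
    by (rule integrable_lborel_scaleR[OF integrable_gauss]) (use s in auto)
  then have "integrable lborel (\<lambda>y. gauss ((1 / ?s) *\<^sub>R y) * h y)"
    by (rule integrable_mult_bounded[where B=B]) (use B in auto)
  then have g: "integrable lborel g" unfolding g_def by (simp only: complex_of_real_integrable_eq mult.commute)
  define c where "c = complex_of_real (?s ^ CARD('n) / gauss_const TYPE('n))"
  define \<Phi> where "\<Phi> \<xi> = c * ((\<integral>y. g y * cis (- (y \<bullet> \<xi>)) \<partial>lborel) * \<Psi> \<xi>)" for \<xi>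
  have "complex_of_real (reg n h x) = ftrans \<Phi> x" for x
  proof -
    have "complex_of_real (reg n h x) = c * (\<integral>y. g y * ftrans \<Psi> (x - y) \<partial>lborel)"
      unfolding reg_def c_def of_real_mult integral_complex_of_real[symmetric] g_def
      by (simp add: \<Psi>(2)[symmetric] mult_ac del: of_nat_Suc)
    also have "\<dots> = ftrans \<Phi> x" unfolding \<Phi>_def
      by (subst ftrans_convolution[OF _ _ g \<Psi>(1)]) (auto simp: ftrans_cmult sigma_finite_lborel)
    finally show ?thesis .
  qed
  moreover have "integrable lborel \<Phi>"
  proof -
    have [measurable]: "g \<in> borel_measurable borel" using g by (simp add: borel_measurable_integrable)
    have "integrable lborel (\<lambda>\<xi>. \<Psi> \<xi> * (\<integral>y. g y * cis (- (y \<bullet> \<xi>)) \<partial>lborel))"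
    proof (rule integrable_mult_bounded[OF \<Psi>(1), where B="\<integral>y. norm (g y) \<partial>lborel"])
      show "norm (\<integral>y. g y * cis (- (y \<bullet> \<xi>)) \<partial>lborel) \<le> (\<integral>y. norm (g y) \<partial>lborel)" for \<xi>
        by (rule order_trans[OF integral_norm_bound]) (simp add: norm_mult)
    qed measurable
    then show ?thesis unfolding \<Phi>_def by (intro integrable_mult_right) (simp only: mult.commute)
  qed
  ultimately show ?thesis using that by blast
qed

lemma xk_decreasing_gauss_scaleR: "xk_decreasing k (\<lambda>w::real^'n. gauss (s *\<^sub>R w))"
  unfolding xk_decreasing_def
proof (intro conjI allI impI)
  show "gauss (s *\<^sub>R reflN k x) = gauss (s *\<^sub>R x)" for x :: "real^'n"
    by (simp add: reflN_scaleR[symmetric])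
  fix z :: "real^'n" and r t :: real assume "0 < r \<and> r \<le> t"
  then have "norm (s *\<^sub>R upd z k r) \<le> norm (s *\<^sub>R upd z k t)"
    by (intro norm_le_componentwise_cart) (auto simp: upd_def abs_mult intro!: mult_left_mono)
  then show "gauss (s *\<^sub>R upd z k t) \<le> gauss (s *\<^sub>R upd z k r)"
    unfolding gauss_def by (simp add: power_mono)
qed

text \<open>The cutoff is even and positive, and the mollifier is even and decreasing in the k-th
  coordinate, so neither operation leaves the cone.\<close>

lemma cone_reg:
  fixes h :: "real^'n \<Rightarrow> real"
  assumes h: "cone k h" "\<And>x. \<bar>h x\<bar> \<le> B"
  shows "cone k (reg n h)"
proof -
  let ?s = "real (Suc n)"
  have B0: "0 \<le> B" using h(2)[of 0] by simp
  have [measurable]: "h \<in> borel_measurable borel" using h(1) by (rule cone_measurable)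
  have "cone k (\<lambda>x. \<integral>y. gauss (?s *\<^sub>R (x - y)) * (h y * gauss ((1 / ?s) *\<^sub>R y)) \<partial>lborel)"
  proof (rule cone_convolution[OF xk_decreasing_gauss_scaleR])
    show "integrable lborel (\<lambda>w::real^'n. gauss (?s *\<^sub>R w))"
      by (rule integrable_lborel_scaleR[OF integrable_gauss]) auto
    show "cone k (\<lambda>y. h y * gauss ((1 / ?s) *\<^sub>R y))"
      using h(1) by (auto simp: cone_def reflN_scaleR[symmetric] simp del: of_nat_Suc)
    show "\<bar>h x * gauss ((1 / ?s) *\<^sub>R x)\<bar> \<le> B" for x
      by (rule abs_mult_gauss_le[OF h(2)])
  qed
  then show ?thesis
    using gauss_const_pos[where 'n='n] unfolding cone_def reg_def by (auto simp: less_imp_le)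
qed

lemma integral_reg_tendsto:
  fixes h :: "real^'n \<Rightarrow> real"
  assumes "finite_measure \<mu>" and [measurable_cong]: "sets \<mu> = sets borel"
    and h: "continuous_on UNIV h" "\<And>x. \<bar>h x\<bar> \<le> B"
  shows "(\<lambda>n. \<integral>y. reg n h (x - y) \<partial>\<mu>) \<longlonglongrightarrow> (\<integral>y. h (x - y) \<partial>\<mu>)"
proof -
  interpret finite_measure \<mu> by fact
  have [measurable]: "h \<in> borel_measurable borel" using h(1) by (rule borel_measurable_continuous_onI)
  have [measurable]: "reg n h \<in> borel_measurable borel" for n unfolding reg_def by measurable
  show ?thesis
    by (rule integral_dominated_convergence[where w="\<lambda>_. B"]) (use reg_tendsto[OF h] abs_reg_le[of h B, OF _ h(2)] in auto)
qed

text \<open>Integrals of transforms depend on the measure through \<open>mfourier\<close> alone, and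
  regularisations of bounded continuous functions are transforms converging boundedly. The reflected
  function \<open>h\<close> writes the integral of \<phi> as a convolution at the point 0.\<close>

lemma measure_eqI_mfourier:
  fixes \<mu> \<nu> :: "(real^'n) measure"
  assumes \<mu>: "finite_measure \<mu>" "sets \<mu> = sets borel" and \<nu>: "finite_measure \<nu>" "sets \<nu> = sets borel"
    and eq: "\<And>\<xi>. mfourier \<mu> \<xi> = mfourier \<nu> \<xi>"
  shows "\<mu> = \<nu>"
proof (rule measure_eqI_continuous)
  fix \<phi> :: "real^'n \<Rightarrow> real" assume \<phi>: "continuous_on UNIV \<phi>" "bounded (range \<phi>)"
  then obtain B where B: "\<And>x. \<bar>\<phi> x\<bar> \<le> B" by (auto simp: bounded_iff)
  define h where "h y = \<phi> (- y)" for y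
  have h: "continuous_on UNIV h" "\<And>x. \<bar>h x\<bar> \<le> B"
    unfolding h_def using B by (auto intro!: continuous_on_compose2[OF \<phi>(1)] continuous_intros)
  have [measurable]: "h \<in> borel_measurable borel" using h(1) by (rule borel_measurable_continuous_onI)
  have "(\<integral>y. reg n h (0 - y) \<partial>\<mu>) = (\<integral>y. reg n h (0 - y) \<partial>\<nu>)" for n
  proof -
    obtain \<Phi> where \<Phi>: "integrable lborel \<Phi>" "\<And>x. complex_of_real (reg n h x) = ftrans \<Phi> x"
      using reg_trans[of h B n] h(2) by auto
    have "complex_of_real (\<integral>y. reg n h (0 - y) \<partial>\<mu>) = complex_of_real (\<integral>y. reg n h (0 - y) \<partial>\<nu>)"
      unfolding integral_complex_of_real[symmetric] \<Phi>(2) mconv_trans[OF \<mu> \<Phi>(1)] mconv_trans[OF \<nu> \<Phi>(1)] eq ..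
    then show ?thesis by (simp only: of_real_eq_iff)
  qed
  then have "(\<integral>y. h (0 - y) \<partial>\<mu>) = (\<integral>y. h (0 - y) \<partial>\<nu>)"
    using integral_reg_tendsto[OF \<mu> h, of 0] integral_reg_tendsto[OF \<nu> h, of 0] by (simp add: LIMSEQ_unique)
  then show "integral\<^sup>L \<mu> \<phi> = integral\<^sup>L \<nu> \<phi>" by (simp add: h_def)
qed fact+

section \<open>Fourier multipliers preserving the cone\<close>

text \<open>The cone seen from the frequency side. Membership in
  \<open>\<real>\<^sub>\<ge>\<^sub>0\<close> includes that the transform is real on the
  half-space.\<close>

definition tcone :: "'n \<Rightarrow> (real^'n \<Rightarrow> complex) \<Rightarrow> bool" where
  "tcone k \<Phi> \<longleftrightarrow> integrable lborel \<Phi> \<and> (\<forall>x. ftrans \<Phi> (reflN k x) = - ftrans \<Phi> x) \<and>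
     (\<forall>x. 0 < x $ k \<longrightarrow> ftrans \<Phi> x \<in> \<real>\<^sub>\<ge>\<^sub>0)"

text \<open>Stability is asked on transforms of integrable functions, where a multiplier acts
  without reference to any kernel. Boundedness of \<open>m\<close> keeps the products
  integrable.\<close>

definition cone_mult :: "'n \<Rightarrow> (real^'n \<Rightarrow> complex) \<Rightarrow> bool" where
  "cone_mult k m \<longleftrightarrow> m \<in> borel_measurable borel \<and> (\<exists>B. \<forall>\<xi>. norm (m \<xi>) \<le> B) \<and>
     (\<forall>\<Phi>. tcone k \<Phi> \<longrightarrow> tcone k (\<lambda>\<xi>. m \<xi> * \<Phi> \<xi>))"

lemma integrable_bounded_mult:
  fixes f :: "'a \<Rightarrow> complex"
  assumes "integrable M f" "g \<in> borel_measurable M" "\<And>x. norm (g x) \<le> B"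
  shows "integrable M (\<lambda>x. g x * f x)"
  using integrable_mult_bounded[OF assms(1,2), of B] assms(3) by (simp add: mult.commute)


lemma tcone_lim:
  assumes \<Phi>: "\<And>n. tcone k (\<Phi> n)" and int: "integrable lborel \<Psi>"
    and lim: "\<And>x. (\<lambda>n::nat. ftrans (\<Phi> n) x) \<longlonglongrightarrow> ftrans \<Psi> x"
  shows "tcone k \<Psi>"
  unfolding tcone_def
proof (intro conjI allI impI int)
  fix x
  have "(\<lambda>n. ftrans (\<Phi> n) (reflN k x)) \<longlonglongrightarrow> - ftrans \<Psi> x"
    using tendsto_minus[OF lim[of x]] \<Phi> by (simp add: tcone_def)
  then show "ftrans \<Psi> (reflN k x) = - ftrans \<Psi> x" using lim by (rule LIMSEQ_unique[rotated])
  assume "0 < x $ k"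
  then show "ftrans \<Psi> x \<in> \<real>\<^sub>\<ge>\<^sub>0"
    using \<Phi> by (intro Lim_in_closed_set[OF closed_nonneg_Reals_complex _ _ lim[of x]]) (auto simp: tcone_def)
qed

section \<open>Closure properties of the multipliers\<close>

lemma cone_mult_const: "c \<ge> 0 \<Longrightarrow> cone_mult k (\<lambda>_. complex_of_real c)"
  by (auto simp: cone_mult_def tcone_def ftrans_cmult)

lemma cone_mult_add:
  assumes "cone_mult k m" "cone_mult k m'"
  shows "cone_mult k (\<lambda>\<xi>. m \<xi> + m' \<xi>)"
proof -
  obtain B B' where B: "\<And>\<xi>. norm (m \<xi>) \<le> B" "\<And>\<xi>. norm (m' \<xi>) \<le> B'"
    using assms by (auto simp: cone_mult_def)
  have "norm (m \<xi> + m' \<xi>) \<le> B + B'" for \<xi> by (rule norm_triangle_mono[OF B])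
  moreover have "tcone k (\<lambda>\<xi>. (m \<xi> + m' \<xi>) * \<Phi> \<xi>)" if "tcone k \<Phi>" for \<Phi>
  proof -
    have "tcone k (\<lambda>\<xi>. m \<xi> * \<Phi> \<xi>)" "tcone k (\<lambda>\<xi>. m' \<xi> * \<Phi> \<xi>)"
      using assms that by (auto simp: cone_mult_def)
    then show ?thesis by (simp add: tcone_def distrib_right ftrans_add)
  qed
  ultimately show ?thesis using assms by (auto simp: cone_mult_def)
qed

lemma cone_mult_mult:
  assumes "cone_mult k m" "cone_mult k m'"
  shows "cone_mult k (\<lambda>\<xi>. m \<xi> * m' \<xi>)"
proof -
  obtain B B' where B: "\<And>\<xi>. norm (m \<xi>) \<le> B" "\<And>\<xi>. norm (m' \<xi>) \<le> B'"
    using assms by (auto simp: cone_mult_def)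
  have "norm (m \<xi> * m' \<xi>) \<le> B * B'" for \<xi>
    using B norm_ge_zero[of "m \<xi>"] by (simp add: norm_mult) (metis B mult_mono norm_ge_zero order_trans)
  moreover have "tcone k (\<lambda>\<xi>. (m \<xi> * m' \<xi>) * \<Phi> \<xi>)" if "tcone k \<Phi>" for \<Phi>
    using assms that unfolding cone_mult_def by (simp add: mult.assoc)
  ultimately show ?thesis using assms by (auto simp: cone_mult_def)
qed

text \<open>The common bound gives a dominating function \<open>B * norm (\<Phi> \<xi>)\<close>, so
  the transforms converge at every point, and the conditions of \<open>tcone\<close> are closed
  under pointwise limits.\<close>

lemma cone_mult_lim:
  assumes m: "\<And>n. cone_mult k (m n)" and B: "\<And>n \<xi>. norm (m n \<xi>) \<le> B"
    and lim: "\<And>\<xi>. (\<lambda>n::nat. m n \<xi>) \<longlonglongrightarrow> m' \<xi>"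
  shows "cone_mult k m'"
proof -
  have meas [measurable]: "m n \<in> borel_measurable borel" for n using m by (auto simp: cone_mult_def)
  have [measurable]: "m' \<in> borel_measurable borel"
    by (rule borel_measurable_LIMSEQ_metric[OF meas lim])
  have B': "norm (m' \<xi>) \<le> B" for \<xi>
    by (rule Lim_bounded[OF tendsto_norm[OF lim[of \<xi>]], of 0]) (use B in auto)
  have "tcone k (\<lambda>\<xi>. m' \<xi> * \<Phi> \<xi>)" if \<Phi>: "tcone k \<Phi>" for \<Phi>
  proof (rule tcone_lim)
    have int: "integrable lborel \<Phi>" using \<Phi> by (simp add: tcone_def)
    then have [measurable]: "\<Phi> \<in> borel_measurable borel" by (simp add: borel_measurable_integrable)
    show "tcone k (\<lambda>\<xi>. m n \<xi> * \<Phi> \<xi>)" for n using m[of n] \<Phi> by (auto simp: cone_mult_def)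
    show "integrable lborel (\<lambda>\<xi>. m' \<xi> * \<Phi> \<xi>)"
      by (rule integrable_bounded_mult[OF int]) (use B' in auto)
    show "(\<lambda>n. ftrans (\<lambda>\<xi>. m n \<xi> * \<Phi> \<xi>) x) \<longlonglongrightarrow> ftrans (\<lambda>\<xi>. m' \<xi> * \<Phi> \<xi>) x" for x
      unfolding ftrans_def
    proof (rule integral_dominated_convergence)
      show "integrable lborel (\<lambda>\<xi>. B * norm (\<Phi> \<xi>))" using int by (intro integrable_mult_right integrable_norm)
      show "AE \<xi> in lborel. norm (m n \<xi> * \<Phi> \<xi> * cis (x \<bullet> \<xi>)) \<le> B * norm (\<Phi> \<xi>)" for n
        using B by (intro AE_I2) (simp add: norm_mult mult_right_mono)
      show "AE \<xi> in lborel. (\<lambda>n. m n \<xi> * \<Phi> \<xi> * cis (x \<bullet> \<xi>)) \<longlonglongrightarrow> m' \<xi> * \<Phi> \<xi> * cis (x \<bullet> \<xi>)"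
        by (intro AE_I2 tendsto_intros lim)
    qed measurable
  qed
  then show ?thesis using B' by (auto simp: cone_mult_def)
qed

lemma cone_mult_power: "cone_mult k m \<Longrightarrow> cone_mult k (\<lambda>\<xi>. m \<xi> ^ n)"
proof (induction n)
  case 0
  then show ?case using cone_mult_const[of 1 k] by simp
next
  case (Suc n)
  then show ?case using cone_mult_mult[of k m "\<lambda>\<xi>. m \<xi> ^ n"] by simp
qed

text \<open>The Taylor polynomials of the exponential have nonnegative coefficients, and along a
  bounded multiplier they are uniformly bounded by \<open>exp B\<close>.\<close>

lemma cone_mult_exp:
  assumes m: "cone_mult k m"
  shows "cone_mult k (\<lambda>\<xi>. exp (m \<xi>))"
proof -
  obtain B where B: "\<And>\<xi>. norm (m \<xi>) \<le> B" using m by (auto simp: cone_mult_def)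
  have B0: "0 \<le> B" using B[of 0] norm_ge_zero order_trans by blast
  show ?thesis
  proof (rule cone_mult_lim)
    show "cone_mult k (\<lambda>\<xi>. \<Sum>i<n. m \<xi> ^ i /\<^sub>R fact i)" for n
    proof (induction n)
      case 0
      then show ?case using cone_mult_const[of 0 k] by simp
    next
      case (Suc n)
      have "cone_mult k (\<lambda>\<xi>. complex_of_real (inverse (fact n)) * m \<xi> ^ n)"
        by (intro cone_mult_mult cone_mult_const cone_mult_power m) auto
      then have "cone_mult k (\<lambda>\<xi>. (\<Sum>i<n. m \<xi> ^ i /\<^sub>R fact i) + complex_of_real (inverse (fact n)) * m \<xi> ^ n)"
        by (rule cone_mult_add[OF Suc])
      then show ?case by (simp add: scaleR_conv_of_real)
    qed
    show "(\<lambda>n. \<Sum>i<n. m \<xi> ^ i /\<^sub>R fact i) \<longlonglongrightarrow> exp (m \<xi>)" for \<xi>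
      using exp_converges[of "m \<xi>"] by (simp add: sums_def)
    show "norm (\<Sum>i<n. m \<xi> ^ i /\<^sub>R fact i) \<le> exp B" for n \<xi>
    proof -
      have "norm (\<Sum>i<n. m \<xi> ^ i /\<^sub>R fact i) \<le> (\<Sum>i<n. norm (m \<xi> ^ i /\<^sub>R fact i))" by (rule norm_sum)
      also have "\<dots> \<le> (\<Sum>i<n. B ^ i /\<^sub>R fact i)"
        by (intro sum_mono) (auto simp: norm_power intro!: mult_left_mono power_mono B)
      also have "\<dots> \<le> (\<Sum>i. B ^ i /\<^sub>R fact i)"
        by (rule sum_le_suminf[OF sums_summable[OF exp_converges]]) (use B0 in auto)
      also have "\<dots> = exp B" by (simp add: exp_def)
      finally show ?thesis .
    qed
  qed
qed

lemma complex_integral_nonneg_Reals: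
  fixes f :: "'a \<Rightarrow> complex"
  assumes f: "integrable M f" and nn: "\<And>x. f x \<in> \<real>\<^sub>\<ge>\<^sub>0"
  shows "(\<integral>x. f x \<partial>M) \<in> \<real>\<^sub>\<ge>\<^sub>0"
proof -
  have "f x = complex_of_real (Re (f x))" "0 \<le> Re (f x)" for x
    using nn[of x] by (auto simp: complex_nonneg_Reals_iff complex_eq_iff)
  then have "f = (\<lambda>x. complex_of_real (Re (f x)))" and nn: "\<And>x. 0 \<le> Re (f x)" by auto
  then have "(\<integral>x. f x \<partial>M) = complex_of_real (\<integral>x. Re (f x) \<partial>M)"
    by (metis integral_complex_of_real)
  moreover have "0 \<le> (\<integral>x. Re (f x) \<partial>M)" using nn by (simp add: integral_nonneg_AE)
  ultimately show ?thesis by simp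
qed

text \<open>By Fubini the transform of a mixture is the mixture of the transforms, with nonnegative
  weights. The cone property is asked where the weight is positive, the bound by 1 at every
  \<open>s\<close>.\<close>

lemma cone_mult_mixture:
  fixes w :: "real \<Rightarrow> real" and m :: "real \<Rightarrow> real^'n \<Rightarrow> complex"
  assumes w: "integrable lborel w" "\<And>s. 0 \<le> w s"
    and m: "\<And>s. 0 < w s \<Longrightarrow> cone_mult k (m s)" and m1: "\<And>s \<xi>. norm (m s \<xi>) \<le> 1"
    and meas [measurable]: "(\<lambda>(s, \<xi>). m s \<xi>) \<in> borel_measurable (borel \<Otimes>\<^sub>M borel)"
  shows "cone_mult k (\<lambda>\<xi>. \<integral>s. complex_of_real (w s) * m s \<xi> \<partial>lborel)"
proof -
  have [measurable]: "w \<in> borel_measurable borel" using w by (simp add: borel_measurable_integrable)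
  have int1: "integrable lborel (\<lambda>s. complex_of_real (w s) * m s \<xi>)" for \<xi>
    by (rule integrable_mult_bounded[where B=1]) (use w m1 in auto)
  have bd: "norm (\<integral>s. complex_of_real (w s) * m s \<xi> \<partial>lborel) \<le> (\<integral>s. w s \<partial>lborel)" for \<xi>
  proof -
    have "norm (\<integral>s. complex_of_real (w s) * m s \<xi> \<partial>lborel) \<le> (\<integral>s. norm (complex_of_real (w s) * m s \<xi>) \<partial>lborel)"
      by (rule integral_norm_bound)
    also have "\<dots> \<le> (\<integral>s. w s \<partial>lborel)"
      by (rule integral_mono[OF integrable_norm[OF int1] w(1)])
         (use mult_left_mono[OF m1 w(2)] w(2) in \<open>auto simp: norm_mult\<close>)
    finally show ?thesis .
  qed
  have "tcone k (\<lambda>\<xi>. (\<integral>s. complex_of_real (w s) * m s \<xi> \<partial>lborel) * \<Phi> \<xi>)" if \<Phi>: "tcone k \<Phi>" for \<Phi>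
  proof -
    have int\<Phi>: "integrable lborel \<Phi>" using \<Phi> by (simp add: tcone_def)
    then have [measurable]: "\<Phi> \<in> borel_measurable borel" by (simp add: borel_measurable_integrable)
    have int2: "integrable (lborel \<Otimes>\<^sub>M lborel) (\<lambda>(s, \<xi>). complex_of_real (w s) * (m s \<xi> * \<Phi> \<xi> * cis (x \<bullet> \<xi>)))" for x
    proof (rule Bochner_Integration.integrable_bound)
      have "integrable (lborel \<Otimes>\<^sub>M lborel) (\<lambda>(s, \<xi>). w s * norm (\<Phi> \<xi>))"
        by (rule lborel_pair.Fubini_integrable) (use w int\<Phi> in \<open>auto simp: abs_mult\<close>)
      then show "integrable (lborel \<Otimes>\<^sub>M lborel) (\<lambda>(s, \<xi>). w s * norm (\<Phi> \<xi>))" .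
      show "AE p in lborel \<Otimes>\<^sub>M lborel. norm (case p of (s, \<xi>) \<Rightarrow> complex_of_real (w s) * (m s \<xi> * \<Phi> \<xi> * cis (x \<bullet> \<xi>)))
          \<le> norm (case p of (s, \<xi>) \<Rightarrow> w s * norm (\<Phi> \<xi>))"
        using m1 w(2) by (intro AE_I2) (auto simp: norm_mult intro!: mult_left_mono mult_left_le_one_le)
    qed measurable
    have eq: "ftrans (\<lambda>\<xi>. (\<integral>s. complex_of_real (w s) * m s \<xi> \<partial>lborel) * \<Phi> \<xi>) x
      = (\<integral>s. complex_of_real (w s) * ftrans (\<lambda>\<xi>. m s \<xi> * \<Phi> \<xi>) x \<partial>lborel)" for x
    proof -
      have "ftrans (\<lambda>\<xi>. (\<integral>s. complex_of_real (w s) * m s \<xi> \<partial>lborel) * \<Phi> \<xi>) x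
         = (\<integral>\<xi>. (\<integral>s. complex_of_real (w s) * (m s \<xi> * \<Phi> \<xi> * cis (x \<bullet> \<xi>)) \<partial>lborel) \<partial>lborel)"
        unfolding ftrans_def
      proof (intro Bochner_Integration.integral_cong refl)
        fix \<xi>
        have "(\<integral>s. complex_of_real (w s) * m s \<xi> \<partial>lborel) * \<Phi> \<xi> * cis (x \<bullet> \<xi>)
           = (\<integral>s. complex_of_real (w s) * m s \<xi> * (\<Phi> \<xi> * cis (x \<bullet> \<xi>)) \<partial>lborel)" by simp
        then show "(\<integral>s. complex_of_real (w s) * m s \<xi> \<partial>lborel) * \<Phi> \<xi> * cis (x \<bullet> \<xi>)
           = (\<integral>s. complex_of_real (w s) * (m s \<xi> * \<Phi> \<xi> * cis (x \<bullet> \<xi>)) \<partial>lborel)" by (simp only: mult.assoc)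
      qed
      also have "\<dots> = (\<integral>s. (\<integral>\<xi>. complex_of_real (w s) * (m s \<xi> * \<Phi> \<xi> * cis (x \<bullet> \<xi>)) \<partial>lborel) \<partial>lborel)"
        by (rule lborel_pair.Fubini_integral[OF int2])
      also have "\<dots> = (\<integral>s. complex_of_real (w s) * ftrans (\<lambda>\<xi>. m s \<xi> * \<Phi> \<xi>) x \<partial>lborel)"
        by (simp add: ftrans_def)
      finally show ?thesis .
    qed
    have m\<Phi>: "tcone k (\<lambda>\<xi>. m s \<xi> * \<Phi> \<xi>)" if "w s \<noteq> 0" for s
      using m[of s] w(2)[of s] that \<Phi> by (auto simp: cone_mult_def)
    have int3: "integrable lborel (\<lambda>s. complex_of_real (w s) * ftrans (\<lambda>\<xi>. m s \<xi> * \<Phi> \<xi>) x)" for x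
      using lborel_pair.integrable_fst[OF int2[of x]] by (simp add: ftrans_def)
    show ?thesis unfolding tcone_def
    proof (intro conjI allI impI)
      show "integrable lborel (\<lambda>\<xi>. (\<integral>s. complex_of_real (w s) * m s \<xi> \<partial>lborel) * \<Phi> \<xi>)"
        by (rule integrable_bounded_mult[OF int\<Phi> _ bd]) measurable
      fix x
      have "complex_of_real (w s) * ftrans (\<lambda>\<xi>. m s \<xi> * \<Phi> \<xi>) (reflN k x)
          = - (complex_of_real (w s) * ftrans (\<lambda>\<xi>. m s \<xi> * \<Phi> \<xi>) x)" for s
        using m\<Phi>[of s] by (cases "w s = 0") (auto simp: tcone_def)
      then show "ftrans (\<lambda>\<xi>. (\<integral>s. complex_of_real (w s) * m s \<xi> \<partial>lborel) * \<Phi> \<xi>) (reflN k x)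
        = - ftrans (\<lambda>\<xi>. (\<integral>s. complex_of_real (w s) * m s \<xi> \<partial>lborel) * \<Phi> \<xi>) x"
        unfolding eq by simp
      assume x: "0 < x $ k"
      have "complex_of_real (w s) * ftrans (\<lambda>\<xi>. m s \<xi> * \<Phi> \<xi>) x \<in> \<real>\<^sub>\<ge>\<^sub>0" for s
        using m\<Phi>[of s] x w(2)[of s] by (cases "w s = 0") (auto simp: tcone_def intro!: nonneg_Reals_mult_I)
      then show "ftrans (\<lambda>\<xi>. (\<integral>s. complex_of_real (w s) * m s \<xi> \<partial>lborel) * \<Phi> \<xi>) x \<in> \<real>\<^sub>\<ge>\<^sub>0"
        unfolding eq using int3 by (intro complex_integral_nonneg_Reals)
    qed
  qed
  then show ?thesis using bd by (auto simp: cone_mult_def)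
qed

text \<open>Reality on the lower half-space comes from oddness, and on the hyperplane oddness forces
  the value 0.\<close>

lemma cone_Re_trans:
  assumes "tcone k \<Phi>"
  shows "cone k (\<lambda>x. Re (ftrans \<Phi> x))" "ftrans \<Phi> x = complex_of_real (Re (ftrans \<Phi> x))"
proof -
  have [measurable]: "\<Phi> \<in> borel_measurable borel"
    using assms by (auto simp: tcone_def borel_measurable_integrable)
  show "cone k (\<lambda>x. Re (ftrans \<Phi> x))"
    using assms by (auto simp: tcone_def cone_def complex_nonneg_Reals_iff)
  show "ftrans \<Phi> x = complex_of_real (Re (ftrans \<Phi> x))"
  proof (cases "x $ k" "0 :: real" rule: linorder_cases)
    case less
    then have "0 < reflN k x $ k" by simp
    then have "ftrans \<Phi> (reflN k x) \<in> \<real>\<^sub>\<ge>\<^sub>0" using assms unfolding tcone_def by blast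
    then have "- ftrans \<Phi> x \<in> \<real>\<^sub>\<ge>\<^sub>0" using assms by (simp add: tcone_def)
    then show ?thesis by (auto simp: complex_nonneg_Reals_iff complex_eq_iff)
  next
    case equal
    then have "ftrans \<Phi> x = - ftrans \<Phi> x" using assms reflN_fixed[of x k] unfolding tcone_def by metis
    then show ?thesis by simp
  next
    case greater
    then have "ftrans \<Phi> x \<in> \<real>\<^sub>\<ge>\<^sub>0" using assms by (simp add: tcone_def)
    then show ?thesis by (auto simp: complex_nonneg_Reals_iff complex_eq_iff)
  qed
qed

section \<open>Multipliers of the three operators\<close>

lemma norm_ffourier_le: "norm (ffourier J \<xi>) \<le> (\<integral>x. \<bar>J x\<bar> \<partial>lborel)"
  unfolding ffourier_def by (rule order_trans[OF integral_norm_bound]) (simp add: norm_mult)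

lemma borel_measurable_ffourier:
  assumes [measurable]: "J \<in> borel_measurable borel"
  shows "ffourier J \<in> borel_measurable borel"
  unfolding ffourier_def by measurable

text \<open>On the transforms this multiplier acts as convolution with \<open>J\<close>, which
  preserves the cone by the method of images.\<close>

lemma cone_mult_ffourier:
  assumes J: "xk_decreasing k J" "integrable lborel J"
  shows "cone_mult k (ffourier J)"
proof -
  have [measurable]: "J \<in> borel_measurable borel" using J by (simp add: borel_measurable_integrable)
  note borel_measurable_ffourier[of J, measurable]
  have "tcone k (\<lambda>\<xi>. ffourier J \<xi> * \<Phi> \<xi>)" if \<Phi>: "tcone k \<Phi>" for \<Phi>
  proof -
    have int\<Phi>: "integrable lborel \<Phi>" using \<Phi> by (simp add: tcone_def)
    then have [measurable]: "\<Phi> \<in> borel_measurable borel" by (simp add: borel_measurable_integrable)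
    define f where "f x = Re (ftrans \<Phi> x)" for x
    have f: "cone k f" "\<And>x. ftrans \<Phi> x = complex_of_real (f x)"
      unfolding f_def using cone_Re_trans[OF \<Phi>] by auto
    have fb: "\<bar>f x\<bar> \<le> (\<integral>\<xi>. norm (\<Phi> \<xi>) \<partial>lborel)" for x
      unfolding f_def using abs_Re_le_cmod norm_trans_le order_trans by blast
    have [measurable]: "f \<in> borel_measurable borel" using f(1) by (rule cone_measurable)
    have eq: "ftrans (\<lambda>\<xi>. ffourier J \<xi> * \<Phi> \<xi>) x = complex_of_real (\<integral>y. J (x - y) * f y \<partial>lborel)" for x
    proof -
      have "ftrans (\<lambda>\<xi>. ffourier J \<xi> * \<Phi> \<xi>) x = (\<integral>y. complex_of_real (J y) * ftrans \<Phi> (x - y) \<partial>lborel)"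
        unfolding ffourier_def
        by (rule ftrans_convolution[symmetric]) (use J int\<Phi> in \<open>auto simp: sigma_finite_lborel complex_of_real_integrable_eq\<close>)
      also have "\<dots> = complex_of_real (\<integral>y. J y * f (x - y) \<partial>lborel)"
        by (simp only: f of_real_mult[symmetric] integral_complex_of_real)
      also have "(\<integral>y. J y * f (x - y) \<partial>lborel) = (\<integral>y. J (x - y) * f (x - (x - y)) \<partial>lborel)"
        by (rule integral_lborel_minus[symmetric]) measurable
      finally show ?thesis by simp
    qed
    have "cone k (\<lambda>x. \<integral>y. J (x - y) * f y \<partial>lborel)" by (rule cone_convolution[OF J f(1) fb])
    moreover have "integrable lborel (\<lambda>\<xi>. ffourier J \<xi> * \<Phi> \<xi>)"
      by (rule integrable_bounded_mult[OF int\<Phi> _ norm_ffourier_le]) measurable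
    ultimately show ?thesis by (auto simp: tcone_def eq cone_def)
  qed
  then show ?thesis using norm_ffourier_le[of J] by (auto simp: cone_mult_def)
qed

text \<open>The multiplier is the Fourier transform of the heat kernel at time \<open>s\<close>, a
  Gaussian of standard deviation \<open>sqrt (2 * s)\<close>. For \<open>s = 0\<close> that kernel
  degenerates to a point mass and the multiplier is constant.\<close>

lemma cone_mult_exp_norm_sq:
  assumes "s \<ge> 0"
  shows "cone_mult k (\<lambda>\<xi>::real^'n. complex_of_real (exp (- s * (norm \<xi>)\<^sup>2)))"
proof (cases "s = 0")
  case True
  then show ?thesis using cone_mult_const[of 1 k] by simp
next
  case False
  define r where "r = sqrt (2 * s)"
  have r: "r > 0" "r\<^sup>2 = 2 * s" using assms False by (auto simp: r_def)
  define J where "J = (\<lambda>\<xi>::real^'n. gauss ((1 / r) *\<^sub>R \<xi>) / (gauss_const TYPE('n) * r ^ CARD('n)))"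
  have int: "integrable lborel J"
    using gauss_scaleR_trans(1)[OF r(1), where 'n='n] unfolding J_def by (simp only: complex_of_real_integrable_eq)
  have dec: "xk_decreasing k J"
    using xk_decreasing_gauss_scaleR[of k "1 / r"] r(1) gauss_const_pos[where 'n='n]
    unfolding xk_decreasing_def J_def by (auto intro!: divide_right_mono)
  have "ffourier J \<xi> = complex_of_real (exp (- s * (norm \<xi>)\<^sup>2))" for \<xi>
  proof -
    have "ffourier J \<xi> = ftrans (\<lambda>\<xi>. complex_of_real (J \<xi>)) (- \<xi>)"
      by (simp add: ffourier_def ftrans_def inner_commute)
    also have "\<dots> = complex_of_real (gauss (r *\<^sub>R (- \<xi>)))"
      using gauss_scaleR_trans(2)[OF r(1), of "- \<xi>"] unfolding J_def by simp
    also have "gauss (r *\<^sub>R (- \<xi>)) = exp (- s * (norm \<xi>)\<^sup>2)"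
      using r by (simp add: gauss_def power_mult_distrib)
    finally show ?thesis .
  qed
  then have "ffourier J = (\<lambda>\<xi>. complex_of_real (exp (- s * (norm \<xi>)\<^sup>2)))" by (rule ext)
  then show ?thesis using cone_mult_ffourier[OF dec int] by simp
qed

text \<open>Near 0 the bound 1 - e^(-s) \<le> s leaves s^(-b), integrable since b < 1; towards
  infinity s^(-1-b) is integrable since b > 0.\<close>

lemma integrable_stable_kernel:
  fixes b :: real
  assumes "0 < b" "b < 1"
  shows "integrable lborel (\<lambda>s. indicator {0<..} s * ((1 - exp (- s)) * s powr (-1 - b)))"
proof (rule Bochner_Integration.integrable_bound)
  have i0: "integrable lborel (\<lambda>s. indicator {0..1} s *\<^sub>R (s powr (- b)))"
  proof -
    have "(\<lambda>s. s powr (- b)) integrable_on {0..1::real}"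
      by (rule integrable_on_powr_from_0) (use assms in auto)
    then have "set_integrable lebesgue {0..1} (\<lambda>s::real. s powr (- b))"
      by (intro nonnegative_absolutely_integrable_1) auto
    then show ?thesis unfolding set_integrable_def
      by (subst (asm) integrable_completion) auto
  qed
  have i1: "integrable lborel (\<lambda>s. indicator {1..} s *\<^sub>R (s powr (-1 - b)))"
  proof -
    have "(\<lambda>s. s powr (-1 - b)) integrable_on {1::real..}"
      unfolding integrable_on_def using has_integral_powr_to_inf[of "-1 - b" 1] assms by auto
    then have "set_integrable lebesgue {1..} (\<lambda>s::real. s powr (-1 - b))"
      by (intro nonnegative_absolutely_integrable_1) auto
    then show ?thesis unfolding set_integrable_def
      by (subst (asm) integrable_completion) auto
  qed
  show "integrable lborel (\<lambda>s. indicator {0..1} s *\<^sub>R (s powr (- b)) + indicator {1..} s *\<^sub>R (s powr (-1 - b)))"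
    by (rule Bochner_Integration.integrable_add[OF i0 i1])
  show "AE s in lborel. norm (indicator {0<..} s * ((1 - exp (- s)) * s powr (-1 - b)))
     \<le> norm (indicator {0..1} s *\<^sub>R (s powr (- b)) + indicator {1..} s *\<^sub>R (s powr (-1 - b)))"
  proof (rule AE_I2)
    fix s :: real
    have nn: "0 \<le> 1 - exp (- s)" if "0 < s" using that by simp
    consider "s \<le> 0" | "0 < s" "s \<le> 1" | "1 < s" by linarith
    then show "norm (indicator {0<..} s * ((1 - exp (- s)) * s powr (-1 - b)))
       \<le> norm (indicator {0..1} s *\<^sub>R (s powr (- b)) + indicator {1..} s *\<^sub>R (s powr (-1 - b)))"
    proof cases
      case 2
      have "(1 - exp (- s)) * s powr (-1 - b) \<le> s * s powr (-1 - b)"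
        using exp_ge_add_one_self[of "- s"] by (intro mult_right_mono) auto
      also have "\<dots> = s powr (- b)" using 2 by (simp add: powr_mult_base)
      moreover have "-1 \<le> exp (-1::real)" by (rule order_trans[of _ 0]) auto
      ultimately show ?thesis using 2 nn by (auto simp: abs_mult indicator_def)
    next
      case 3
      have "(1 - exp (- s)) * s powr (-1 - b) \<le> 1 * s powr (-1 - b)"
        by (intro mult_right_mono) auto
      then show ?thesis using 3 nn by (auto simp: abs_mult indicator_def)
    qed auto
  qed
qed measurable

text \<open>The measure s^(-1-b) ds is homogeneous of degree -b, so dilating \<open>s\<close> by
  \<open>r\<close> extracts the factor \<open>r powr b\<close>.\<close>

lemma stable_integral_scaling:
  fixes b r :: real
  assumes "0 < b" "b < 1" "0 < r"
  defines "g \<equiv> \<lambda>r s. indicator {0<..} s * ((1 - exp (- s * r)) * s powr (-1 - b))"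
  shows "integrable lborel (g r)" "(\<integral>s. g r s \<partial>lborel) = r powr b * (\<integral>s. g 1 s \<partial>lborel)"
proof -
  have int1: "integrable lborel (g 1)" using integrable_stable_kernel[OF assms(1,2)] by (simp add: g_def)
  have eq: "g r s = r powr (1 + b) * g 1 (0 + r * s)" for s
  proof (cases "s > 0")
    case True
    have "s powr (-1 - b) = r powr (1 + b) * (r * s) powr (-1 - b)"
      using True assms by (simp add: powr_mult powr_add[symmetric] mult.assoc[symmetric])
    then show ?thesis using True assms by (simp add: g_def mult_ac)
  next
    case False
    then show ?thesis using assms by (auto simp: g_def indicator_def zero_less_mult_iff)
  qed
  have "integrable lborel (\<lambda>s. g 1 (0 + r * s))" using assms int1 by (subst lborel_integrable_real_affine_iff) auto
  then show "integrable lborel (g r)" unfolding eq[abs_def] by (rule integrable_mult_right)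
  have "(\<integral>s. g 1 s \<partial>lborel) = r * (\<integral>s. g 1 (0 + r * s) \<partial>lborel)"
    using lborel_integral_real_affine[of r "g 1" 0] assms by simp
  then show "(\<integral>s. g r s \<partial>lborel) = r powr b * (\<integral>s. g 1 s \<partial>lborel)"
    unfolding eq using assms by (simp add: powr_add)
qed

lemma stable_const_pos:
  fixes b :: real
  assumes "0 < b" "b < 1"
  shows "0 < (\<integral>s. indicator {0<..} s * ((1 - exp (- s * 1)) * s powr (-1 - b)) \<partial>lborel)" (is "0 < (\<integral>s. ?g s \<partial>lborel)")
proof -
  have int: "integrable lborel ?g" using integrable_stable_kernel[OF assms] by simp
  have nn: "0 \<le> ?g s" for s by (auto simp: indicator_def)
  have "(\<integral>s. ?g s \<partial>lborel) \<noteq> 0"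
  proof
    assume "(\<integral>s. ?g s \<partial>lborel) = 0"
    then have "AE s in lborel. ?g s = 0"
      using integral_nonneg_eq_0_iff_AE[OF int] nn by auto
    then have "AE s in lborel. s \<notin> {0<..<1::real}"
      by eventually_elim (auto simp: indicator_def)
    then have "emeasure lborel {0<..<1::real} = 0"
      by (subst (asm) AE_iff_measurable[of "{0<..<1}"]) auto
    then show False by simp
  qed
  moreover have "0 \<le> (\<integral>s. ?g s \<partial>lborel)" by (rule integral_nonneg_AE) (use nn in auto)
  ultimately show ?thesis by linarith
qed

text \<open>Subordination: \<open>r powr b\<close> is a multiple of the integral of \<open>(1 - exp (- s * r)) * s powr (-1 - b)\<close>;
  cutting off small \<open>s\<close> leaves a constant minus a mixture of Gaussians.\<close>

lemma cone_mult_stable: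
  assumes b: "0 < b" "b < 1" and t: "t \<ge> 0"
  shows "cone_mult k (\<lambda>\<xi>::real^'n. complex_of_real (exp (- t * ((norm \<xi>)\<^sup>2) powr b)))"
proof -
  define g where "g = (\<lambda>r s::real. indicator {0<..} s * ((1 - exp (- s * r)) * s powr (-1 - b)))"
  define c where "c = (\<integral>s. g 1 s \<partial>lborel)"
  have c: "c > 0" using stable_const_pos[OF b] by (simp add: c_def g_def)
  define \<tau> where "\<tau> = t / c"
  have \<tau>: "\<tau> \<ge> 0" "\<tau> * c = t" using c t by (auto simp: \<tau>_def)
  have g_int: "integrable lborel (g r)" and g_eq: "(\<integral>s. g r s \<partial>lborel) = r powr b * c" if "r \<ge> 0" for r
  proof -
    show "integrable lborel (g r)"
      using stable_integral_scaling(1)[OF b, of r] that by (cases "r = 0") (auto simp: g_def)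
    show "(\<integral>s. g r s \<partial>lborel) = r powr b * c"
      using stable_integral_scaling(2)[OF b, of r] that by (cases "r = 0") (auto simp: g_def c_def)
  qed
  \<comment> \<open>Cutting at 1/(n+1) makes the jump measure finite, which is what allows its
    constant part to be separated from its Gaussian part.\<close>
  define w where "w n s = indicator {1 / real (Suc n)..} s * (s powr (-1 - b))" for n and s :: real
  have w_int: "integrable lborel (w n)" for n
  proof -
    have "(\<lambda>s. s powr (-1 - b)) integrable_on {1 / real (Suc n)..}"
      unfolding integrable_on_def using has_integral_powr_to_inf[of "-1 - b" "1 / real (Suc n)"] b by auto
    then have "set_integrable lebesgue {1 / real (Suc n)..} (\<lambda>s::real. s powr (-1 - b))"
      by (intro nonnegative_absolutely_integrable_1) auto
    then show ?thesis unfolding set_integrable_def w_def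
      by (subst (asm) integrable_completion) (auto simp: real_scaleR_def)
  qed
  have w_nn: "0 \<le> w n s" for n s by (simp add: w_def)
  have [measurable]: "w n \<in> borel_measurable borel" for n using w_int[of n] by (simp add: borel_measurable_integrable)
  have w_pos: "0 < s" if "0 < w n s" for n s
  proof -
    have "1 / real (Suc n) \<le> s" using that by (cases "1 / real (Suc n) \<le> s") (auto simp: w_def)
    then show ?thesis by (rule less_le_trans[rotated]) simp
  qed
  \<comment> \<open>The value 0 for nonpositive \<open>s\<close> keeps the modulus at most 1
    everywhere, as the mixture rule asks; the weight vanishes there anyway.\<close>
  define e where "e s \<xi> = (if s > 0 then complex_of_real (exp (- s * (norm \<xi>)\<^sup>2)) else 0)" for s and \<xi> :: "real^'n"
  have w_exp_int: "integrable lborel (\<lambda>s. w n s * exp (- s * r))" if "r \<ge> 0" for n r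
  proof (rule Bochner_Integration.integrable_bound[OF w_int[of n]])
    show "AE s in lborel. norm (w n s * exp (- s * r)) \<le> norm (w n s)"
    proof (rule AE_I2)
      fix s show "norm (w n s * exp (- s * r)) \<le> norm (w n s)"
        using w_pos[of n s] w_nn[of n s] that
        by (cases "w n s = 0") (auto simp: abs_mult less_le intro!: mult_left_le)
    qed
  qed measurable
  define m where "m n \<xi> = (\<integral>s. complex_of_real (w n s) * e s \<xi> \<partial>lborel)" for n and \<xi> :: "real^'n"
  have m_mult: "cone_mult k (m n)" for n unfolding m_def
  proof (rule cone_mult_mixture[OF w_int w_nn])
    show "cone_mult k (e s)" if "0 < w n s" for s
      using cone_mult_exp_norm_sq[of s k] w_pos[OF that] unfolding e_def by simp
    show "norm (e s \<xi>) \<le> 1" for s \<xi> by (simp add: e_def)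
    show "(\<lambda>(s, \<xi>). e s \<xi>) \<in> borel_measurable (borel \<Otimes>\<^sub>M borel)" unfolding e_def by measurable
  qed
  have m_eq: "m n \<xi> = complex_of_real (\<integral>s. w n s * exp (- s * (norm \<xi>)\<^sup>2) \<partial>lborel)" for n \<xi>
  proof -
    have "m n \<xi> = (\<integral>s. complex_of_real (w n s * exp (- s * (norm \<xi>)\<^sup>2)) \<partial>lborel)"
      unfolding m_def
    proof (intro Bochner_Integration.integral_cong refl)
      fix s show "complex_of_real (w n s) * e s \<xi> = complex_of_real (w n s * exp (- s * (norm \<xi>)\<^sup>2))"
        using w_pos[of n s] w_nn[of n s] by (cases "w n s = 0") (auto simp: e_def)
    qed
    then show ?thesis by (simp only: integral_complex_of_real)
  qed
  define A where "A n = (\<integral>s. w n s \<partial>lborel)" for n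
  define \<psi> where "\<psi> n r = (\<integral>s. w n s * (1 - exp (- s * r)) \<partial>lborel)" for n r
  have \<psi>_eq: "\<psi> n r = A n - (\<integral>s. w n s * exp (- s * r) \<partial>lborel)" if "r \<ge> 0" for n r
    unfolding \<psi>_def A_def using Bochner_Integration.integral_diff[OF w_int[of n] w_exp_int[OF that, of n]]
    by (simp add: right_diff_distrib)
  have \<psi>_nn: "0 \<le> \<psi> n r" if "r \<ge> 0" for n r
    unfolding \<psi>_def
  proof (rule integral_nonneg_AE, rule AE_I2)
    fix s show "0 \<le> w n s * (1 - exp (- s * r))"
      using w_pos[of n s] w_nn[of n s] that by (cases "w n s = 0") (auto simp: less_le)
  qed
  have \<psi>_lim: "(\<lambda>n. \<psi> n r) \<longlonglongrightarrow> r powr b * c" if r: "r \<ge> 0" for r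
  proof -
    have "(\<lambda>n. \<psi> n r) \<longlonglongrightarrow> (\<integral>s. g r s \<partial>lborel)"
      unfolding \<psi>_def
    proof (rule integral_dominated_convergence)
      show "integrable lborel (\<lambda>s. g r s)" using g_int[OF r] .
      show "g r \<in> borel_measurable lborel" using g_int[OF r] by (rule borel_measurable_integrable)
      show "AE s in lborel. norm (w n s * (1 - exp (- s * r))) \<le> g r s" for n
      proof (rule AE_I2)
        fix s show "norm (w n s * (1 - exp (- s * r))) \<le> g r s"
          using w_pos[of n s] w_nn[of n s] r
          by (cases "w n s = 0") (auto simp: g_def w_def indicator_def abs_mult split: if_splits)
      qed
      show "AE s in lborel. (\<lambda>n. w n s * (1 - exp (- s * r))) \<longlonglongrightarrow> g r s"
      proof (rule AE_I2, rule tendsto_eventually)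
        fix s
        show "eventually (\<lambda>n. w n s * (1 - exp (- s * r)) = g r s) sequentially"
        proof (cases "s > 0")
          case True
          have "(\<lambda>n. 1 / real (Suc n)) \<longlonglongrightarrow> 0" using LIMSEQ_inverse_real_of_nat by (simp add: inverse_eq_divide)
          then have "eventually (\<lambda>n. 1 / real (Suc n) < s) sequentially"
            using True by (rule order_tendstoD(2))
          then show ?thesis by eventually_elim (use True in \<open>auto simp: w_def g_def\<close>)
        next
          case False
          then have "w n s = 0" "g r s = 0" for n using w_pos[of n s] w_nn[of n s] by (auto simp: g_def less_le)
          then show ?thesis by simp
        qed
      qed
    qed measurable
    then show ?thesis using g_eq[OF r] by simp
  qed
  \<comment> \<open>The compound Poisson form. The masses \<open>A n\<close> diverge, but each of
    them enters merely as a positive constant factor, while the exponents \<psi> converge.\<close>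
  have eq: "exp (complex_of_real \<tau> * m n \<xi>) * complex_of_real (exp (- \<tau> * A n))
      = complex_of_real (exp (- \<tau> * \<psi> n ((norm \<xi>)\<^sup>2)))" for n \<xi>
    unfolding m_eq of_real_mult[symmetric] exp_of_real exp_add[symmetric]
    by (simp add: \<psi>_eq exp_add[symmetric] algebra_simps del: of_real_mult)
  show ?thesis
  proof (rule cone_mult_lim)
    show "cone_mult k (\<lambda>\<xi>. complex_of_real (exp (- \<tau> * \<psi> n ((norm \<xi>)\<^sup>2))))" for n
      unfolding eq[symmetric]
      by (intro cone_mult_mult cone_mult_exp cone_mult_const m_mult \<tau>) auto
    show "norm (complex_of_real (exp (- \<tau> * \<psi> n ((norm \<xi>)\<^sup>2)))) \<le> 1" for n and \<xi> :: "real^'n"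
      using \<psi>_nn[of "(norm \<xi>)\<^sup>2" n] \<tau> by simp
    show "(\<lambda>n. complex_of_real (exp (- \<tau> * \<psi> n ((norm \<xi>)\<^sup>2)))) \<longlonglongrightarrow> complex_of_real (exp (- t * (norm \<xi>)\<^sup>2 powr b))" for \<xi> :: "real^'n"
    proof -
      have "(\<lambda>n. complex_of_real (exp (- \<tau> * \<psi> n ((norm \<xi>)\<^sup>2)))) \<longlonglongrightarrow> complex_of_real (exp (- \<tau> * ((norm \<xi>)\<^sup>2 powr b * c)))"
        by (intro tendsto_intros \<psi>_lim) auto
      moreover have "- \<tau> * ((norm \<xi>)\<^sup>2 powr b * c) = - t * (norm \<xi>)\<^sup>2 powr b"
        using \<tau>(2) by (metis mult.commute mult.left_commute mult_minus_left)
      ultimately show ?thesis by (simp only:)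
    qed
  qed
qed

text \<open>Integrals of simple functions are compared term by term, and the comparison passes to
  the supremum.\<close>

lemma nn_integral_mono_emeasure:
  assumes sets: "sets M = sets N" and le: "\<And>A. A \<in> sets M \<Longrightarrow> emeasure M A \<le> emeasure N A"
  shows "(\<integral>\<^sup>+x. f x \<partial>M) \<le> (\<integral>\<^sup>+x. f x \<partial>N)"
proof -
  have space: "space M = space N" by (rule sets_eq_imp_space_eq[OF sets])
  have sf: "simple_function M g \<longleftrightarrow> simple_function N g" for g :: "'a \<Rightarrow> ennreal"
    by (simp add: simple_function_def sets space)
  have "integral\<^sup>S M g \<le> integral\<^sup>S N g" if "simple_function M g" for g
    unfolding simple_integral_def space[symmetric]
    by (intro sum_mono mult_left_mono le simple_functionD(2)[OF that]) auto
  then show ?thesis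
    unfolding nn_integral_def by (intro SUP_mono) (auto simp: sf)
qed

text \<open>The Laplacian gives a Gaussian and the fractional Laplacian a stable symbol, with
  exponent \<beta>/2 because it acts on |\<xi>|^2. The convolution operator is bounded, so its
  symbol is e^(-t) times the exponential of a multiplier.\<close>

lemma cone_mult_generator:
  fixes J0 :: "real^'n \<Rightarrow> real"
  assumes beta: "0 < \<beta>" "\<beta> \<le> 2" and t: "0 \<le> t"
    and A: "(\<beta> = 2 \<and> (\<forall>\<xi>. J0 \<xi> = 1 - norm \<xi> ^ 2))
       \<or> (\<beta> < 2 \<and> (\<forall>\<xi>. J0 \<xi> = 1 - norm \<xi> powr \<beta>))
       \<or> (\<exists>J :: real^'n \<Rightarrow> real.
            (\<forall>x. 0 \<le> J x) \<and> integrable lborel J \<and> J \<in> borel_measurable lborel \<and>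
            (\<exists>C. AE x in lborel. \<bar>J x\<bar> \<le> C) \<and>
            (\<forall>\<xi>. complex_of_real (J0 \<xi>) = ffourier J \<xi>) \<and>
            (\<forall>x. J (reflN k x) = J x) \<and> (\<forall>x. J (reflP k x) = J x) \<and>
            (\<forall>z s t. 0 < s \<and> s \<le> t \<longrightarrow> J (upd z k t) \<le> J (upd z k s)))"
  shows "cone_mult k (\<lambda>\<xi>. exp (complex_of_real (t * (J0 \<xi> - 1))))"
  using A
proof (elim disjE)
  assume *: "\<beta> = 2 \<and> (\<forall>\<xi>. J0 \<xi> = 1 - norm \<xi> ^ 2)"
  show ?thesis using cone_mult_exp_norm_sq[OF t, of k] * by (simp add: exp_of_real[symmetric] del: of_real_mult)
next
  assume *: "\<beta> < 2 \<and> (\<forall>\<xi>. J0 \<xi> = 1 - norm \<xi> powr \<beta>)"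
  have "(norm \<xi>)\<^sup>2 powr (\<beta> / 2) = norm \<xi> powr \<beta>" for \<xi> :: "real^'n"
  proof (cases "\<xi> = 0")
    case False
    then have "(norm \<xi>)\<^sup>2 = norm \<xi> powr 2" by simp
    then show ?thesis by (simp only: powr_powr) simp
  qed (use beta in simp)
  then show ?thesis using cone_mult_stable[of "\<beta> / 2" t k] * beta t
    by (simp add: exp_of_real[symmetric] del: of_real_mult)
next
  assume "\<exists>J :: real^'n \<Rightarrow> real.
            (\<forall>x. 0 \<le> J x) \<and> integrable lborel J \<and> J \<in> borel_measurable lborel \<and>
            (\<exists>C. AE x in lborel. \<bar>J x\<bar> \<le> C) \<and>
            (\<forall>\<xi>. complex_of_real (J0 \<xi>) = ffourier J \<xi>) \<and>
            (\<forall>x. J (reflN k x) = J x) \<and> (\<forall>x. J (reflP k x) = J x) \<and>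
            (\<forall>z s t. 0 < s \<and> s \<le> t \<longrightarrow> J (upd z k t) \<le> J (upd z k s))"
  then obtain J :: "real^'n \<Rightarrow> real" where J: "integrable lborel J" "xk_decreasing k J"
    and J0: "\<And>\<xi>. complex_of_real (J0 \<xi>) = ffourier J \<xi>"
    by (auto simp: xk_decreasing_def)
  have "cone_mult k (\<lambda>\<xi>. complex_of_real (exp (- t)) * exp (complex_of_real t * ffourier J \<xi>))"
    by (intro cone_mult_mult cone_mult_const cone_mult_exp cone_mult_ffourier J) (use t in auto)
  moreover have "complex_of_real (exp (- t)) * exp (complex_of_real t * ffourier J \<xi>) = exp (complex_of_real (t * (J0 \<xi> - 1)))" for \<xi>
    unfolding J0[symmetric] exp_of_real[symmetric] exp_add[symmetric] by (simp add: algebra_simps)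
  ultimately show ?thesis by simp
qed

text \<open>The passage from continuous to Borel functions goes through open subsets of the half-space and
  outer regularity.\<close>

lemma cone_kernel_continuous:
  fixes \<mu> :: "(real^'n) measure"
  assumes \<mu>: "finite_measure \<mu>" "sets \<mu> = sets borel" and m: "cone_mult k (mfourier \<mu>)"
    and h: "cone k h" "continuous_on UNIV h" "\<And>x. \<bar>h x\<bar> \<le> B" and x: "0 < x $ k"
  shows "0 \<le> (\<integral>y. h (x - y) \<partial>\<mu>)"
proof (rule LIMSEQ_le_const[OF integral_reg_tendsto[OF \<mu> h(2,3), of x]], intro exI allI impI)
  fix n :: nat
  have [measurable]: "h \<in> borel_measurable borel" using h(1) by (rule cone_measurable)
  obtain \<Phi> where \<Phi>: "integrable lborel \<Phi>" "\<And>x. complex_of_real (reg n h x) = ftrans \<Phi> x"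
    using reg_trans[of h B n] h(3) by auto
  have "cone k (reg n h)" by (rule cone_reg[OF h(1,3)])
  then have "tcone k \<Phi>" using \<Phi>(1) by (auto simp: tcone_def \<Phi>(2)[symmetric] cone_def)
  then have "ftrans (\<lambda>\<xi>. mfourier \<mu> \<xi> * \<Phi> \<xi>) x \<in> \<real>\<^sub>\<ge>\<^sub>0"
    using m x unfolding cone_mult_def tcone_def by blast
  then have "complex_of_real (\<integral>y. reg n h (x - y) \<partial>\<mu>) \<in> \<real>\<^sub>\<ge>\<^sub>0"
    unfolding integral_complex_of_real[symmetric] \<Phi>(2) mconv_trans[OF \<mu> \<Phi>(1)] .
  then show "0 \<le> (\<integral>y. reg n h (x - y) \<partial>\<mu>)" by simp
qed

text \<open>The point is that on the half-space the law \<nu>1 of x - y dominates its mirror image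
  \<nu>2: an odd function is integrated against the difference of the two.\<close>

lemma cone_kernel:
  fixes \<mu> :: "(real^'n) measure"
  assumes \<mu>: "finite_measure \<mu>" "sets \<mu> = sets borel" and m: "cone_mult k (mfourier \<mu>)"
    and h: "cone k h" "\<And>x. \<bar>h x\<bar> \<le> B" and x: "0 < x $ k"
  shows "0 \<le> (\<integral>y. h (x - y) \<partial>\<mu>)"
proof -
  note [measurable_cong] = \<mu>(2)
  interpret finite_measure \<mu> by fact
  have [measurable]: "h \<in> borel_measurable borel" using h(1) by (rule cone_measurable)
  define \<nu>1 where "\<nu>1 = distr \<mu> borel (\<lambda>y. x - y)"
  define \<nu>2 where "\<nu>2 = distr \<mu> borel (\<lambda>y. reflN k (x - y))"
  interpret N1: finite_measure \<nu>1 unfolding \<nu>1_def by (rule finite_measure_distr) measurable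
  interpret N2: finite_measure \<nu>2 unfolding \<nu>2_def by (rule finite_measure_distr) measurable
  have sets: "sets \<nu>1 = sets borel" "sets \<nu>2 = sets borel" by (auto simp: \<nu>1_def \<nu>2_def)
  note [measurable_cong] = sets
  have H_open: "open (halfspace k)" unfolding halfspace_def
    by (intro open_Collect_less continuous_intros)
  then have [measurable]: "halfspace k \<in> sets borel" by simp
  have openU: "measure \<nu>2 U \<le> measure \<nu>1 U" if U: "open U" "U \<subseteq> halfspace k" for U
  proof -
    have [measurable]: "U \<in> sets borel" using U by simp
    have oa: "continuous_on UNIV (open_approx U n)" for n by (rule continuous_on_open_approx)
    have [measurable]: "open_approx U n \<in> borel_measurable borel" for n
      using oa by (rule borel_measurable_continuous_onI)
    \<comment> \<open>For \<open>U\<close> inside the half-space the reflected term vanishes there,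
      so this odd continuous function lies in the cone.\<close>
    define g where "g n z = open_approx U n z - open_approx U n (reflN k z)" for n z
    have g1: "\<bar>g n z\<bar> \<le> 1" for n z
      using open_approx_bounds[of U n z] open_approx_bounds[of U n "reflN k z"] unfolding g_def by linarith
    have nonneg: "0 \<le> (\<integral>y. g n (x - y) \<partial>\<mu>)" for n
    proof (rule cone_kernel_continuous[OF \<mu> m _ _ _ x])
      have "open_approx U n (reflN k z) = 0" if "0 < z $ k" for z
        using that U by (intro open_approx_outside) (auto simp: halfspace_def)
      then show "cone k (g n)"
        by (auto simp: cone_def g_def[abs_def] open_approx_bounds)
      show "continuous_on UNIV (g n)" unfolding g_def
        by (intro continuous_intros continuous_on_compose2[OF oa]) auto
      show "\<bar>g n z\<bar> \<le> 1" for z by (rule g1)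
    qed
    have "(\<lambda>n. \<integral>y. g n (x - y) \<partial>\<mu>) \<longlonglongrightarrow> (\<integral>y. indicat_real U (x - y) - indicat_real U (reflN k (x - y)) \<partial>\<mu>)"
    proof (rule integral_dominated_convergence[where w="\<lambda>_. 1"])
      show "AE y in \<mu>. norm (g n (x - y)) \<le> 1" for n
        using g1 by simp
      show "AE y in \<mu>. (\<lambda>n. g n (x - y)) \<longlonglongrightarrow> indicat_real U (x - y) - indicat_real U (reflN k (x - y))"
        unfolding g_def by (intro AE_I2 tendsto_diff open_approx_tendsto U)
    qed (auto simp: g_def[abs_def])
    then have "0 \<le> (\<integral>y. indicat_real U (x - y) - indicat_real U (reflN k (x - y)) \<partial>\<mu>)"
      using nonneg by (intro LIMSEQ_le_const) auto
    also have "\<dots> = (\<integral>y. indicat_real U (x - y) \<partial>\<mu>) - (\<integral>y. indicat_real U (reflN k (x - y)) \<partial>\<mu>)"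
      by (intro Bochner_Integration.integral_diff integrable_const_bound[where B=1]) auto
    also have "(\<integral>y. indicat_real U (x - y) \<partial>\<mu>) = measure \<nu>1 U"
    proof -
      have "measure \<nu>1 U = (\<integral>z. indicat_real U z \<partial>\<nu>1)" by (simp add: sets_eq_imp_space_eq[OF sets(1)])
      also have "\<dots> = (\<integral>y. indicat_real U (x - y) \<partial>\<mu>)" unfolding \<nu>1_def by (rule integral_distr) measurable
      finally show ?thesis by simp
    qed
    also have "(\<integral>y. indicat_real U (reflN k (x - y)) \<partial>\<mu>) = measure \<nu>2 U"
    proof -
      have "measure \<nu>2 U = (\<integral>z. indicat_real U z \<partial>\<nu>2)" by (simp add: sets_eq_imp_space_eq[OF sets(2)])
      also have "\<dots> = (\<integral>y. indicat_real U (reflN k (x - y)) \<partial>\<mu>)" unfolding \<nu>2_def by (rule integral_distr) measurable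
      finally show ?thesis by simp
    qed
    finally show ?thesis by simp
  qed
  have borelA: "emeasure \<nu>2 A \<le> emeasure \<nu>1 A" if A: "A \<in> sets borel" "A \<subseteq> halfspace k" for A
  proof -
    have "emeasure \<nu>1 A = (INF U \<in> {U. A \<subseteq> U \<and> open U}. emeasure \<nu>1 U)"
      by (rule outer_regular[OF sets(1) _ A(1)]) simp
    \<comment> \<open>An open superset supplied by outer regularity may leave the half-space, but
      its part inside still contains \<open>A\<close>.\<close>
    moreover have "emeasure \<nu>2 A \<le> emeasure \<nu>1 U" if "A \<subseteq> U" "open U" for U
    proof -
      have "emeasure \<nu>2 A \<le> emeasure \<nu>2 (U \<inter> halfspace k)"
        using that A H_open by (intro emeasure_mono) (auto simp: sets)
      also have "\<dots> \<le> emeasure \<nu>1 (U \<inter> halfspace k)"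
        using openU[of "U \<inter> halfspace k"] that H_open
        by (simp add: N1.emeasure_eq_measure N2.emeasure_eq_measure open_Int)
      also have "\<dots> \<le> emeasure \<nu>1 U" using that by (intro emeasure_mono) (auto simp: sets)
      finally show ?thesis .
    qed
    ultimately show ?thesis by (auto intro: INF_greatest)
  qed
  \<comment> \<open>The upper half of \<open>h\<close>; oddness recovers \<open>h\<close> as
    \<open>f\<close> minus its reflection, with both terms vanishing on the hyperplane.\<close>
  define f where "f z = indicator (halfspace k) z * h z" for z
  have f: "0 \<le> f z" "\<bar>f z\<bar> \<le> B" "h z = f z - f (reflN k z)" for z
  proof -
    show "0 \<le> f z" using cone_nonneg[OF h(1)] by (auto simp: f_def halfspace_def indicator_def)
    show "\<bar>f z\<bar> \<le> B" using h(2)[of z] by (auto simp: f_def indicator_def)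
    show "h z = f z - f (reflN k z)"
      using cone_odd[OF h(1)] cone_zero[OF h(1)] by (auto simp: f_def halfspace_def indicator_def not_less)
  qed
  have [measurable]: "f \<in> borel_measurable borel" unfolding f_def by measurable
  have "(\<integral>\<^sup>+z. ennreal (f z) \<partial>\<nu>2) \<le> (\<integral>\<^sup>+z. ennreal (f z) \<partial>\<nu>1)"
  proof -
    let ?D = "\<lambda>\<nu>. density \<nu> (indicator (halfspace k))"
    have D: "(\<integral>\<^sup>+z. ennreal (f z) \<partial>\<nu>) = (\<integral>\<^sup>+z. ennreal (f z) \<partial>?D \<nu>)"
      if [measurable_cong]: "sets \<nu> = sets borel" for \<nu> :: "(real^'n) measure"
      by (subst nn_integral_density) (auto simp: f_def indicator_def intro!: nn_integral_cong)
    have emD: "emeasure (?D \<nu>) A = emeasure \<nu> (halfspace k \<inter> A)"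
      if [measurable_cong]: "sets \<nu> = sets borel" and [measurable]: "A \<in> sets borel" for \<nu> :: "(real^'n) measure" and A
      by (simp add: emeasure_density indicator_inter_arith[symmetric])
    show ?thesis unfolding D[OF sets(1)] D[OF sets(2)]
      by (rule nn_integral_mono_emeasure) (auto simp: sets emD intro!: borelA)
  qed
  then have "(\<integral>\<^sup>+y. ennreal (f (reflN k (x - y))) \<partial>\<mu>) \<le> (\<integral>\<^sup>+y. ennreal (f (x - y)) \<partial>\<mu>)"
    unfolding \<nu>1_def \<nu>2_def by (simp add: nn_integral_distr)
  moreover have i: "integrable \<mu> (\<lambda>y. f (x - y))" "integrable \<mu> (\<lambda>y. f (reflN k (x - y)))"
    using f(2) by (auto intro!: integrable_const_bound[where B=B])
  ultimately have "(\<integral>y. f (reflN k (x - y)) \<partial>\<mu>) \<le> (\<integral>y. f (x - y) \<partial>\<mu>)"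
    using f(1) by (simp add: nn_integral_eq_integral integral_nonneg_AE)
  then show ?thesis unfolding f(3) using i by simp
qed

section \<open>The semigroup\<close>

text \<open>For an involution \<rho> the difference of \<phi> and \<phi> composed with \<rho> is an
  odd bounded continuous function, so evenness annihilates it.\<close>

lemma distr_eqI_meas_even:
  fixes \<mu> :: "(real^'n) measure"
  assumes \<mu>: "finite_measure \<mu>" "sets \<mu> = sets borel" and even: "meas_even \<rho> \<mu>"
    and \<rho>: "continuous_on UNIV \<rho>" "\<And>x. \<rho> (\<rho> x) = x"
  shows "distr \<mu> borel \<rho> = \<mu>"
proof (rule measure_eqI_continuous)
  note [measurable_cong] = \<mu>(2)
  interpret finite_measure \<mu> by fact
  have [measurable]: "\<rho> \<in> borel_measurable borel" using \<rho>(1) by (rule borel_measurable_continuous_onI)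
  show "finite_measure (distr \<mu> borel \<rho>)" by (rule finite_measure_distr) measurable
  fix \<phi> :: "real^'n \<Rightarrow> real" assume \<phi>: "continuous_on UNIV \<phi>" "bounded (range \<phi>)"
  have [measurable]: "\<phi> \<in> borel_measurable borel" using \<phi>(1) by (rule borel_measurable_continuous_onI)
  obtain B where B: "\<And>x. \<bar>\<phi> x\<bar> \<le> B" using \<phi>(2) by (auto simp: bounded_iff)
  have i: "integrable \<mu> \<phi>" "integrable \<mu> (\<lambda>x. \<phi> (\<rho> x))"
    using B by (auto intro!: integrable_const_bound[where B=B])
  have "(\<integral>x. \<phi> x - \<phi> (\<rho> x) \<partial>\<mu>) = 0"
  proof (rule even[unfolded meas_even_def, rule_format])
    show "continuous_on UNIV (\<lambda>x. \<phi> x - \<phi> (\<rho> x))"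
      using \<phi>(1) \<rho>(1) by (intro continuous_intros) (auto intro: continuous_on_compose2)
    show "bounded (range (\<lambda>x. \<phi> x - \<phi> (\<rho> x)))"
    proof (rule boundedI)
      fix z assume "z \<in> range (\<lambda>x. \<phi> x - \<phi> (\<rho> x))"
      then obtain x where "z = \<phi> x - \<phi> (\<rho> x)" by auto
      then show "norm z \<le> B + B" using B[of x] B[of "\<rho> x"] by simp
    qed
  qed (simp add: \<rho>(2))
  then show "integral\<^sup>L (distr \<mu> borel \<rho>) \<phi> = integral\<^sup>L \<mu> \<phi>"
    using i by (simp add: integral_distr)
qed (use assms in auto)

text \<open>This includes parameters \<open>x\<close> at which \<open>f x\<close> is not integrable and the integral has the value 0.\<close>

lemma integral_measurable_kernel:
  fixes f :: "'a \<Rightarrow> 'b \<Rightarrow> real"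
  assumes f [measurable]: "(\<lambda>(x, y). f x y) \<in> borel_measurable (M \<Otimes>\<^sub>M N)"
    and L [measurable]: "L \<in> measurable M (subprob_algebra N)"
  shows "(\<lambda>x. \<integral>y. f x y \<partial>L x) \<in> borel_measurable M"
proof -
  note [measurable] = nn_integral_measurable_subprob_algebra2
  have *: "(\<integral>y. f x y \<partial>L x) = (if (\<integral>\<^sup>+y. ennreal \<bar>f x y\<bar> \<partial>L x) < \<infinity> then
      enn2real (\<integral>\<^sup>+y. ennreal (f x y) \<partial>L x) - enn2real (\<integral>\<^sup>+y. ennreal (- f x y) \<partial>L x) else 0)"
    if x: "x \<in> space M" for x
  proof -
    have "f x \<in> borel_measurable N" using measurable_Pair2[OF f x] by simp
    then have [measurable]: "f x \<in> borel_measurable (L x)"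
      by (subst measurable_cong_sets[OF subprob_measurableD(2)[OF L x] refl])
    have "integrable (L x) (f x) \<longleftrightarrow> (\<integral>\<^sup>+y. ennreal \<bar>f x y\<bar> \<partial>L x) < \<infinity>"
      by (simp add: integrable_iff_bounded)
    then show ?thesis using real_lebesgue_integral_def[of "L x" "f x"] not_integrable_integral_eq[of "L x" "f x"]
      by auto
  qed
  have "(\<lambda>x. if (\<integral>\<^sup>+y. ennreal \<bar>f x y\<bar> \<partial>L x) < \<infinity> then
      enn2real (\<integral>\<^sup>+y. ennreal (f x y) \<partial>L x) - enn2real (\<integral>\<^sup>+y. ennreal (- f x y) \<partial>L x) else 0) \<in> borel_measurable M"
    by measurable
  then show ?thesis by (subst measurable_cong[OF *]) auto
qed

section \<open>Operators of a symmetric convolution semigroup\<close>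

text \<open>Measurability over the whole time axis lets \<open>Q (t - s)\<close> stand in iterated
  integrals without restricting \<open>s\<close>. Symmetry under \<open>uminus\<close> gives
  self-adjointness, symmetry under \<open>reflN k\<close> keeps odd functions odd, and
  \<open>Q_cone\<close> is the positivity won from the multipliers.\<close>

locale kernel_semigroup =
  fixes Q :: "real \<Rightarrow> (real^'n) measure" and k :: 'n
  assumes Q_meas [measurable]: "Q \<in> measurable borel (prob_algebra borel)"
    and Q_0: "Q 0 = return borel 0"
    and Q_add: "0 \<le> s \<Longrightarrow> 0 \<le> t \<Longrightarrow> distr (Q s \<Otimes>\<^sub>M Q t) borel (\<lambda>(x, y). x + y) = Q (s + t)"
    and Q_uminus: "distr (Q t) borel uminus = Q t"
    and Q_reflN: "distr (Q t) borel (reflN k) = Q t"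
    and Q_cone: "cone k f \<Longrightarrow> (\<And>x. \<bar>f x\<bar> \<le> B) \<Longrightarrow> 0 < x $ k \<Longrightarrow> 0 \<le> (\<integral>y. f (x - y) \<partial>Q t)"
begin

lemma Q_subprob [measurable]: "Q \<in> measurable borel (subprob_algebra borel)"
  by (rule measurable_prob_algebraD) measurable

lemma sets_Q [measurable_cong, simp]: "sets (Q t) = sets borel"
  using measurable_space[OF Q_meas, of t] by (simp add: space_prob_algebra)

lemma prob_space_Q: "prob_space (Q t)"
  using measurable_space[OF Q_meas, of t] by (simp add: space_prob_algebra)

definition P :: "real \<Rightarrow> (real^'n \<Rightarrow> real) \<Rightarrow> real^'n \<Rightarrow> real" where
  "P t f x = (\<integral>y. f (x - y) \<partial>Q t)"

text \<open>Time and function may both depend on the parameter \<open>w\<close>; this joint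
  measurability is what Fubini needs in the Duhamel term.\<close>

lemma P_measurable:
  assumes [measurable]: "(\<lambda>(w, y). f w y) \<in> borel_measurable (M \<Otimes>\<^sub>M borel)" "\<tau> \<in> borel_measurable M"
  shows "(\<lambda>(w, x). P (\<tau> w) (f w) x) \<in> borel_measurable (M \<Otimes>\<^sub>M borel)"
proof -
  have "(\<lambda>p. \<integral>y. f (fst p) (snd p - y) \<partial>Q (\<tau> (fst p))) \<in> borel_measurable (M \<Otimes>\<^sub>M borel)"
    by (rule integral_measurable_kernel[where N=borel]) measurable
  then show ?thesis by (simp add: P_def case_prod_beta')
qed

lemma P_measurable1 [measurable]:
  assumes [measurable]: "f \<in> borel_measurable borel"
  shows "P t f \<in> borel_measurable borel"
proof -
  have "(\<lambda>x. \<integral>y. f (x - y) \<partial>Q t) \<in> borel_measurable borel"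
    by (rule integral_measurable_kernel[where N=borel]) (auto intro: measurable_const simp: space_subprob_algebra prob_space_imp_subprob_space[OF prob_space_Q])
  then show ?thesis by (simp add: P_def[abs_def])
qed

lemma integrable_Q_bounded:
  fixes f :: "real^'n \<Rightarrow> real"
  assumes [measurable]: "f \<in> borel_measurable borel" and B: "\<And>x. \<bar>f x\<bar> \<le> B"
  shows "integrable (Q t) (\<lambda>y. f (x - y))"
proof -
  interpret prob_space "Q t" by (rule prob_space_Q)
  show ?thesis using B by (intro integrable_const_bound[where B=B]) auto
qed

lemma P_mono:
  assumes [measurable]: "f \<in> borel_measurable borel" "g \<in> borel_measurable borel"
    and B: "\<And>x. \<bar>f x\<bar> \<le> B" "\<And>x. \<bar>g x\<bar> \<le> B'" and le: "\<And>x. f x \<le> g x"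
  shows "P t f x \<le> P t g x"
  unfolding P_def by (intro integral_mono integrable_Q_bounded[OF assms(1) B(1)] integrable_Q_bounded[OF assms(2) B(2)] le)

lemma P_const: "P t (\<lambda>_. c) x = c"
proof -
  interpret prob_space "Q t" by (rule prob_space_Q)
  show ?thesis by (simp add: P_def prob_space)
qed

lemma P_bound:
  assumes [measurable]: "f \<in> borel_measurable borel" and B: "\<And>x. \<bar>f x\<bar> \<le> B"
  shows "\<bar>P t f x\<bar> \<le> B"
proof -
  have "0 \<le> B" using B[of 0] by simp
  have "P t f x \<le> P t (\<lambda>_. B) x"
    by (rule P_mono[where B=B and B'=B]) (use B \<open>0 \<le> B\<close> in \<open>auto simp: abs_le_iff\<close>)
  moreover have "P t (\<lambda>_. - B) x \<le> P t f x"
    by (rule P_mono[where B=B and B'=B]) (use B \<open>0 \<le> B\<close> in \<open>auto simp: abs_le_iff minus_le_iff\<close>)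
  ultimately show ?thesis by (simp add: P_const)
qed

lemma P_diff:
  assumes [measurable]: "f \<in> borel_measurable borel" "g \<in> borel_measurable borel"
    and "\<And>x. \<bar>f x\<bar> \<le> B" "\<And>x. \<bar>g x\<bar> \<le> B'"
  shows "P t (\<lambda>x. f x - g x) x = P t f x - P t g x"
  unfolding P_def by (intro Bochner_Integration.integral_diff integrable_Q_bounded[OF assms(1,3)] integrable_Q_bounded[OF assms(2,4)])

lemma P_0:
  assumes [measurable]: "f \<in> borel_measurable borel"
  shows "P 0 f x = f x"
  unfolding P_def Q_0 by (subst integral_return) auto

lemma cone_P:
  assumes f: "cone k f" "\<And>x. \<bar>f x\<bar> \<le> B"
  shows "cone k (P t f)"
  unfolding cone_def
proof (intro conjI allI impI)
  have [measurable]: "f \<in> borel_measurable borel" using f(1) by (rule cone_measurable)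
  show "P t f \<in> borel_measurable borel" by measurable
  show "0 < x $ k \<Longrightarrow> 0 \<le> P t f x" for x unfolding P_def by (rule Q_cone[OF f])
  fix x
  have "P t f (reflN k x) = (\<integral>y. f (reflN k x - y) \<partial>distr (Q t) borel (reflN k))"
    by (simp add: P_def Q_reflN)
  also have "\<dots> = (\<integral>y. f (reflN k (x - y)) \<partial>Q t)"
    by (subst integral_distr) (auto simp: reflN_diff)
  also have "\<dots> = - P t f x" by (simp add: P_def cone_odd[OF f(1)])
  finally show "P t f (reflN k x) = - P t f x" .
qed

lemma P_add:
  assumes [measurable]: "f \<in> borel_measurable borel" and B: "\<And>x. \<bar>f x\<bar> \<le> B" and st: "0 \<le> s" "0 \<le> t"
  shows "P s (P t f) x = P (s + t) f x"
proof -
  interpret s: prob_space "Q s" by (rule prob_space_Q)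
  interpret t: prob_space "Q t" by (rule prob_space_Q)
  interpret st: pair_prob_space "Q s" "Q t" ..
  have "P (s + t) f x = (\<integral>p. f (x - (fst p + snd p)) \<partial>(Q s \<Otimes>\<^sub>M Q t))"
    unfolding P_def Q_add[OF st, symmetric] by (subst integral_distr) (auto simp: case_prod_beta')
  also have "\<dots> = (\<integral>y. (\<integral>z. f (x - (y + z)) \<partial>Q t) \<partial>Q s)"
    by (subst st.integral_fst'[symmetric]) (use B in \<open>auto intro!: st.P.integrable_const_bound[where B=B]\<close>)
  also have "\<dots> = P s (P t f) x" by (simp add: P_def diff_diff_eq)
  finally show ?thesis by simp
qed

lemma nn_integral_Q_lborel:
  assumes [measurable]: "g \<in> borel_measurable borel"
  shows "(\<integral>\<^sup>+x. (\<integral>\<^sup>+y. g (x - y) \<partial>Q t) \<partial>lborel) = (\<integral>\<^sup>+x. g x \<partial>lborel)"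
proof -
  interpret prob_space "Q t" by (rule prob_space_Q)
  interpret pair_sigma_finite "Q t" "lborel :: (real^'n) measure" ..
  have "(\<integral>\<^sup>+x. (\<integral>\<^sup>+y. g (x - y) \<partial>Q t) \<partial>lborel) = (\<integral>\<^sup>+y. (\<integral>\<^sup>+x. g (x - y) \<partial>lborel) \<partial>Q t)"
    by (rule Fubini') measurable
  also have "\<dots> = (\<integral>\<^sup>+y. (\<integral>\<^sup>+x. g x \<partial>lborel) \<partial>Q t)"
  proof (rule nn_integral_cong)
    fix y show "(\<integral>\<^sup>+x. g (x - y) \<partial>lborel) = (\<integral>\<^sup>+x. g x \<partial>lborel)"
      using nn_integral_lborel_plus[of g "- y"] by simp
  qed
  finally show ?thesis by (simp add: emeasure_space_1)
qed

text \<open>Averaging translates by \<open>Q t\<close> leaves Lebesgue measure invariant. Hence for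
  almost every \<open>x\<close> the exceptional set is missed by x - y for \<open>Q t\<close>-almost
  all \<open>y\<close>, even if \<open>Q t\<close> has atoms.\<close>

lemma P_AE_cong:
  assumes [measurable]: "f \<in> borel_measurable borel" "g \<in> borel_measurable borel"
    and eq: "AE x in lborel. f x = g x"
  shows "AE x in lborel. P t f x = P t g x"
proof -
  let ?d = "\<lambda>x. indicator {x. f x \<noteq> g x} x :: ennreal"
  have "(\<integral>\<^sup>+x. (\<integral>\<^sup>+y. ?d (x - y) \<partial>Q t) \<partial>lborel) = (\<integral>\<^sup>+x. ?d x \<partial>lborel)"
    by (rule nn_integral_Q_lborel) measurable
  also have "\<dots> = 0"
    by (subst nn_integral_0_iff_AE) (use eq in \<open>auto elim!: eventually_mono\<close>)
  finally have "AE x in lborel. (\<integral>\<^sup>+y. ?d (x - y) \<partial>Q t) = 0"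
  proof (subst (asm) nn_integral_0_iff_AE)
    show "(\<lambda>x. \<integral>\<^sup>+ y. ?d (x - y) \<partial>Q t) \<in> borel_measurable lborel"
      using nn_integral_measurable_subprob_algebra2[of "\<lambda>x y. ?d (x - y)" borel borel "\<lambda>_. Q t"]
      by (auto simp: space_subprob_algebra prob_space_imp_subprob_space[OF prob_space_Q])
  qed auto
  then show ?thesis
  proof eventually_elim
    case (elim x)
    then have "AE y in Q t. f (x - y) = g (x - y)"
      by (subst (asm) nn_integral_0_iff_AE) (auto elim!: eventually_mono simp: indicator_def split: if_splits)
    then show ?case unfolding P_def by (intro integral_cong_AE) auto
  qed
qed

text \<open>Invariance of Lebesgue measure gives the L^1 contraction. Where \<open>h (x - y)\<close>
  fails to be integrable in \<open>y\<close>, the integral has the value 0 and obeys the bound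
  too.\<close>

lemma integrable_P:
  assumes h: "integrable lborel h"
  shows "integrable lborel (P t h)" and "(\<integral>x. \<bar>P t h x\<bar> \<partial>lborel) \<le> (\<integral>x. \<bar>h x\<bar> \<partial>lborel)"
proof -
  have [measurable]: "h \<in> borel_measurable borel" using h by (simp add: borel_measurable_integrable)
  have le: "(\<integral>\<^sup>+x. ennreal \<bar>P t h x\<bar> \<partial>lborel) \<le> (\<integral>\<^sup>+x. ennreal \<bar>h x\<bar> \<partial>lborel)"
  proof -
    have "(\<integral>\<^sup>+x. ennreal \<bar>P t h x\<bar> \<partial>lborel) \<le> (\<integral>\<^sup>+x. (\<integral>\<^sup>+y. ennreal \<bar>h (x - y)\<bar> \<partial>Q t) \<partial>lborel)"
    proof (rule nn_integral_mono)
      fix x show "ennreal \<bar>P t h x\<bar> \<le> (\<integral>\<^sup>+y. ennreal \<bar>h (x - y)\<bar> \<partial>Q t)"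
        using integral_norm_bound_ennreal[of "Q t" "\<lambda>y. h (x - y)"] not_integrable_integral_eq[of "Q t" "\<lambda>y. h (x - y)"]
        unfolding P_def by (cases "integrable (Q t) (\<lambda>y. h (x - y))") auto
    qed
    also have "\<dots> = (\<integral>\<^sup>+x. ennreal \<bar>h x\<bar> \<partial>lborel)"
      by (rule nn_integral_Q_lborel) measurable
    finally show ?thesis .
  qed
  also have "\<dots> < \<infinity>" using h by (simp add: integrable_iff_bounded)
  finally show i: "integrable lborel (P t h)" by (intro integrableI_bounded) auto
  show "(\<integral>x. \<bar>P t h x\<bar> \<partial>lborel) \<le> (\<integral>x. \<bar>h x\<bar> \<partial>lborel)"
    using le integrable_abs[OF i] integrable_abs[OF h] by (simp add: nn_integral_eq_integral)
qed

text \<open>Translation invariance of Lebesgue measure moves the shift from \<open>f\<close> to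
  \<open>h\<close> with reversed sign, and the symmetry of \<open>Q t\<close> under
  \<open>uminus\<close> undoes the reversal.\<close>

lemma P_dual:
  assumes [measurable]: "f \<in> borel_measurable borel" and B: "\<And>x. \<bar>f x\<bar> \<le> B" and h: "integrable lborel h"
  shows "(\<integral>x. P t f x * h x \<partial>lborel) = (\<integral>x. f x * P t h x \<partial>lborel)"
proof -
  interpret prob_space "Q t" by (rule prob_space_Q)
  interpret pair_sigma_finite "Q t" "lborel :: (real^'n) measure" ..
  have [measurable]: "h \<in> borel_measurable borel" using h by (simp add: borel_measurable_integrable)
  have fh: "integrable lborel (\<lambda>x. \<bar>f x * h x\<bar>)"
    using integrable_mult_bounded[OF h, of f B] B by (simp add: mult.commute)
  have i1: "integrable (Q t \<Otimes>\<^sub>M lborel) (\<lambda>(y, x). f (x - y) * h x)"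
  proof (rule Bochner_Integration.integrable_bound)
    show "integrable (Q t \<Otimes>\<^sub>M lborel) (\<lambda>(y, x). B * \<bar>h x\<bar>)"
      by (rule Fubini_integrable) (use h in \<open>auto simp: abs_mult\<close>)
    show "AE p in Q t \<Otimes>\<^sub>M lborel. norm (case p of (y, x) \<Rightarrow> f (x - y) * h x) \<le> norm (case p of (y, x) \<Rightarrow> B * \<bar>h x\<bar>)"
      using B by (intro AE_I2) (auto simp: abs_mult intro!: mult_right_mono order_trans[OF B abs_ge_self])
  qed measurable
  have i2: "integrable (Q t \<Otimes>\<^sub>M lborel) (\<lambda>(y, x). f x * h (x - (- y)))"
  proof (rule Fubini_integrable)
    have "(\<integral>x. \<bar>f x * h (x + y)\<bar> \<partial>lborel) = (\<integral>x. \<bar>f (x - y) * h x\<bar> \<partial>lborel)" for y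
      using integral_lborel_plus[of "\<lambda>x. \<bar>f (x - y) * h x\<bar>" y] by simp
    then show "integrable (Q t) (\<lambda>y. \<integral>x. norm (case (y, x) of (y, x) \<Rightarrow> f x * h (x - (- y))) \<partial>lborel)"
      using integrable_fst'[OF integrable_norm[OF i1]] by (simp add: case_prod_beta')
    have "integrable lborel (\<lambda>x. h (x + y) * f x)" for y
      using B by (intro integrable_mult_bounded[OF integrable_lborel_plus[OF h], where B=B]) auto
    then show "AE y in Q t. integrable lborel (\<lambda>x. case (y, x) of (y, x) \<Rightarrow> f x * h (x - (- y)))"
      by (simp add: mult.commute)
  qed measurable
  have "(\<integral>x. P t f x * h x \<partial>lborel) = (\<integral>x. (\<integral>y. f (x - y) * h x \<partial>Q t) \<partial>lborel)" by (simp add: P_def)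
  also have "\<dots> = (\<integral>y. (\<integral>x. f (x - y) * h x \<partial>lborel) \<partial>Q t)" by (rule Fubini_integral[OF i1])
  also have "\<dots> = (\<integral>y. (\<integral>x. f x * h (x - (- y)) \<partial>lborel) \<partial>Q t)"
  proof (rule Bochner_Integration.integral_cong[OF refl])
    fix y show "(\<integral>x. f (x - y) * h x \<partial>lborel) = (\<integral>x. f x * h (x - (- y)) \<partial>lborel)"
      using integral_lborel_plus[of "\<lambda>x. f (x - y) * h x" y] by simp
  qed
  also have "\<dots> = (\<integral>x. (\<integral>y. f x * h (x - (- y)) \<partial>Q t) \<partial>lborel)" by (rule Fubini_integral[OF i2, symmetric])
  also have "\<dots> = (\<integral>x. f x * P t h x \<partial>lborel)"
  proof (rule Bochner_Integration.integral_cong[OF refl])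
    fix x
    have "(\<integral>y. h (x - (- y)) \<partial>Q t) = (\<integral>y. h (x - y) \<partial>distr (Q t) borel uminus)"
      by (subst integral_distr) auto
    then show "(\<integral>y. f x * h (x - (- y)) \<partial>Q t) = f x * P t h x" by (simp add: P_def Q_uminus)
  qed
  finally show ?thesis .
qed

end

text \<open>Nothing is known about \<open>G t\<close> for \<open>t \<le> 0\<close>, not even that it is a Borel measure.\<close>

definition ext_kernel :: "(real \<Rightarrow> (real^'n) measure) \<Rightarrow> real \<Rightarrow> (real^'n) measure" where
  "ext_kernel G t = (if 0 < t then G t else return borel 0)"

section \<open>The measures \<open>G t\<close> form such a semigroup\<close>

lemma mfourier_return_0: "mfourier (return borel 0) \<xi> = 1"
  unfolding mfourier_def by (subst integral_return) auto

lemma mfourier_distr_add: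
  fixes \<mu> \<nu> :: "(real^'n) measure"
  assumes "prob_space \<mu>" "prob_space \<nu>" and [measurable_cong]: "sets \<mu> = sets borel" "sets \<nu> = sets borel"
  shows "mfourier (distr (\<mu> \<Otimes>\<^sub>M \<nu>) borel (\<lambda>(x, y). x + y)) \<xi> = mfourier \<mu> \<xi> * mfourier \<nu> \<xi>"
proof -
  interpret m: prob_space \<mu> by fact
  interpret n: prob_space \<nu> by fact
  interpret pair_prob_space \<mu> \<nu> ..
  have "mfourier (distr (\<mu> \<Otimes>\<^sub>M \<nu>) borel (\<lambda>(x, y). x + y)) \<xi>
     = (\<integral>p. cis (- (fst p \<bullet> \<xi>)) * cis (- (snd p \<bullet> \<xi>)) \<partial>(\<mu> \<Otimes>\<^sub>M \<nu>))"
    unfolding mfourier_def by (subst integral_distr) (auto simp: case_prod_beta' cis_mult inner_add_left)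
  also have "\<dots> = (\<integral>x. (\<integral>y. cis (- (x \<bullet> \<xi>)) * cis (- (y \<bullet> \<xi>)) \<partial>\<nu>) \<partial>\<mu>)"
    by (subst integral_fst'[symmetric]) (auto intro!: P.integrable_const_bound[where B=1] simp: norm_mult)
  also have "\<dots> = mfourier \<mu> \<xi> * mfourier \<nu> \<xi>" by (simp add: mfourier_def)
  finally show ?thesis .
qed

text \<open>Open sets suffice as a generator. The measure of an open set is a limit of integrals of
  continuous functions, each continuous in \<open>t\<close> on the positive axis and constant
  elsewhere.\<close>

lemma ext_kernel_measurable:
  fixes G :: "real \<Rightarrow> (real^'n) measure"
  assumes G_sets: "\<forall>t>0. sets (G t) = sets borel"
    and G_prob: "\<forall>t>0. prob_space (G t)"
    and G_cont: "\<forall>\<phi>::real^'n \<Rightarrow> real. continuous_on UNIV \<phi> \<longrightarrow> bounded (range \<phi>) \<longrightarrow>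
                   continuous_on {0<..} (\<lambda>t. integral\<^sup>L (G t) \<phi>)"
  shows "ext_kernel G \<in> measurable borel (prob_algebra borel)"
proof (rule measurable_prob_algebra_generated[where \<Omega>=UNIV and G="{S. open S}"])
  have prob: "prob_space (ext_kernel G t)" for t using G_prob by (auto simp: ext_kernel_def prob_space_return)
  have sets: "sets (ext_kernel G t) = sets borel" for t using G_sets by (auto simp: ext_kernel_def)
  show "sets borel = sigma_sets UNIV {S::(real^'n) set. open S}" by (simp add: borel_def)
  show "Int_stable {S::(real^'n) set. open S}" by (auto simp: Int_stable_def)
  show "prob_space (ext_kernel G t)" "sets (ext_kernel G t) = sets borel" for t by (fact prob sets)+
  fix U :: "(real^'n) set" assume "U \<in> {S. open S}"
  then have U: "open U" by simp
  have "(\<lambda>t. measure (ext_kernel G t) U) \<in> borel_measurable borel"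
  proof (rule borel_measurable_LIMSEQ_real)
    fix t
    interpret prob_space "ext_kernel G t" by (rule prob)
    note [measurable_cong] = sets[of t]
    have [measurable]: "open_approx U n \<in> borel_measurable borel" for n
      by (rule borel_measurable_continuous_onI) (rule continuous_on_open_approx)
    have [measurable]: "U \<in> sets borel" using U by simp
    have "(\<lambda>n. integral\<^sup>L (ext_kernel G t) (open_approx U n)) \<longlonglongrightarrow> integral\<^sup>L (ext_kernel G t) (indicator U)"
      by (rule integral_dominated_convergence[where w="\<lambda>_. 1"])
         (auto intro!: open_approx_tendsto U simp: open_approx_bounds abs_of_nonneg)
    then show "(\<lambda>n. integral\<^sup>L (ext_kernel G t) (open_approx U n)) \<longlonglongrightarrow> measure (ext_kernel G t) U"
      by (simp add: sets_eq_imp_space_eq[OF sets])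
  next
    fix n
    have [measurable]: "open_approx U n \<in> borel_measurable borel"
      by (rule borel_measurable_continuous_onI) (rule continuous_on_open_approx)
    have c: "continuous_on {0<..} (\<lambda>t. integral\<^sup>L (G t) (open_approx U n))"
      by (intro G_cont[rule_format] continuous_on_open_approx boundedI[where B=1])
         (auto simp: open_approx_bounds abs_of_nonneg)
    have "(\<lambda>t. if t \<in> {0<..} then integral\<^sup>L (G t) (open_approx U n) else open_approx U n 0) \<in> borel_measurable borel"
      by (rule borel_measurable_continuous_on_if[OF _ c]) auto
    also have "(\<lambda>t. if t \<in> {0<..} then integral\<^sup>L (G t) (open_approx U n) else open_approx U n 0)
        = (\<lambda>t. integral\<^sup>L (ext_kernel G t) (open_approx U n))"
      by (auto simp: ext_kernel_def integral_return fun_eq_iff)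
    finally show "(\<lambda>t. integral\<^sup>L (ext_kernel G t) (open_approx U n)) \<in> borel_measurable borel" .
  qed
  then show "(\<lambda>t. emeasure (ext_kernel G t) U) \<in> borel_measurable borel"
    using prob by (simp add: finite_measure.emeasure_eq_measure prob_space.finite_measure)
qed auto

text \<open>The semigroup law holds because both sides have the same Fourier transform. Symmetry
  under \<open>uminus\<close> combines the two reflections, as \<open>reflP k\<close> is minus
  \<open>reflN k\<close>.\<close>

lemma kernel_semigroup_ext_kernel:
  fixes k :: "'n::finite" and G :: "real \<Rightarrow> (real^'n) measure" and J0 :: "real^'n \<Rightarrow> real"
  assumes G_sets: "\<forall>t>0. sets (G t) = sets borel"
    and G_prob: "\<forall>t>0. prob_space (G t)"
    and G_cont: "\<forall>\<phi>::real^'n \<Rightarrow> real. continuous_on UNIV \<phi> \<longrightarrow> bounded (range \<phi>) \<longrightarrow>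
                   continuous_on {0<..} (\<lambda>t. integral\<^sup>L (G t) \<phi>)"
    and G_evenN: "\<forall>t>0. meas_even (reflN k) (G t)"
    and G_evenP: "\<forall>t>0. meas_even (reflP k) (G t)"
    and G_fourier: "\<forall>t>0. \<forall>\<xi>. mfourier (G t) \<xi> = exp (complex_of_real (t * (J0 \<xi> - 1)))"
    and mult: "\<And>t. 0 < t \<Longrightarrow> cone_mult k (\<lambda>\<xi>. exp (complex_of_real (t * (J0 \<xi> - 1))))"
  shows "kernel_semigroup (ext_kernel G) k"
proof
  show "ext_kernel G \<in> measurable borel (prob_algebra borel)"
    by (rule ext_kernel_measurable[OF G_sets G_prob G_cont])
  show "ext_kernel G 0 = return borel 0" by (simp add: ext_kernel_def)
  have prob: "prob_space (ext_kernel G t)" for t using G_prob by (auto simp: ext_kernel_def prob_space_return)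
  have sets [measurable_cong]: "sets (ext_kernel G t) = sets borel" for t using G_sets by (auto simp: ext_kernel_def)
  have fourier: "mfourier (ext_kernel G t) \<xi> = exp (complex_of_real (t * (J0 \<xi> - 1)))" if "0 \<le> t" for t \<xi>
    using G_fourier that by (cases "t = 0") (auto simp: ext_kernel_def mfourier_return_0)
  show reflN: "distr (ext_kernel G t) borel (reflN k) = ext_kernel G t" for t
  proof (cases "0 < t")
    case True
    then show ?thesis unfolding ext_kernel_def using G_prob G_sets G_evenN
      by (auto intro!: distr_eqI_meas_even continuous_on_reflN continuous_on_id prob_space.finite_measure)
  next
    case False
    then show ?thesis by (simp add: ext_kernel_def distr_return reflN_fixed)
  qed
  have reflP_cont: "continuous_on UNIV (reflP k)"
    unfolding reflP_eq[abs_def] by (intro continuous_intros)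
  then have [measurable]: "reflP k \<in> borel_measurable borel" by (rule borel_measurable_continuous_onI)
  show "distr (ext_kernel G t) borel uminus = ext_kernel G t" for t
  proof (cases "0 < t")
    case True
    have "distr (G t) borel (reflP k) = G t" using True G_prob G_sets G_evenP
      by (auto intro!: distr_eqI_meas_even reflP_cont prob_space.finite_measure simp: reflP_def vec_eq_iff)
    then have "distr (ext_kernel G t) borel uminus = distr (distr (ext_kernel G t) borel (reflP k)) borel uminus"
      using True by (simp add: ext_kernel_def)
    also have "\<dots> = distr (ext_kernel G t) borel (reflN k)"
      by (subst distr_distr) (auto simp: reflP_eq comp_def)
    finally show ?thesis by (simp add: reflN)
  next
    case False
    then show ?thesis by (simp add: ext_kernel_def distr_return)
  qed
  show "distr (ext_kernel G s \<Otimes>\<^sub>M ext_kernel G t) borel (\<lambda>(x, y). x + y) = ext_kernel G (s + t)"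
    if "0 \<le> s" "0 \<le> t" for s t
  proof (rule measure_eqI_mfourier)
    interpret m: prob_space "ext_kernel G s" by (rule prob)
    interpret n: prob_space "ext_kernel G t" by (rule prob)
    interpret pair_prob_space "ext_kernel G s" "ext_kernel G t" ..
    show "finite_measure (distr (ext_kernel G s \<Otimes>\<^sub>M ext_kernel G t) borel (\<lambda>(x, y). x + y))"
      by (rule P.finite_measure_distr) measurable
    show "mfourier (distr (ext_kernel G s \<Otimes>\<^sub>M ext_kernel G t) borel (\<lambda>(x, y). x + y)) \<xi> = mfourier (ext_kernel G (s + t)) \<xi>" for \<xi>
      using that by (simp add: mfourier_distr_add prob sets fourier exp_add[symmetric] algebra_simps)
  qed (auto simp: sets prob_space.finite_measure[OF prob])
  fix f :: "real^'n \<Rightarrow> real" and B t :: real and x :: "real^'n"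
  assume f: "cone k f" "\<And>x. \<bar>f x\<bar> \<le> B" and x: "0 < x $ k"
  show "0 \<le> (\<integral>y. f (x - y) \<partial>ext_kernel G t)"
  proof (cases "0 < t")
    case True
    have "mfourier (ext_kernel G t) = (\<lambda>\<xi>. exp (complex_of_real (t * (J0 \<xi> - 1))))"
      using fourier[of t] True by (auto simp: fun_eq_iff)
    then show ?thesis using mult[OF True]
      by (intro cone_kernel[OF _ _ _ f x]) (auto simp: sets prob_space.finite_measure[OF prob])
  next
    case False
    then have "(\<integral>y. f (x - y) \<partial>ext_kernel G t) = f x"
      using cone_measurable[OF f(1)] by (simp add: ext_kernel_def integral_return)
    then show ?thesis using cone_nonneg[OF f(1) x] by simp
  qed
qed

section \<open>The Duhamel equation\<close>

lemma integral_exp_Icc: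
  fixes L t :: real
  assumes "L > 0" "t \<ge> 0"
  shows "integrable lborel (\<lambda>s. indicator {0..t} s * (c * exp (2 * L * s)))"
    and "(\<integral>s. indicator {0..t} s * (c * exp (2 * L * s)) \<partial>lborel) = c * (exp (2 * L * t) - 1) / (2 * L)"
proof -
  have "has_bochner_integral lborel (\<lambda>s. exp (2 * L * s) * indicator {0..t} s)
      (exp (2 * L * t) / (2 * L) - exp (2 * L * 0) / (2 * L))"
    by (rule has_bochner_integral_FTC_Icc_nonneg)
       (use assms in \<open>auto intro!: derivative_eq_intros continuous_intros\<close>)
  then have "has_bochner_integral lborel (\<lambda>s. c * (exp (2 * L * s) * indicator {0..t} s))
      (c * (exp (2 * L * t) / (2 * L) - exp (2 * L * 0) / (2 * L)))"
    by (rule has_bochner_integral_mult_right)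
  then have "has_bochner_integral lborel (\<lambda>s. indicator {0..t} s * (c * exp (2 * L * s)))
      (c * (exp (2 * L * t) - 1) / (2 * L))"
    by (simp add: mult_ac diff_divide_distrib right_diff_distrib)
  then show "integrable lborel (\<lambda>s. indicator {0..t} s * (c * exp (2 * L * s)))"
    "(\<integral>s. indicator {0..t} s * (c * exp (2 * L * s)) \<partial>lborel) = c * (exp (2 * L * t) - 1) / (2 * L)"
    by (auto simp: has_bochner_integral_iff)
qed

section \<open>The Duhamel operator\<close>

context kernel_semigroup
begin

definition D :: "(real \<Rightarrow> real^'n \<Rightarrow> real) \<Rightarrow> real \<Rightarrow> real^'n \<Rightarrow> real" where
  "D g t x = (LBINT s:{0..t}. P (t - s) (g s) x)"

lemma D_eq: "D g t x = (\<integral>s. indicator {0..t} s * P (t - s) (g s) x \<partial>lborel)"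
  by (simp add: D_def set_lebesgue_integral_def)

abbreviation meas2 :: "(real \<Rightarrow> real^'n \<Rightarrow> real) \<Rightarrow> bool" where
  "meas2 g \<equiv> (\<lambda>(s, y). g s y) \<in> borel_measurable (borel \<Otimes>\<^sub>M borel)"

lemma meas2_section: "meas2 g \<Longrightarrow> g s \<in> borel_measurable borel"
  using measurable_Pair2[of "\<lambda>(s, y). g s y" borel borel borel s] by simp

lemma P_source_measurable:
  assumes [measurable]: "meas2 g"
  shows "(\<lambda>((t, s), x). P (t - s) (g s) x) \<in> borel_measurable ((borel \<Otimes>\<^sub>M borel) \<Otimes>\<^sub>M borel)"
proof -
  have "(\<lambda>(w, x). P (fst w - snd w) (g (snd w)) x) \<in> borel_measurable ((borel \<Otimes>\<^sub>M borel) \<Otimes>\<^sub>M borel)"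
    by (rule P_measurable) measurable
  then show ?thesis by (simp add: case_prod_beta')
qed

lemma P_source_measurable':
  assumes [measurable]: "meas2 g" and [measurable]: "a \<in> borel_measurable M" "b \<in> borel_measurable M" "c \<in> borel_measurable M"
  shows "(\<lambda>w. P (a w - b w) (g (b w)) (c w)) \<in> borel_measurable M"
proof -
  have "(\<lambda>w. ((a w, b w), c w)) \<in> measurable M ((borel \<Otimes>\<^sub>M borel) \<Otimes>\<^sub>M borel)" by measurable
  from measurable_compose[OF this P_source_measurable[OF assms(1)]] show ?thesis by simp
qed

lemma D_measurable:
  assumes [measurable]: "meas2 g"
  shows "meas2 (D g)"
proof -
  have "(\<lambda>p. \<integral>s. indicator {0..fst p} s * P (fst p - s) (g s) (snd p) \<partial>lborel) \<in> borel_measurable (borel \<Otimes>\<^sub>M borel)"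
  proof (rule lborel.borel_measurable_lebesgue_integral)
    have "(\<lambda>(p, s). (if 0 \<le> s \<and> s \<le> fst p then 1 else 0) * P (fst p - s) (g s) (snd p))
        \<in> borel_measurable ((borel \<Otimes>\<^sub>M borel) \<Otimes>\<^sub>M lborel)"
      by (simp only: case_prod_beta', intro borel_measurable_times P_source_measurable'[OF assms]) measurable
    also have "(\<lambda>(p, s). (if 0 \<le> s \<and> s \<le> fst p then 1 else 0) * P (fst p - s) (g s) (snd p))
       = (\<lambda>(p, s). indicator {0..fst p} s * P (fst p - s) (g s) (snd p))"
      by (auto simp: indicator_def fun_eq_iff)
    finally show "(\<lambda>(p, s). indicator {0..fst p} s * P (fst p - s) (g s) (snd p))
        \<in> borel_measurable ((borel \<Otimes>\<^sub>M borel) \<Otimes>\<^sub>M lborel)" .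
  qed
  then show ?thesis by (simp add: D_eq case_prod_beta')
qed

lemma D_integrable:
  assumes [measurable]: "meas2 g" and B: "\<And>s y. 0 \<le> s \<Longrightarrow> s \<le> t \<Longrightarrow> \<bar>g s y\<bar> \<le> B"
  shows "integrable lborel (\<lambda>s. indicator {0..t} s * P (t - s) (g s) x)"
proof (rule Bochner_Integration.integrable_bound)
  show "integrable lborel (\<lambda>s. indicator {0..t} s * B)"
    by (intro integrable_mult_left) (auto simp: integrable_indicator_iff emeasure_lborel_Icc_eq)
  show "AE s in lborel. norm (indicator {0..t} s * P (t - s) (g s) x) \<le> norm (indicator {0..t} s * B)"
    using P_bound[OF meas2_section[OF assms(1)] B] by (intro AE_I2) (auto simp: indicator_def intro: order_trans[OF _ abs_ge_self])
  show "(\<lambda>s. indicator {0..t} s * P (t - s) (g s) x) \<in> borel_measurable lborel"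
    by (intro borel_measurable_times P_source_measurable'[OF assms(1)]) measurable
qed

lemma D_diff:
  assumes g: "meas2 g" "\<And>s y. 0 \<le> s \<Longrightarrow> s \<le> t \<Longrightarrow> \<bar>g s y\<bar> \<le> B"
    and h: "meas2 h" "\<And>s y. 0 \<le> s \<Longrightarrow> s \<le> t \<Longrightarrow> \<bar>h s y\<bar> \<le> B'"
  shows "D (\<lambda>s y. g s y - h s y) t x = D g t x - D h t x"
proof -
  have "indicator {0..t} s * P (t - s) (\<lambda>y. g s y - h s y) x
      = indicator {0..t} s * P (t - s) (g s) x - indicator {0..t} s * P (t - s) (h s) x" for s
    using P_diff[OF meas2_section[OF g(1)] meas2_section[OF h(1)] g(2) h(2)]
    by (auto simp: indicator_def)
  then show ?thesis unfolding D_eq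
    using Bochner_Integration.integral_diff[OF D_integrable[OF g] D_integrable[OF h]] by simp
qed

text \<open>\<open>P\<close> does not increase bounds, so only the scalar weight is integrated in
  time. Dividing by 2L rather than L is what later yields the contraction factor 1/2.\<close>

lemma D_le_exp:
  assumes g: "meas2 g" "\<And>s y. 0 \<le> s \<Longrightarrow> s \<le> t \<Longrightarrow> \<bar>g s y\<bar> \<le> c * exp (2 * L * s)" and L: "L > 0" and t: "0 \<le> t"
  shows "\<bar>D g t x\<bar> \<le> c * (exp (2 * L * t) - 1) / (2 * L)"
proof -
  have "\<bar>D g t x\<bar> \<le> (\<integral>s. \<bar>indicator {0..t} s * P (t - s) (g s) x\<bar> \<partial>lborel)"
    unfolding D_eq by (rule integral_abs_bound)
  also have "\<dots> \<le> (\<integral>s. indicator {0..t} s * (c * exp (2 * L * s)) \<partial>lborel)"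
  proof (rule integral_mono')
    show "integrable lborel (\<lambda>s. indicator {0..t} s * (c * exp (2 * L * s)))" by (rule integral_exp_Icc[OF L t])
    fix s
    show "\<bar>indicator {0..t} s * P (t - s) (g s) x\<bar> \<le> indicator {0..t} s * (c * exp (2 * L * s))"
      using P_bound[OF meas2_section[OF g(1)] g(2)] by (auto simp: indicator_def)
    then show "0 \<le> indicator {0..t} s * (c * exp (2 * L * s))" using abs_ge_zero order_trans by blast
  qed
  also have "\<dots> = c * (exp (2 * L * t) - 1) / (2 * L)" by (rule integral_exp_Icc[OF L t])
  finally show ?thesis .
qed

lemma D_mono:
  assumes g: "meas2 g" "\<And>s y. 0 \<le> s \<Longrightarrow> s \<le> t \<Longrightarrow> \<bar>g s y\<bar> \<le> B"
    and h: "meas2 h" "\<And>s y. 0 \<le> s \<Longrightarrow> s \<le> t \<Longrightarrow> \<bar>h s y\<bar> \<le> B'"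
    and le: "\<And>s y. 0 \<le> s \<Longrightarrow> s \<le> t \<Longrightarrow> g s y \<le> h s y"
  shows "D g t x \<le> D h t x"
  unfolding D_eq
proof (rule integral_mono[OF D_integrable[OF g] D_integrable[OF h]])
  fix s
  show "indicator {0..t} s * P (t - s) (g s) x \<le> indicator {0..t} s * P (t - s) (h s) x"
    using P_mono[OF meas2_section[OF g(1)] meas2_section[OF h(1)] g(2) h(2) le] by (auto simp: indicator_def)
qed

lemma D_lim:
  assumes g: "\<And>n::nat. meas2 (g n)" "\<And>n s y. 0 \<le> s \<Longrightarrow> s \<le> t \<Longrightarrow> \<bar>g n s y\<bar> \<le> B"
    and h [measurable]: "meas2 h" and lim: "\<And>s y. 0 \<le> s \<Longrightarrow> s \<le> t \<Longrightarrow> (\<lambda>n. g n s y) \<longlonglongrightarrow> h s y"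
  shows "(\<lambda>n. D (g n) t x) \<longlonglongrightarrow> D h t x"
  unfolding D_eq
proof (rule integral_dominated_convergence[where w="\<lambda>s. indicator {0..t} s * B"])
  show "AE s in lborel. norm (indicator {0..t} s * P (t - s) (g n s) x) \<le> indicator {0..t} s * B" for n
    using P_bound[OF meas2_section[OF g(1)] g(2)] by (intro AE_I2) (auto simp: indicator_def)
  show "AE s in lborel. (\<lambda>n. indicator {0..t} s * P (t - s) (g n s) x) \<longlonglongrightarrow> indicator {0..t} s * P (t - s) (h s) x"
  proof (rule AE_I2)
    fix s
    show "(\<lambda>n. indicator {0..t} s * P (t - s) (g n s) x) \<longlonglongrightarrow> indicator {0..t} s * P (t - s) (h s) x"
    proof (cases "s \<in> {0..t}")
      case True
      interpret prob_space "Q (t - s)" by (rule prob_space_Q)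
      have [measurable]: "g n s \<in> borel_measurable borel" "h s \<in> borel_measurable borel" for n
        using meas2_section g(1) h by auto
      have "(\<lambda>n. P (t - s) (g n s) x) \<longlonglongrightarrow> P (t - s) (h s) x"
        unfolding P_def
        by (rule integral_dominated_convergence[where w="\<lambda>_. B"]) (use g(2) lim True in auto)
      then show ?thesis using True by simp
    qed simp
  qed
qed (auto intro!: borel_measurable_times P_source_measurable' g(1) h integrable_mult_left simp: integrable_indicator_iff emeasure_lborel_Icc_eq)

text \<open>The exceptional set may depend on the time. Fubini exchanges the quantifiers: for almost
  every \<open>x\<close> the two integrands agree at almost every time.\<close>

lemma D_AE_cong:
  assumes [measurable]: "meas2 g" "meas2 h" and eq: "\<And>s. 0 \<le> s \<Longrightarrow> s \<le> t \<Longrightarrow> AE y in lborel. g s y = h s y"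
  shows "AE x in lborel. D g t x = D h t x"
proof -
  let ?R = "\<lambda>s x. indicator {0..t} s * P (t - s) (g s) x = indicator {0..t} s * P (t - s) (h s) x"
  have P_ind: "(\<lambda>p. indicator {0..t} (fst p) * P (t - fst p) (g (fst p)) (snd p)) \<in> borel_measurable (lborel \<Otimes>\<^sub>M lborel)"
    if "meas2 g" for g
    by (intro borel_measurable_times P_source_measurable'[OF that]) measurable
  have "AE s in lborel. AE x in lborel. ?R s x"
  proof (rule AE_I2)
    fix s
    show "AE x in lborel. ?R s x"
    proof (cases "s \<in> {0..t}")
      case True
      then have "AE x in lborel. P (t - s) (g s) x = P (t - s) (h s) x"
        by (intro P_AE_cong meas2_section eq assms) auto
      then show ?thesis by eventually_elim simp
    qed simp
  qed
  then have "AE x in lborel. AE s in lborel. ?R s x"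
  proof (subst (asm) lborel_pair.AE_commute)
    show "{p \<in> space (lborel \<Otimes>\<^sub>M lborel). ?R (fst p) (snd p)} \<in> sets (lborel \<Otimes>\<^sub>M lborel)"
      by (intro borel_measurable_eq P_ind assms) measurable
  qed
  then show ?thesis
    by eventually_elim (unfold D_eq, rule integral_cong_AE, auto intro!: borel_measurable_times P_source_measurable' assms)
qed

lemma cone_D:
  assumes g [measurable]: "meas2 g" and B: "\<And>s y. 0 \<le> s \<Longrightarrow> s \<le> t \<Longrightarrow> \<bar>g s y\<bar> \<le> B"
    and c: "\<And>s. 0 \<le> s \<Longrightarrow> s \<le> t \<Longrightarrow> cone k (g s)"
  shows "cone k (D g t)"
proof -
  have cP: "cone k (P (t - s) (g s))" if "s \<in> {0..t}" for s
    using that by (intro cone_P[OF c B]) auto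
  show ?thesis unfolding cone_def
  proof (intro conjI allI impI)
    show "D g t \<in> borel_measurable borel" by (rule meas2_section[OF D_measurable[OF g]])
    fix x
    have "indicator {0..t} s * P (t - s) (g s) (reflN k x) = - (indicator {0..t} s * P (t - s) (g s) x)" for s
      using cone_odd[OF cP, of s x] by (auto simp: indicator_def)
    then show "D g t (reflN k x) = - D g t x" unfolding D_eq by simp
    assume "0 < x $ k"
    then show "0 \<le> D g t x" unfolding D_eq
      by (intro integral_nonneg_AE AE_I2) (use cone_nonneg[OF cP] in \<open>auto simp: indicator_def\<close>)
  qed
qed

end

section \<open>Picard iteration for a globally Lipschitz nonlinearity\<close>

text \<open>The model of the truncated problem. All bounds hold at every point instead of almost
  everywhere, so the iteration runs pointwise and its limit is a genuine function.\<close>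

locale lipschitz_problem = kernel_semigroup Q k
  for Q :: "real \<Rightarrow> (real^'n) measure" and k :: 'n +
  fixes f :: "real \<Rightarrow> real" and L K :: real and v0 :: "real^'n \<Rightarrow> real"
  assumes L_pos: "0 < L" and f_lip: "\<And>a b. \<bar>f a - f b\<bar> \<le> L * \<bar>a - b\<bar>" and f_0: "f 0 = 0"
    and f_meas [measurable]: "f \<in> borel_measurable borel"
    and v0_meas [measurable]: "v0 \<in> borel_measurable borel" and v0_bound: "\<And>x. \<bar>v0 x\<bar> \<le> K"
begin

primrec pic :: "nat \<Rightarrow> real \<Rightarrow> real^'n \<Rightarrow> real" where
  "pic 0 = (\<lambda>t x. 0)"
| "pic (Suc n) = (\<lambda>t x. P t v0 x + D (\<lambda>s y. f (pic n s y)) t x)"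

lemma K_nonneg: "0 \<le> K" using v0_bound[of 0] by simp

lemma f_bound: "\<bar>f a\<bar> \<le> L * \<bar>a\<bar>" using f_lip[of a 0] by (simp add: f_0)

lemma P_v0_measurable: "meas2 (\<lambda>t x. P t v0 x)"
proof -
  have "(\<lambda>(w, x). P (id w) v0 x) \<in> borel_measurable (borel \<Otimes>\<^sub>M borel)"
    by (rule P_measurable) (auto simp: id_def)
  then show ?thesis by simp
qed

lemma pic_measurable [measurable]: "meas2 (pic n)"
proof (induction n)
  case (Suc n)
  then have "meas2 (\<lambda>s y. f (pic n s y))" by measurable
  from D_measurable[OF this] P_v0_measurable
  have "(\<lambda>p. (case p of (t, x) \<Rightarrow> P t v0 x) + (case p of (t, x) \<Rightarrow> D (\<lambda>s y. f (pic n s y)) t x)) \<in> borel_measurable (borel \<Otimes>\<^sub>M borel)"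
    by (rule borel_measurable_add[rotated])
  then show ?case by (simp add: case_prod_beta')
qed simp

lemma f_pic_measurable: "meas2 (\<lambda>s y. f (pic n s y))" by measurable

lemma exp_step:
  assumes "0 \<le> t" "0 \<le> c"
  shows "L * c * (exp (2 * L * t) - 1) / (2 * L) \<le> c * exp (2 * L * t) / 2"
  using L_pos assms by (simp add: field_simps)

text \<open>With E = e^(2Lt), the datum contributes \<open>K\<close> and the Duhamel term at most K
  (E - 1)/2; together this is at most K E.\<close>

lemma pic_bound: "0 \<le> t \<Longrightarrow> \<bar>pic n t x\<bar> \<le> K * exp (2 * L * t)"
proof (induction n arbitrary: t x)
  case 0
  then show ?case using K_nonneg by simp
next
  case (Suc n)
  have b: "\<bar>f (pic n s y)\<bar> \<le> (L * K) * exp (2 * L * s)" if "0 \<le> s" for s y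
    using order_trans[OF f_bound mult_left_mono[OF Suc.IH[OF that]]] L_pos by (simp add: mult.assoc)
  have "\<bar>D (\<lambda>s y. f (pic n s y)) t x\<bar> \<le> L * K * (exp (2 * L * t) - 1) / (2 * L)"
    by (rule D_le_exp[OF f_pic_measurable _ L_pos]) (use Suc b in auto)
  also have "\<dots> = K * (exp (2 * L * t) - 1) / 2" using L_pos by simp
  finally have "\<bar>D (\<lambda>s y. f (pic n s y)) t x\<bar> \<le> K * (exp (2 * L * t) - 1) / 2" .
  moreover have "\<bar>P t v0 x\<bar> \<le> K" by (rule P_bound[OF v0_meas v0_bound])
  moreover have "K * 1 \<le> K * exp (2 * L * t)"
    using L_pos Suc.prems K_nonneg by (intro mult_left_mono) auto
  ultimately show ?case by (simp add: algebra_simps)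
qed

lemma f_pic_bound: 
  assumes "0 \<le> s" "s \<le> t"
  shows "\<bar>f (pic n s y)\<bar> \<le> L * (K * exp (2 * L * t))"
proof -
  have "\<bar>f (pic n s y)\<bar> \<le> L * \<bar>pic n s y\<bar>" by (rule f_bound)
  also have "\<dots> \<le> L * (K * exp (2 * L * t))"
    using L_pos K_nonneg assms(2)
    by (intro mult_left_mono order_trans[OF pic_bound[OF assms(1)]]) auto
  finally show ?thesis .
qed

text \<open>The weight \<open>exp (2 * L * t)\<close> makes the Picard map a contraction with factor 1/2.\<close>

lemma pic_step: "0 \<le> t \<Longrightarrow> \<bar>pic (Suc n) t x - pic n t x\<bar> \<le> K * exp (2 * L * t) * (1 / 2) ^ n"
proof (induction n arbitrary: t x)
  case 0
  then show ?case using pic_bound[of t "Suc 0" x] by simp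
next
  case (Suc n)
  have m: "meas2 (\<lambda>s y. f (pic (Suc n) s y) - f (pic n s y))" by measurable
  have "pic (Suc (Suc n)) t x - pic (Suc n) t x = D (\<lambda>s y. f (pic (Suc n) s y) - f (pic n s y)) t x"
    using D_diff[OF f_pic_measurable[of "Suc n"] f_pic_bound f_pic_measurable[of n] f_pic_bound, of t t t x] by simp
  also have "\<bar>\<dots>\<bar> \<le> (L * (K * (1 / 2) ^ n)) * (exp (2 * L * t) - 1) / (2 * L)"
  proof (rule D_le_exp[OF m _ L_pos Suc.prems])
    fix s :: real and y :: "real^'n" assume s: "0 \<le> s"
    have "\<bar>f (pic (Suc n) s y) - f (pic n s y)\<bar> \<le> L * \<bar>pic (Suc n) s y - pic n s y\<bar>" by (rule f_lip)
    also have "\<dots> \<le> L * (K * exp (2 * L * s) * (1 / 2) ^ n)"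
      using L_pos by (intro mult_left_mono Suc.IH s) auto
    finally show "\<bar>f (pic (Suc n) s y) - f (pic n s y)\<bar> \<le> (L * (K * (1 / 2) ^ n)) * exp (2 * L * s)"
      by (simp add: mult_ac)
  qed
  also have "\<dots> \<le> (K * (1 / 2) ^ n) * exp (2 * L * t) / 2"
    by (rule exp_step) (use Suc.prems K_nonneg in auto)
  finally show ?case by (simp add: mult_ac)
qed

text \<open>Convergence of the iterates is established for nonnegative times; 0 is a default value
  before that.\<close>

definition sol :: "real \<Rightarrow> real^'n \<Rightarrow> real" where
  "sol t x = (if 0 \<le> t then lim (\<lambda>n. pic n t x) else 0)"

lemma pic_tendsto:
  assumes t: "0 \<le> t"
  shows "(\<lambda>n. pic n t x) \<longlonglongrightarrow> sol t x"
proof -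
  have "summable (\<lambda>n. pic (Suc n) t x - pic n t x)"
    by (rule summable_comparison_test'[where g="\<lambda>n. K * exp (2 * L * t) * (1 / 2) ^ n" and N=0])
       (use pic_step[OF t] in \<open>auto intro!: summable_mult summable_geometric\<close>)
  then have "convergent (\<lambda>n. \<Sum>i<n. pic (Suc i) t x - pic i t x)" by (simp add: summable_iff_convergent)
  then have "convergent (\<lambda>n. pic n t x)"
    by (simp add: sum_lessThan_telescope[of "\<lambda>i. pic i t x"] del: pic.simps(2))
  then show ?thesis using t by (simp add: sol_def convergent_LIMSEQ_iff)
qed

lemma sol_measurable [measurable]: "meas2 sol"
proof -
  have "(\<lambda>p. if 0 \<le> fst p then lim (\<lambda>n. (case p of (t, x) \<Rightarrow> pic n t x)) else 0) \<in> borel_measurable (borel \<Otimes>\<^sub>M borel)"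
    by measurable
  then show ?thesis by (simp add: sol_def case_prod_beta')
qed

lemma sol_bound: "0 \<le> t \<Longrightarrow> \<bar>sol t x\<bar> \<le> K * exp (2 * L * t)"
  by (rule Lim_bounded[OF tendsto_rabs[OF pic_tendsto], of _ 0]) (use pic_bound in auto)

lemma f_continuous: "isCont f a"
proof -
  have "(\<lambda>b. f b - f a) \<midarrow>a\<rightarrow> 0"
  proof (rule Lim_null_comparison)
    show "eventually (\<lambda>b. norm (f b - f a) \<le> L * \<bar>b - a\<bar>) (at a)" using f_lip by simp
    have "(\<lambda>b. L * \<bar>b - a\<bar>) \<midarrow>a\<rightarrow> L * \<bar>a - a\<bar>" by (intro tendsto_intros)
    then show "(\<lambda>b. L * \<bar>b - a\<bar>) \<midarrow>a\<rightarrow> 0" by simp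
  qed
  then show ?thesis unfolding isCont_def by (simp add: LIM_zero_iff)
qed

lemma sol_eq:
  assumes t: "0 \<le> t"
  shows "sol t x = P t v0 x + D (\<lambda>s y. f (sol s y)) t x"
proof (rule LIMSEQ_unique)
  show "(\<lambda>n. pic (Suc n) t x) \<longlonglongrightarrow> sol t x" using pic_tendsto[OF t] by (rule LIMSEQ_Suc)
  have "(\<lambda>n. D (\<lambda>s y. f (pic n s y)) t x) \<longlonglongrightarrow> D (\<lambda>s y. f (sol s y)) t x"
  proof (rule D_lim[OF f_pic_measurable f_pic_bound])
    show "meas2 (\<lambda>s y. f (sol s y))" by measurable
    show "(\<lambda>n. f (pic n s y)) \<longlonglongrightarrow> f (sol s y)" if "0 \<le> s" for s y
      by (rule isCont_tendsto_compose[OF f_continuous pic_tendsto[OF that]])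
  qed
  then show "(\<lambda>n. pic (Suc n) t x) \<longlonglongrightarrow> P t v0 x + D (\<lambda>s y. f (sol s y)) t x"
    by (auto intro: tendsto_intros)
qed

text \<open>An odd nonlinearity that is nonnegative on nonnegative arguments maps the cone into
  itself. Hence all iterates stay in the cone, which is closed under pointwise limits.\<close>

lemma cone_sol:
  assumes v0: "cone k v0" and f_odd: "\<And>a. f (- a) = - f a" and f_nn: "\<And>a. 0 \<le> a \<Longrightarrow> 0 \<le> f a" and t: "0 \<le> t"
  shows "cone k (sol t)"
proof -
  have fc: "cone k (\<lambda>y. f (g y))" if "cone k g" for g
    using that cone_measurable[OF that] by (auto simp: cone_def f_odd f_nn)
  have "cone k (pic n t)" if "0 \<le> t" for n t
    using that
  proof (induction n arbitrary: t)
    case (Suc n)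
    have "cone k (P t v0)" by (rule cone_P[OF v0 v0_bound])
    moreover have "cone k (D (\<lambda>s y. f (pic n s y)) t)"
      by (rule cone_D[OF f_pic_measurable f_pic_bound]) (use Suc fc in auto)
    ultimately show ?case by (auto simp: cone_def)
  qed (simp add: cone_def)
  then show ?thesis by (rule cone_lim[OF _ pic_tendsto[OF t]]) (use t in auto)
qed

text \<open>The contraction estimate of the iteration, applied to the difference of two solutions:
  every passage through the equation halves the weighted bound, which starts from 2C.\<close>

lemma mild_unique:
  assumes u [measurable]: "meas2 u" and ub: "\<And>t x. \<bar>u t x\<bar> \<le> C"
    and ueq: "\<And>t. 0 \<le> t \<Longrightarrow> t \<le> \<tau> \<Longrightarrow> AE x in lborel. u t x = P t v0 x + D (\<lambda>s y. f (u s y)) t x"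
    and w [measurable]: "meas2 w" and wb: "\<And>t x. \<bar>w t x\<bar> \<le> C"
    and weq: "\<And>t. 0 \<le> t \<Longrightarrow> t \<le> \<tau> \<Longrightarrow> AE x in lborel. w t x = P t v0 x + D (\<lambda>s y. f (w s y)) t x"
    and t: "0 \<le> t" "t \<le> \<tau>"
  shows "AE x in lborel. u t x = w t x"
proof -
  have C0: "0 \<le> C" using ub[of 0 0] by simp
  have step: "AE x in lborel. \<bar>u t x - w t x\<bar> \<le> 2 * C * exp (2 * L * t) * (1 / 2) ^ n" if "0 \<le> t" "t \<le> \<tau>" for n t
    using that
  proof (induction n arbitrary: t)
    case 0
    have "\<bar>u t x - w t x\<bar> \<le> 2 * C * exp (2 * L * t)" for x
    proof -
      have "\<bar>u t x - w t x\<bar> \<le> 2 * C * 1" using ub[of t x] wb[of t x] by simp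
      also have "\<dots> \<le> 2 * C * exp (2 * L * t)" using C0 L_pos 0 by (intro mult_left_mono) auto
      finally show ?thesis .
    qed
    then show ?case by simp
  next
    case (Suc n)
    let ?c = "L * (2 * C * (1 / 2) ^ n)"
    define d where "d s y = L * \<bar>u s y - w s y\<bar>" for s y
    \<comment> \<open>The induction hypothesis bounds \<open>d\<close> almost everywhere only. The
      minimum is a version of \<open>d\<close> that obeys the bound at every point, as
      \<open>D_le_exp\<close> requires.\<close>
    define q where "q s y = min (d s y) (?c * exp (2 * L * s))" for s y
    have [measurable]: "meas2 d" "meas2 q" unfolding d_def q_def by measurable
    have fb: "\<bar>f (u s y)\<bar> \<le> L * C" "\<bar>f (w s y)\<bar> \<le> L * C" for s y
      using order_trans[OF f_bound mult_left_mono[OF ub]] order_trans[OF f_bound mult_left_mono[OF wb]] L_pos by auto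
    have db: "\<bar>d s y\<bar> \<le> L * (2 * C)" for s y
      using ub[of s y] wb[of s y] L_pos unfolding d_def by (auto simp: abs_mult intro!: mult_left_mono)
    have m1: "meas2 (\<lambda>s y. f (u s y))" "meas2 (\<lambda>s y. f (w s y))" "meas2 (\<lambda>s y. f (u s y) - f (w s y))" "meas2 (\<lambda>s y. - d s y)"
      by measurable
    have le: "\<bar>D (\<lambda>s y. f (u s y)) t x - D (\<lambda>s y. f (w s y)) t x\<bar> \<le> D d t x" for x
    proof -
      have e: "D (\<lambda>s y. f (u s y) - f (w s y)) t x = D (\<lambda>s y. f (u s y)) t x - D (\<lambda>s y. f (w s y)) t x"
        by (rule D_diff[OF m1(1) fb(1) m1(2) fb(2)])
      have fd: "\<bar>f (u s y) - f (w s y)\<bar> \<le> d s y" for s y unfolding d_def by (rule f_lip)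
      then have fdb: "\<bar>f (u s y) - f (w s y)\<bar> \<le> L * (2 * C)" for s y
        using db[of s y] by (meson abs_ge_self order_trans)
      have "D (\<lambda>s y. f (u s y) - f (w s y)) t x \<le> D d t x"
        by (rule D_mono[OF m1(3) fdb _ db]) (use fd in \<open>auto simp: abs_le_iff\<close>)
      moreover have "D (\<lambda>s y. - d s y) t x \<le> D (\<lambda>s y. f (u s y) - f (w s y)) t x"
      proof (rule D_mono[OF m1(4) _ m1(3) fdb])
        show "- d s y \<le> f (u s y) - f (w s y)" for s y using fd[of s y] by linarith
        show "\<bar>- d s y\<bar> \<le> L * (2 * C)" for s y using db[of s y] by simp
      qed
      moreover have "D (\<lambda>s y. - d s y) t x = - D d t x" by (simp add: D_eq P_def)
      ultimately show ?thesis unfolding e by (simp add: abs_le_iff)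
    qed
    have dq: "AE x in lborel. D d t x = D q t x"
    proof (rule D_AE_cong)
      fix s assume s: "0 \<le> s" "s \<le> t"
      then have "AE y in lborel. \<bar>u s y - w s y\<bar> \<le> 2 * C * exp (2 * L * s) * (1 / 2) ^ n"
        using Suc by auto
      then show "AE y in lborel. d s y = q s y"
      proof eventually_elim
        case (elim y)
        then have "d s y \<le> L * (2 * C * exp (2 * L * s) * (1 / 2) ^ n)"
          unfolding d_def using L_pos by (intro mult_left_mono) auto
        then show ?case by (simp add: q_def mult_ac)
      qed
    qed measurable
    have qb: "\<bar>D q t x\<bar> \<le> 2 * C * exp (2 * L * t) * (1 / 2) ^ Suc n" for x
    proof -
      have "\<bar>D q t x\<bar> \<le> ?c * (exp (2 * L * t) - 1) / (2 * L)"
      proof (rule D_le_exp[OF _ _ L_pos Suc.prems(1)])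
        show "\<bar>q s y\<bar> \<le> ?c * exp (2 * L * s)" for s y
          using L_pos C0 by (auto simp: q_def d_def abs_le_iff min_le_iff_disj intro: order_trans[of _ 0])
      qed measurable
      also have "\<dots> \<le> (2 * C * (1 / 2) ^ n) * exp (2 * L * t) / 2"
        by (rule exp_step) (use Suc.prems C0 in auto)
      finally show ?thesis by (simp add: mult_ac)
    qed
    show ?case
      using ueq[OF Suc.prems] weq[OF Suc.prems] dq
    proof eventually_elim
      case (elim x)
      then show ?case using le[of x] qb[of x] by linarith
    qed
  qed
  have "AE x in lborel. \<forall>n. \<bar>u t x - w t x\<bar> \<le> 2 * C * exp (2 * L * t) * (1 / 2) ^ n"
    unfolding AE_all_countable using step[OF t] by blast
  then show ?thesis
  proof eventually_elim
    case (elim x)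
    have "(\<lambda>n. 2 * C * exp (2 * L * t) * (1 / 2) ^ n) \<longlonglongrightarrow> 2 * C * exp (2 * L * t) * 0"
      by (intro tendsto_mult tendsto_const LIMSEQ_power_zero) auto
    then have "\<bar>u t x - w t x\<bar> \<le> 2 * C * exp (2 * L * t) * 0"
      using elim by (intro LIMSEQ_le_const) auto
    then show ?case by simp
  qed
qed

end

section \<open>The power nonlinearity and its truncation\<close>

definition nl :: "real \<Rightarrow> real \<Rightarrow> real" where
  "nl \<alpha> v = \<bar>v\<bar> powr \<alpha> * v"

text \<open>Truncating symmetrically on both sides keeps the nonlinearity odd, so the truncated
  problem still preserves the cone.\<close>

definition clip :: "real \<Rightarrow> real \<Rightarrow> real" where
  "clip M v = max (- M) (min M v)"

lemma clip_bound: "0 \<le> M \<Longrightarrow> \<bar>clip M v\<bar> \<le> M"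
  by (auto simp: clip_def)

lemma clip_eq: "\<bar>v\<bar> \<le> M \<Longrightarrow> clip M v = v"
  by (auto simp: clip_def)

lemma clip_lip: "\<bar>clip M a - clip M b\<bar> \<le> \<bar>a - b\<bar>"
  by (auto simp: clip_def max_def min_def)

lemma clip_minus: "0 \<le> M \<Longrightarrow> clip M (- v) = - clip M v"
  by (auto simp: clip_def max_def min_def)

lemma clip_measurable [measurable]: "clip M \<in> borel_measurable borel"
  unfolding clip_def by measurable

lemma nl_measurable [measurable]: "nl \<alpha> \<in> borel_measurable borel"
  unfolding nl_def by measurable

lemma nl_minus: "nl \<alpha> (- v) = - nl \<alpha> v" by (simp add: nl_def)

lemma nl_0 [simp]: "nl \<alpha> 0 = 0" by (simp add: nl_def)

lemma nl_nonneg: "0 \<le> v \<Longrightarrow> 0 \<le> nl \<alpha> v" by (simp add: nl_def)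

lemma abs_nl: "\<bar>nl \<alpha> v\<bar> = \<bar>v\<bar> powr \<alpha> * \<bar>v\<bar>" by (simp add: nl_def abs_mult)

lemma nl_MVT:
  assumes \<alpha>: "0 < \<alpha>" and ab: "0 \<le> b" "b < a"
  obtains z where "b < z" "z < a" "nl \<alpha> a - nl \<alpha> b = (a - b) * ((1 + \<alpha>) * z powr \<alpha>)"
proof -
  have nl_eq: "nl \<alpha> x = x powr (1 + \<alpha>)" if "0 \<le> x" for x
    using that by (cases "x = 0") (auto simp: nl_def powr_add)
  have d: "((\<lambda>x. x powr (1 + \<alpha>)) has_real_derivative (1 + \<alpha>) * x powr \<alpha>) (at x)" if "0 < x" for x
    using that \<alpha> by (auto intro!: derivative_eq_intros)
  have "continuous_on {b..a} (\<lambda>x. x powr (1 + \<alpha>))"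
    using ab \<alpha> by (intro continuous_on_powr' continuous_intros) auto
  moreover have "(\<lambda>x. x powr (1 + \<alpha>)) differentiable (at x)" if "b < x" "x < a" for x
    using d[of x] that ab by (auto simp: real_differentiable_def)
  ultimately obtain l z where z: "b < z" "z < a" "((\<lambda>x. x powr (1 + \<alpha>)) has_real_derivative l) (at z)"
      "a powr (1 + \<alpha>) - b powr (1 + \<alpha>) = (a - b) * l"
    using MVT[OF ab(2), of "\<lambda>x. x powr (1 + \<alpha>)"] by blast
  moreover have "l = (1 + \<alpha>) * z powr \<alpha>" using DERIV_unique[OF z(3) d] z ab by simp
  ultimately show ?thesis using that ab nl_eq[of a] nl_eq[of b] by simp
qed

lemma nl_lip_nonneg:
  assumes \<alpha>: "0 < \<alpha>" and ab: "0 \<le> b" "b < a" "a \<le> M"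
  shows "\<bar>nl \<alpha> a - nl \<alpha> b\<bar> \<le> (1 + \<alpha>) * M powr \<alpha> * \<bar>a - b\<bar>"
proof -
  obtain z where z: "b < z" "z < a" "nl \<alpha> a - nl \<alpha> b = (a - b) * ((1 + \<alpha>) * z powr \<alpha>)"
    using nl_MVT[OF \<alpha> ab(1,2)] .
  have "z powr \<alpha> \<le> M powr \<alpha>" using z ab \<alpha> by (intro powr_mono2) auto
  then have "(a - b) * ((1 + \<alpha>) * z powr \<alpha>) \<le> (a - b) * ((1 + \<alpha>) * M powr \<alpha>)"
    using ab \<alpha> by (intro mult_left_mono) auto
  moreover have "0 \<le> (a - b) * ((1 + \<alpha>) * z powr \<alpha>)" using ab \<alpha> by simp
  ultimately show ?thesis using z ab by (simp add: mult_ac)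
qed

text \<open>Convexity of the power 1 + \<alpha>: the left side is its tangent at \<open>l\<close>,
  evaluated at \<open>z\<close>.\<close>

lemma nl_tangent:
  assumes \<alpha>: "0 < \<alpha>" and "0 \<le> l" "0 \<le> z"
  shows "l powr \<alpha> * ((1 + \<alpha>) * z - \<alpha> * l) \<le> nl \<alpha> z"
proof (cases z l rule: linorder_cases)
  case equal
  then show ?thesis using assms by (simp add: nl_def algebra_simps)
next
  case greater
  obtain y where y: "l < y" "nl \<alpha> z - nl \<alpha> l = (z - l) * ((1 + \<alpha>) * y powr \<alpha>)"
    using nl_MVT[OF \<alpha> assms(2) greater] .
  have "(z - l) * ((1 + \<alpha>) * l powr \<alpha>) \<le> (z - l) * ((1 + \<alpha>) * y powr \<alpha>)"
    using y greater assms by (intro mult_left_mono powr_mono2) auto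
  then show ?thesis using y assms by (simp add: nl_def algebra_simps)
next
  case less
  obtain y where y: "z < y" "y < l" "nl \<alpha> l - nl \<alpha> z = (l - z) * ((1 + \<alpha>) * y powr \<alpha>)"
    using nl_MVT[OF \<alpha> assms(3) less] .
  have "(l - z) * ((1 + \<alpha>) * y powr \<alpha>) \<le> (l - z) * ((1 + \<alpha>) * l powr \<alpha>)"
    using y less assms by (intro mult_left_mono powr_mono2) auto
  then show ?thesis using y assms by (simp add: nl_def algebra_simps)
qed

text \<open>For equal signs the derivative is at most (1 + \<alpha>) M^\<alpha> in modulus. For
  opposite signs the moduli of the values add up, and |a| + |b| = |a - b|.\<close>

lemma nl_lip:
  assumes \<alpha>: "0 < \<alpha>" and a: "\<bar>a\<bar> \<le> M" and b: "\<bar>b\<bar> \<le> M"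
  shows "\<bar>nl \<alpha> a - nl \<alpha> b\<bar> \<le> (1 + \<alpha>) * M powr \<alpha> * \<bar>a - b\<bar>"
proof -
  have opp: "\<bar>nl \<alpha> a - nl \<alpha> b\<bar> \<le> (1 + \<alpha>) * M powr \<alpha> * \<bar>a - b\<bar>"
    if "0 \<le> a" "b \<le> 0" "\<bar>a\<bar> \<le> M" "\<bar>b\<bar> \<le> M" for a b
  proof -
    have "\<bar>nl \<alpha> a\<bar> + \<bar>nl \<alpha> b\<bar> \<le> M powr \<alpha> * \<bar>a\<bar> + M powr \<alpha> * \<bar>b\<bar>"
      unfolding abs_nl using that \<alpha> by (intro add_mono mult_right_mono powr_mono2) auto
    also have "\<dots> = M powr \<alpha> * \<bar>a - b\<bar>" using that by (simp add: algebra_simps)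
    also have "\<dots> \<le> (1 + \<alpha>) * (M powr \<alpha> * \<bar>a - b\<bar>)" using \<alpha> by (simp add: distrib_right)
    finally show ?thesis by (simp add: mult.assoc)
  qed
  have nn: "\<bar>nl \<alpha> a - nl \<alpha> b\<bar> \<le> (1 + \<alpha>) * M powr \<alpha> * \<bar>a - b\<bar>"
    if "0 \<le> a" "0 \<le> b" "\<bar>a\<bar> \<le> M" "\<bar>b\<bar> \<le> M" for a b
    using that nl_lip_nonneg[OF \<alpha>, of b a M] nl_lip_nonneg[OF \<alpha>, of a b M]
    by (cases a b rule: linorder_cases) (auto simp: abs_minus_commute)
  consider "0 \<le> a" "0 \<le> b" | "0 \<le> a" "b \<le> 0" | "a \<le> 0" "0 \<le> b" | "a \<le> 0" "b \<le> 0" by linarith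
  then show ?thesis
  proof cases
    case 1 then show ?thesis using nn a b by blast
  next
    case 2 then show ?thesis using opp a b by blast
  next
    case 3 then show ?thesis using opp[of b a] a b by (simp add: abs_minus_commute)
  next
    case 4
    then show ?thesis using nn[of "- a" "- b"] a b by (simp add: nl_minus abs_minus_commute)
  qed
qed

section \<open>Solutions on closed time intervals\<close>

context kernel_semigroup
begin

text \<open>The solution of the problem with nonlinearity truncated at level \<open>M\<close>; it is global and defined
  everywhere, and it agrees a.e. with any solution that stays below \<open>M\<close>.\<close>

definition U :: "real \<Rightarrow> real \<Rightarrow> (real^'n \<Rightarrow> real) \<Rightarrow> real \<Rightarrow> real^'n \<Rightarrow> real" where
  "U \<alpha> M v0 = lipschitz_problem.sol Q (\<lambda>v. nl \<alpha> (clip M v)) v0"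

lemma lipschitz_problem_clip:
  assumes "0 < \<alpha>" "0 < M" and v0: "v0 \<in> borel_measurable borel" "\<And>x. \<bar>v0 x\<bar> \<le> K"
  shows "lipschitz_problem Q k (\<lambda>v. nl \<alpha> (clip M v)) ((1 + \<alpha>) * M powr \<alpha>) K v0"
proof (intro lipschitz_problem.intro kernel_semigroup_axioms lipschitz_problem_axioms.intro)
  fix a b
  have "\<bar>nl \<alpha> (clip M a) - nl \<alpha> (clip M b)\<bar> \<le> (1 + \<alpha>) * M powr \<alpha> * \<bar>clip M a - clip M b\<bar>"
    using assms by (intro nl_lip clip_bound) auto
  also have "\<dots> \<le> (1 + \<alpha>) * M powr \<alpha> * \<bar>a - b\<bar>"
    using assms by (intro mult_left_mono clip_lip) auto
  finally show "\<bar>nl \<alpha> (clip M a) - nl \<alpha> (clip M b)\<bar> \<le> (1 + \<alpha>) * M powr \<alpha> * \<bar>a - b\<bar>" .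
  show "nl \<alpha> (clip M 0) = 0" using assms by (simp add: clip_eq)
qed (use assms in auto)

text \<open>On a closed interval one bound holds for all times. The equation is also imposed at time
  0, where it fixes the initial value. Outside the interval \<open>u\<close> is merely
  measurable.\<close>

definition csol :: "real \<Rightarrow> (real^'n \<Rightarrow> real) \<Rightarrow> real \<Rightarrow> (real \<Rightarrow> real^'n \<Rightarrow> real) \<Rightarrow> bool" where
  "csol \<alpha> v0 \<tau> u \<longleftrightarrow> meas2 u \<and> (\<exists>C. \<forall>t\<in>{0..\<tau>}. AE x in lborel. \<bar>u t x\<bar> \<le> C) \<and>
     (\<forall>t\<in>{0..\<tau>}. AE x in lborel. u t x = P t v0 x + D (\<lambda>s y. nl \<alpha> (u s y)) t x)"

lemma D_cong:
  assumes "\<And>s y. 0 \<le> s \<Longrightarrow> s \<le> t \<Longrightarrow> g s y = h s y"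
  shows "D g t x = D h t x"
proof -
  have "indicator {0..t} s * P (t - s) (g s) x = indicator {0..t} s * P (t - s) (h s) x" for s
    using assms by (auto simp: indicator_def P_def)
  then show ?thesis by (simp only: D_eq)
qed

text \<open>A solution bounded by \<open>M\<close> also solves the problem truncated at
  \<open>M\<close>. For the uniqueness result both functions need bounds valid everywhere, so
  \<open>u\<close> is clipped and the truncated solution is set to 0 outside the interval.\<close>

lemma csol_unique:
  assumes u: "csol \<alpha> v0 \<tau> u" and C: "\<And>t. t \<in> {0..\<tau>} \<Longrightarrow> AE x in lborel. \<bar>u t x\<bar> \<le> C"
    and M: "0 < M" "C \<le> M" and \<alpha>: "0 < \<alpha>"
    and v0: "v0 \<in> borel_measurable borel" "\<And>x. \<bar>v0 x\<bar> \<le> K" and t: "t \<in> {0..\<tau>}"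
  shows "AE x in lborel. u t x = U \<alpha> M v0 t x"
proof -
  let ?f = "\<lambda>v. nl \<alpha> (clip M v)"
  interpret lipschitz_problem Q k ?f "(1 + \<alpha>) * M powr \<alpha>" K v0
    by (rule lipschitz_problem_clip[OF \<alpha> M(1) v0])
  have u_meas [measurable]: "meas2 u" using u by (simp add: csol_def)
  define u' where "u' t x = clip M (u t x)" for t x
  have [measurable]: "meas2 u'" unfolding u'_def by measurable
  have u'_eq: "AE x in lborel. u' t x = u t x" if "t \<in> {0..\<tau>}" for t
    using C[OF that] by eventually_elim (use M in \<open>simp add: u'_def clip_eq\<close>)
  define w where "w t x = (if 0 \<le> t \<and> t \<le> \<tau> then sol t x else 0)" for t x
  have [measurable]: "meas2 w" unfolding w_def by measurable
  define B where "B = max M (K * exp (2 * ((1 + \<alpha>) * M powr \<alpha>) * \<tau>))"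
  have "AE x in lborel. u' t x = w t x"
  proof (rule mild_unique[where \<tau>=\<tau> and C=B])
    show "\<bar>u' t x\<bar> \<le> B" for t x
      using clip_bound[of M "u t x"] M unfolding u'_def B_def by (simp add: le_max_iff_disj)
    show "\<bar>w t x\<bar> \<le> B" for t x
    proof (cases "0 \<le> t \<and> t \<le> \<tau>")
      case True
      have "\<bar>sol t x\<bar> \<le> K * exp (2 * ((1 + \<alpha>) * M powr \<alpha>) * t)" using True by (intro sol_bound) auto
      also have "\<dots> \<le> K * exp (2 * ((1 + \<alpha>) * M powr \<alpha>) * \<tau>)"
        using True L_pos K_nonneg by (intro mult_left_mono iffD2[OF exp_le_cancel_iff]) auto
      finally show ?thesis using True by (simp add: w_def B_def le_max_iff_disj)
    qed (use M in \<open>auto simp: w_def B_def le_max_iff_disj\<close>)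
    show "AE x in lborel. w t x = P t v0 x + D (\<lambda>s y. ?f (w s y)) t x" if "0 \<le> t" "t \<le> \<tau>" for t
    proof (rule AE_I2)
      fix x
      have "D (\<lambda>s y. ?f (w s y)) t x = D (\<lambda>s y. ?f (sol s y)) t x"
        by (rule D_cong) (use that in \<open>auto simp: w_def\<close>)
      then show "w t x = P t v0 x + D (\<lambda>s y. ?f (w s y)) t x"
        using sol_eq[OF that(1), of x] that by (simp add: w_def)
    qed
    show "AE x in lborel. u' t x = P t v0 x + D (\<lambda>s y. ?f (u' s y)) t x" if t: "0 \<le> t" "t \<le> \<tau>" for t
    proof -
      have "AE x in lborel. D (\<lambda>s y. nl \<alpha> (u s y)) t x = D (\<lambda>s y. ?f (u' s y)) t x"
      proof (rule D_AE_cong)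
        fix s assume "0 \<le> s" "s \<le> t"
        then have "AE y in lborel. u' s y = u s y" "AE y in lborel. \<bar>u s y\<bar> \<le> C" using u'_eq C t by auto
        then show "AE y in lborel. nl \<alpha> (u s y) = ?f (u' s y)"
          by eventually_elim (use M in \<open>simp add: clip_eq\<close>)
      qed measurable
      moreover have "AE x in lborel. u t x = P t v0 x + D (\<lambda>s y. nl \<alpha> (u s y)) t x"
        using u t by (simp add: csol_def)
      ultimately show ?thesis using u'_eq[of t] t by auto
    qed
  qed (use t in auto)
  then show ?thesis using u'_eq[OF t] t by (auto simp: U_def w_def elim: eventually_elim2)
qed

lemma U_measurable:
  assumes "0 < \<alpha>" "0 < M" "v0 \<in> borel_measurable borel" "\<And>x. \<bar>v0 x\<bar> \<le> K"
  shows "meas2 (U \<alpha> M v0)"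
  unfolding U_def by (rule lipschitz_problem.sol_measurable[OF lipschitz_problem_clip[OF assms]])

lemma U_eq:
  assumes "0 < \<alpha>" "0 < M" "v0 \<in> borel_measurable borel" "\<And>x. \<bar>v0 x\<bar> \<le> K" "0 \<le> t"
  shows "U \<alpha> M v0 t x = P t v0 x + D (\<lambda>s y. nl \<alpha> (clip M (U \<alpha> M v0 s y))) t x"
  unfolding U_def by (rule lipschitz_problem.sol_eq[OF lipschitz_problem_clip[OF assms(1-4)] assms(5)])

lemma U_bound:
  assumes "0 < \<alpha>" "0 < M" "v0 \<in> borel_measurable borel" "\<And>x. \<bar>v0 x\<bar> \<le> K" "0 \<le> t"
  shows "\<bar>U \<alpha> M v0 t x\<bar> \<le> K * exp (2 * ((1 + \<alpha>) * M powr \<alpha>) * t)"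
  unfolding U_def by (rule lipschitz_problem.sol_bound[OF lipschitz_problem_clip[OF assms(1-4)] assms(5)])

lemma cone_U:
  assumes "0 < \<alpha>" "0 < M" "cone k v0" "\<And>x. \<bar>v0 x\<bar> \<le> K" "0 \<le> t"
  shows "cone k (U \<alpha> M v0 t)"
  unfolding U_def
proof (rule lipschitz_problem.cone_sol[OF lipschitz_problem_clip[OF assms(1,2) cone_measurable[OF assms(3)] assms(4)] assms(3)])
  show "nl \<alpha> (clip M (- a)) = - nl \<alpha> (clip M a)" for a using assms by (simp add: clip_minus nl_minus)
  show "0 \<le> nl \<alpha> (clip M a)" if "0 \<le> a" for a
    using that assms by (intro nl_nonneg) (auto simp: clip_def)
qed (use assms in auto)

text \<open>As long as the truncated solution stays below its level, the truncation is
  inactive.\<close>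

lemma csol_U:
  assumes "0 < \<alpha>" "0 < M" "v0 \<in> borel_measurable borel" "\<And>x. \<bar>v0 x\<bar> \<le> K"
    and B: "\<And>t. t \<in> {0..\<tau>} \<Longrightarrow> AE x in lborel. \<bar>U \<alpha> M v0 t x\<bar> \<le> M"
  shows "csol \<alpha> v0 \<tau> (U \<alpha> M v0)"
  unfolding csol_def
proof (intro conjI ballI)
  show m [measurable]: "meas2 (U \<alpha> M v0)" by (rule U_measurable[OF assms(1-4)])
  show "\<exists>C. \<forall>t\<in>{0..\<tau>}. AE x in lborel. \<bar>U \<alpha> M v0 t x\<bar> \<le> C" using B by blast
  fix t assume t: "t \<in> {0..\<tau>}"
  have "AE x in lborel. D (\<lambda>s y. nl \<alpha> (U \<alpha> M v0 s y)) t x = D (\<lambda>s y. nl \<alpha> (clip M (U \<alpha> M v0 s y))) t x"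
  proof (rule D_AE_cong)
    fix s assume "0 \<le> s" "s \<le> t"
    then have "AE y in lborel. \<bar>U \<alpha> M v0 s y\<bar> \<le> M" using B t by auto
    then show "AE y in lborel. nl \<alpha> (U \<alpha> M v0 s y) = nl \<alpha> (clip M (U \<alpha> M v0 s y))"
      by eventually_elim (simp add: clip_eq)
  qed measurable
  then show "AE x in lborel. U \<alpha> M v0 t x = P t v0 x + D (\<lambda>s y. nl \<alpha> (U \<alpha> M v0 s y)) t x"
    by eventually_elim (use U_eq[OF assms(1-4), of t] t in auto)
qed

lemma csol_cong:
  assumes u: "csol \<alpha> v0 \<tau> u" and w [measurable]: "meas2 w" and eq: "\<And>t. t \<in> {0..\<tau>} \<Longrightarrow> AE x in lborel. w t x = u t x"
  shows "csol \<alpha> v0 \<tau> w"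
  unfolding csol_def
proof (intro conjI ballI w)
  have [measurable]: "meas2 u" using u by (simp add: csol_def)
  obtain C where C: "\<And>t. t \<in> {0..\<tau>} \<Longrightarrow> AE x in lborel. \<bar>u t x\<bar> \<le> C" using u unfolding csol_def by blast
  have "AE x in lborel. \<bar>w t x\<bar> \<le> C" if "t \<in> {0..\<tau>}" for t
    using C[OF that] eq[OF that] by eventually_elim simp
  then show "\<exists>C. \<forall>t\<in>{0..\<tau>}. AE x in lborel. \<bar>w t x\<bar> \<le> C" by blast
  fix t assume t: "t \<in> {0..\<tau>}"
  have "AE x in lborel. D (\<lambda>s y. nl \<alpha> (w s y)) t x = D (\<lambda>s y. nl \<alpha> (u s y)) t x"
  proof (rule D_AE_cong)
    fix s assume "0 \<le> s" "s \<le> t"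
    then have "AE y in lborel. w s y = u s y" using eq t by auto
    then show "AE y in lborel. nl \<alpha> (w s y) = nl \<alpha> (u s y)" by eventually_elim simp
  qed measurable
  moreover have "AE x in lborel. u t x = P t v0 x + D (\<lambda>s y. nl \<alpha> (u s y)) t x" using u t by (simp add: csol_def)
  ultimately show "AE x in lborel. w t x = P t v0 x + D (\<lambda>s y. nl \<alpha> (w s y)) t x"
    using eq[OF t] by eventually_elim simp
qed

lemma csol_mono: "csol \<alpha> v0 \<tau> u \<Longrightarrow> \<sigma> \<le> \<tau> \<Longrightarrow> csol \<alpha> v0 \<sigma> u"
  unfolding csol_def by fastforce

text \<open>On this time span the bound \<open>K * exp (2 * L * t)\<close> for the truncation at level \<open>2 * K\<close> does not
  exceed that level.\<close>

definition lifespan :: "real \<Rightarrow> real \<Rightarrow> real" where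
  "lifespan \<alpha> K = ln 2 / (2 * ((1 + \<alpha>) * (2 * K) powr \<alpha>))"

lemma lifespan_pos: "0 < \<alpha> \<Longrightarrow> 0 < K \<Longrightarrow> 0 < lifespan \<alpha> K"
  by (simp add: lifespan_def)

lemma U_local_bound:
  assumes "0 < \<alpha>" "0 < K" "v0 \<in> borel_measurable borel" "\<And>x. \<bar>v0 x\<bar> \<le> K" "0 \<le> t" "t \<le> lifespan \<alpha> K"
  shows "\<bar>U \<alpha> (2 * K) v0 t x\<bar> \<le> 2 * K"
proof -
  have "0 < 2 * ((1 + \<alpha>) * (2 * K) powr \<alpha>)" using assms by simp
  then have "2 * ((1 + \<alpha>) * (2 * K) powr \<alpha>) * t \<le> ln 2"
    using assms(6) by (simp add: lifespan_def pos_le_divide_eq mult.commute)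
  then have "exp (2 * ((1 + \<alpha>) * (2 * K) powr \<alpha>) * t) \<le> exp (ln 2)" by (simp only: exp_le_cancel_iff)
  then have "K * exp (2 * ((1 + \<alpha>) * (2 * K) powr \<alpha>) * t) \<le> K * 2"
    using assms by (intro mult_left_mono) auto
  moreover have "\<bar>U \<alpha> (2 * K) v0 t x\<bar> \<le> K * exp (2 * ((1 + \<alpha>) * (2 * K) powr \<alpha>) * t)"
    by (rule U_bound) (use assms in auto)
  ultimately show ?thesis by linarith
qed

lemma csol_local:
  assumes "0 < \<alpha>" "0 < K" "v0 \<in> borel_measurable borel" "\<And>x. \<bar>v0 x\<bar> \<le> K"
  shows "csol \<alpha> v0 (lifespan \<alpha> K) (U \<alpha> (2 * K) v0)"
  by (rule csol_U) (use assms U_local_bound[OF assms] in auto)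

section \<open>Restarting a solution\<close>

text \<open>Fubini carries \<open>P h\<close> through the time integral, and the semigroup law
  lengthens each delay from t - s to t + h - s.\<close>

lemma P_D:
  assumes g [measurable]: "meas2 g" and B: "\<And>s y. 0 \<le> s \<Longrightarrow> s \<le> t \<Longrightarrow> \<bar>g s y\<bar> \<le> B" and h: "0 \<le> h"
  shows "P h (D g t) x = (\<integral>s. indicator {0..t} s * P (t + h - s) (g s) x \<partial>lborel)"
proof -
  interpret prob_space "Q h" by (rule prob_space_Q)
  interpret pair_sigma_finite "Q h" "lborel :: real measure" ..
  let ?F = "\<lambda>y s. indicator {0..t} s * P (t - s) (g s) (x - y)"
  have meas: "(\<lambda>(y, s). ?F y s) \<in> borel_measurable (Q h \<Otimes>\<^sub>M lborel)"
    unfolding case_prod_beta' by (intro borel_measurable_times P_source_measurable'[OF g]) measurable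
  have Fb: "\<bar>?F y s\<bar> \<le> indicator {0..t} s * B" for y s
    using P_bound[OF meas2_section[OF g] B] by (auto simp: indicator_def)
  have indB: "integrable lborel (\<lambda>s. indicator {0..t} s * B)"
    by (intro integrable_mult_left) (auto simp: integrable_indicator_iff emeasure_lborel_Icc_eq)
  have int: "integrable (Q h \<Otimes>\<^sub>M lborel) (\<lambda>(y, s). ?F y s)"
  proof (rule Bochner_Integration.integrable_bound[OF _ meas])
    show "integrable (Q h \<Otimes>\<^sub>M lborel) (\<lambda>(y, s). indicator {0..t} s * B)"
      by (rule Fubini_integrable) (use indB in auto)
    show "AE p in Q h \<Otimes>\<^sub>M lborel. norm (case p of (y, s) \<Rightarrow> ?F y s) \<le> norm (case p of (y, s) \<Rightarrow> indicator {0..t} s * B)"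
      using Fb by (intro AE_I2) (auto intro: order_trans[OF _ abs_ge_self])
  qed
  have "P h (D g t) x = (\<integral>y. (\<integral>s. ?F y s \<partial>lborel) \<partial>Q h)" by (simp add: P_def[of h] D_eq)
  also have "\<dots> = (\<integral>s. (\<integral>y. ?F y s \<partial>Q h) \<partial>lborel)" by (rule Fubini_integral[OF int, symmetric])
  also have "\<dots> = (\<integral>s. indicator {0..t} s * P (t + h - s) (g s) x \<partial>lborel)"
  proof (rule Bochner_Integration.integral_cong[OF refl])
    fix s
    show "(\<integral>y. ?F y s \<partial>Q h) = indicator {0..t} s * P (t + h - s) (g s) x"
    proof (cases "s \<in> {0..t}")
      case True
      then have "P h (P (t - s) (g s)) x = P (h + (t - s)) (g s) x"
        using h by (intro P_add[OF meas2_section[OF g] B]) auto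
      then show ?thesis using True by (simp add: P_def[of h] algebra_simps)
    qed simp
  qed
  finally show ?thesis .
qed

text \<open>The time integral is split at \<open>t\<close>: the first part is \<open>P_D\<close>,
  the second a shift in time. The half-open interval after \<open>t\<close> differs from the closed
  one in \<open>D\<close> by a single point.\<close>

lemma D_restart:
  assumes g: "meas2 g" "\<And>s y. 0 \<le> s \<Longrightarrow> s \<le> t \<Longrightarrow> \<bar>g s y\<bar> \<le> B"
    and g': "meas2 g'" "\<And>s y. 0 \<le> s \<Longrightarrow> s \<le> h \<Longrightarrow> \<bar>g' s y\<bar> \<le> B'"
    and t: "0 \<le> t" "0 \<le> h"
  shows "D (\<lambda>s y. if s \<le> t then g s y else g' (s - t) y) (t + h) x = P h (D g t) x + D g' h x"
proof -
  define G where "G s y = (if s \<le> t then g s y else g' (s - t) y)" for s y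
  have [measurable]: "meas2 g" "meas2 g'" by fact+
  have [measurable]: "meas2 G" unfolding G_def by measurable
  have gB: "\<bar>G s y\<bar> \<le> max B B'" if "0 \<le> s" "s \<le> t + h" for s y
    using g(2)[of s y] g'(2)[of "s - t" y] that unfolding G_def by (auto simp: le_max_iff_disj)
  let ?F = "\<lambda>s. P (t + h - s) (G s) x"
  have intF: "integrable lborel (\<lambda>s. indicator {0..t + h} s * ?F s)" by (rule D_integrable[OF _ gB]) measurable
  have [measurable]: "?F \<in> borel_measurable borel" by (intro P_source_measurable') measurable
  have i1: "integrable lborel (\<lambda>s. indicator {0..t} s * ?F s)"
    by (rule Bochner_Integration.integrable_bound[OF intF]) (use t in \<open>auto simp: indicator_def\<close>)
  have i2: "integrable lborel (\<lambda>s. indicator {t<..t + h} s * ?F s)"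
    by (rule Bochner_Integration.integrable_bound[OF intF]) (use t in \<open>auto simp: indicator_def\<close>)
  have "D G (t + h) x = (\<integral>s. indicator {0..t} s * ?F s + indicator {t<..t + h} s * ?F s \<partial>lborel)"
    unfolding D_eq using t by (intro Bochner_Integration.integral_cong) (auto simp: indicator_def)
  also have "\<dots> = (\<integral>s. indicator {0..t} s * ?F s \<partial>lborel) + (\<integral>s. indicator {t<..t + h} s * ?F s \<partial>lborel)"
    by (rule Bochner_Integration.integral_add[OF i1 i2])
  also have "(\<integral>s. indicator {0..t} s * ?F s \<partial>lborel) = P h (D g t) x"
  proof (rule trans[OF _ P_D[symmetric]])
    have "indicator {0..t} s * P (t + h - s) (G s) x = indicator {0..t} s * P (t + h - s) (g s) x" for s
      by (auto simp: indicator_def G_def P_def)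
    then show "(\<integral>s. indicator {0..t} s * P (t + h - s) (G s) x \<partial>lborel) = (\<integral>s. indicator {0..t} s * P (t + h - s) (g s) x \<partial>lborel)"
      by (simp only:)
  qed (use g t in auto)
  also have "(\<integral>s. indicator {t<..t + h} s * ?F s \<partial>lborel) = (\<integral>s. indicator {t<..t + h} (s + t) * ?F (s + t) \<partial>lborel)"
    by (rule integral_lborel_plus[symmetric]) measurable
  also have "\<dots> = D g' h x"
    unfolding D_eq
  proof (rule integral_cong_AE)
    show "AE s in lborel. indicator {t<..t + h} (s + t) * ?F (s + t) = indicator {0..h} s * P (h - s) (g' s) x"
      using AE_lborel_singleton[of 0]
      by eventually_elim (auto simp: indicator_def G_def P_def)
    show "(\<lambda>s. indicator {0..h} s * P (h - s) (g' s) x) \<in> borel_measurable lborel"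
      by (intro borel_measurable_times P_source_measurable') measurable
  qed measurable
  finally show ?thesis by (simp add: G_def)
qed

text \<open>A local solution started from the state at time \<open>t\<close> is glued on. The time
  gained depends on the bound at time \<open>t\<close> and not on the earlier history; this is the
  source of the blow-up alternative.\<close>

lemma csol_restart:
  assumes u: "csol \<alpha> v0 t u" and t: "0 \<le> t" and K': "0 < K'" "AE x in lborel. \<bar>u t x\<bar> \<le> K'"
    and \<alpha>: "0 < \<alpha>" and v0: "v0 \<in> borel_measurable borel" "\<And>x. \<bar>v0 x\<bar> \<le> K"
  shows "\<exists>w. csol \<alpha> v0 (t + lifespan \<alpha> K') w"
proof -
  let ?\<delta> = "lifespan \<alpha> K'"
  obtain C where C: "\<And>s. s \<in> {0..t} \<Longrightarrow> AE x in lborel. \<bar>u s x\<bar> \<le> C" using u unfolding csol_def by blast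
  define M where "M = max C 1"
  have M: "0 < M" "C \<le> M" by (auto simp: M_def)
  define z where "z = U \<alpha> M v0"
  have z_meas [measurable]: "meas2 z" unfolding z_def by (rule U_measurable[OF \<alpha> M(1) v0])
  have uz: "AE x in lborel. u s x = z s x" if "s \<in> {0..t}" for s
    unfolding z_def by (rule csol_unique[OF u C M \<alpha> v0 that])
  have zM: "AE x in lborel. \<bar>z s x\<bar> \<le> M" if "s \<in> {0..t}" for s
    using uz[OF that] C[OF that] by eventually_elim (use M in auto)
  have [measurable]: "z t \<in> borel_measurable borel" by (rule meas2_section[OF z_meas])
  \<comment> \<open>Clipping yields an initial state bounded at every point and equal to
    \<open>z t\<close> almost everywhere.\<close>
  define v1 where "v1 x = clip K' (z t x)" for x
  have v1: "v1 \<in> borel_measurable borel" "\<And>x. \<bar>v1 x\<bar> \<le> K'"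
    unfolding v1_def using K' by (auto intro: clip_bound)
  have v1_eq: "AE x in lborel. v1 x = z t x"
    using uz[of t] K'(2) t by (auto simp: v1_def clip_eq elim: eventually_elim2)
  define V where "V = U \<alpha> (2 * K') v1"
  have V_meas [measurable]: "meas2 V" unfolding V_def by (rule U_measurable[OF \<alpha> _ v1]) (use K' in auto)
  have V_bound: "\<bar>V s x\<bar> \<le> 2 * K'" if "0 \<le> s" "s \<le> ?\<delta>" for s x
    unfolding V_def by (rule U_local_bound[OF \<alpha> K'(1) v1 that])
  define w where "w s x = (if s \<le> t then z s x else V (s - t) x)" for s x
  have [measurable]: "meas2 w" unfolding w_def by measurable
  let ?g = "\<lambda>s y. nl \<alpha> (clip M (z s y))" and ?g' = "\<lambda>s y. nl \<alpha> (clip (2 * K') (V s y))"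
  have gb: "\<bar>nl \<alpha> (clip A v)\<bar> \<le> A powr \<alpha> * A" if "0 < A" for A v
    unfolding abs_nl using clip_bound[of A v] that \<alpha> by (intro mult_mono powr_mono2) auto
  have "csol \<alpha> v0 (t + ?\<delta>) w"
    unfolding csol_def
  proof (intro conjI ballI)
    show "meas2 w" by measurable
    have "AE x in lborel. \<bar>w s x\<bar> \<le> max M (2 * K')" if "s \<in> {0..t + ?\<delta>}" for s
    proof (cases "s \<le> t")
      case True
      then show ?thesis using zM[of s] that by (auto simp: w_def le_max_iff_disj elim: eventually_mono)
    next
      case False
      then show ?thesis using V_bound[of "s - t"] that by (auto simp: w_def le_max_iff_disj)
    qed
    then show "\<exists>C. \<forall>s\<in>{0..t + ?\<delta>}. AE x in lborel. \<bar>w s x\<bar> \<le> C" by blast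
    fix s assume s: "s \<in> {0..t + ?\<delta>}"
    let ?G = "\<lambda>s y. if s \<le> t then ?g s y else ?g' (s - t) y"
    have DG: "AE x in lborel. D (\<lambda>s y. nl \<alpha> (w s y)) s x = D ?G s x"
    proof (rule D_AE_cong)
      show "meas2 (\<lambda>s y. nl \<alpha> (w s y))" by measurable
      show "meas2 ?G" by measurable
      fix r assume r: "0 \<le> r" "r \<le> s"
      show "AE y in lborel. nl \<alpha> (w r y) = ?G r y"
      proof (cases "r \<le> t")
        case True
        then show ?thesis using zM[of r] r by (auto simp: w_def clip_eq elim: eventually_mono)
      next
        case False
        then show ?thesis using V_bound[of "r - t"] r s by (auto simp: w_def clip_eq)
      qed
    qed
    show "AE x in lborel. w s x = P s v0 x + D (\<lambda>s y. nl \<alpha> (w s y)) s x"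
    proof (cases "s \<le> t")
      case True
      have "D ?G s x = D ?g s x" for x by (rule D_cong) (use True in auto)
      then have "w s x = P s v0 x + D ?G s x" for x
        using U_eq[OF \<alpha> M(1) v0, of s x] s True by (simp add: w_def z_def)
      then show ?thesis using DG by auto
    next
      case False
      define h where "h = s - t"
      have h: "0 \<le> h" "h \<le> ?\<delta>" "s = t + h" using s False by (auto simp: h_def)
      have g: "meas2 ?g" "meas2 ?g'" by measurable
      have z_eq: "z t y = P t v0 y + D ?g t y" for y
        unfolding z_def by (rule U_eq[OF \<alpha> M(1) v0 t])
      have zb: "\<bar>D ?g t y\<bar> \<le> \<bar>K * exp (2 * ((1 + \<alpha>) * M powr \<alpha>) * t)\<bar> + K" for y
        using z_eq[of y] U_bound[OF \<alpha> M(1) v0 t, of y] P_bound[OF v0, of t y] unfolding z_def by linarith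
      have [measurable]: "D ?g t \<in> borel_measurable borel" by (rule meas2_section[OF D_measurable[OF g(1)]])
      have [measurable]: "P t v0 \<in> borel_measurable borel" by (rule P_measurable1[OF v0(1)])
      have Pz: "P h (z t) x = P s v0 x + P h (D ?g t) x" for x
      proof -
        have "P h (z t) x = P h (\<lambda>y. P t v0 y - (- D ?g t y)) x" by (simp add: z_eq P_def[of h])
        also have "\<dots> = P h (P t v0) x - P h (\<lambda>y. - D ?g t y) x"
          by (rule P_diff[where B=K and B'="\<bar>K * exp (2 * ((1 + \<alpha>) * M powr \<alpha>) * t)\<bar> + K"])
             (use P_bound[OF v0] zb in auto)
        also have "P h (P t v0) x = P s v0 x"
          using P_add[OF v0 h(1) t, of x] by (simp add: h(3) add.commute)
        also have "P h (\<lambda>y. - D ?g t y) x = - P h (D ?g t) x" by (simp add: P_def[of h])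
        finally show ?thesis by simp
      qed
      have Vh: "V h x = P h v1 x + D ?g' h x" for x
        unfolding V_def by (rule U_eq[OF \<alpha> _ v1 h(1)]) (use K' in simp)
      have DGs: "D ?G s x = P h (D ?g t) x + D ?g' h x" for x
        unfolding h(3) by (rule D_restart[OF g(1) gb[OF M(1)] g(2) gb t h(1)]) (use K' in simp)
      have "AE x in lborel. P h v1 x = P h (z t) x"
        by (rule P_AE_cong[OF v1(1) _ v1_eq]) measurable
      then show ?thesis using DG
      proof eventually_elim
        case (elim x)
        have "w s x = V h x" using False by (simp add: w_def h_def)
        then show ?case using elim Vh[of x] DGs[of x] Pz[of x] by simp
      qed
    qed
  qed
  then show ?thesis by blast
qed

end

section \<open>Nonexistence of global solutions\<close>

text \<open>Jensen's inequality for the weight |W|, obtained by integrating the tangent inequality.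
  The sign condition allows \<open>f\<close> and \<open>W\<close> to change sign together, as
  members of the cone do.\<close>

lemma jensen_nl:
  fixes f W :: "'a \<Rightarrow> real"
  assumes \<alpha>: "0 < \<alpha>" and W: "integrable M W" and f: "f \<in> borel_measurable M" "AE x in M. \<bar>f x\<bar> \<le> C"
    and nn: "AE x in M. 0 \<le> f x * W x"
  shows "(\<integral>x. f x * W x \<partial>M) powr (1 + \<alpha>) \<le> (\<integral>x. nl \<alpha> (f x) * W x \<partial>M) * (\<integral>x. \<bar>W x\<bar> \<partial>M) powr \<alpha>"
proof -
  let ?S = "\<integral>x. f x * W x \<partial>M" and ?m = "\<integral>x. \<bar>W x\<bar> \<partial>M" and ?N = "\<integral>x. nl \<alpha> (f x) * W x \<partial>M"
  have [measurable]: "W \<in> borel_measurable M" "f \<in> borel_measurable M"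
    using W f by (auto simp: borel_measurable_integrable)
  have bdI: "integrable M (\<lambda>x. h x * W x)" if [measurable]: "h \<in> borel_measurable M" and "AE x in M. \<bar>h x\<bar> \<le> B" for h B
  proof (rule Bochner_Integration.integrable_bound)
    show "integrable M (\<lambda>x. B * W x)" using W by simp
    show "AE x in M. norm (h x * W x) \<le> norm (B * W x)"
      using that(2) by eventually_elim (auto simp: abs_mult intro!: mult_right_mono)
  qed measurable
  have ifW: "integrable M (\<lambda>x. f x * W x)" by (rule bdI[OF _ f(2)]) measurable
  have inW: "integrable M (\<lambda>x. nl \<alpha> (f x) * W x)"
  proof (rule bdI)
    show "AE x in M. \<bar>nl \<alpha> (f x)\<bar> \<le> C powr \<alpha> * C"
      using f(2) by eventually_elim (use \<alpha> in \<open>auto simp: abs_nl intro!: mult_mono powr_mono2\<close>)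
  qed measurable
  have fW: "AE x in M. f x * W x = \<bar>f x\<bar> * \<bar>W x\<bar> \<and> nl \<alpha> (f x) * W x = nl \<alpha> \<bar>f x\<bar> * \<bar>W x\<bar>"
    using nn
  proof eventually_elim
    case (elim x)
    then have e: "f x * W x = \<bar>f x\<bar> * \<bar>W x\<bar>" by (simp add: abs_mult[symmetric])
    have "nl \<alpha> (f x) * W x = \<bar>f x\<bar> powr \<alpha> * (f x * W x)" by (simp add: nl_def)
    also have "\<dots> = nl \<alpha> \<bar>f x\<bar> * \<bar>W x\<bar>" unfolding e by (simp add: nl_def)
    finally show ?case using e by simp
  qed
  have S_nn: "0 \<le> ?S" using nn by (rule integral_nonneg_AE)
  have N_nn: "0 \<le> ?N" by (rule integral_nonneg_AE) (use fW in \<open>eventually_elim, simp add: nl_nonneg\<close>)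
  have "?S powr (1 + \<alpha>) \<le> ?N * ?m powr \<alpha>" if S: "0 < ?S"
  proof -
    have "?m \<noteq> 0"
    proof
      assume "?m = 0"
      then have "AE x in M. W x = 0" using integral_nonneg_eq_0_iff_AE[OF integrable_abs[OF W]] by auto
      then have "?S = 0" by (intro integral_eq_zero_AE) auto
      then show False using S by simp
    qed
    moreover have "0 \<le> ?m" by (rule integral_nonneg_AE) auto
    ultimately have m: "0 < ?m" by linarith
    \<comment> \<open>The tangent is taken at the mean of |f| with respect to |W|; with this choice
      the integrated tangent collapses to l^\<alpha> times the pairing of \<open>f\<close> and
      \<open>W\<close>.\<close>
    define l where "l = ?S / ?m"
    have l: "0 < l" using S m by (simp add: l_def)
    have "(\<integral>x. l powr \<alpha> * ((1 + \<alpha>) * (f x * W x) - \<alpha> * l * \<bar>W x\<bar>) \<partial>M) \<le> ?N"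
    proof (rule integral_mono_AE)
      show "integrable M (\<lambda>x. l powr \<alpha> * ((1 + \<alpha>) * (f x * W x) - \<alpha> * l * \<bar>W x\<bar>))"
        using ifW W by (intro integrable_mult_right Bochner_Integration.integrable_diff integrable_abs)
      show "AE x in M. l powr \<alpha> * ((1 + \<alpha>) * (f x * W x) - \<alpha> * l * \<bar>W x\<bar>) \<le> nl \<alpha> (f x) * W x"
        using fW
      proof eventually_elim
        case (elim x)
        have "l powr \<alpha> * ((1 + \<alpha>) * \<bar>f x\<bar> - \<alpha> * l) * \<bar>W x\<bar> \<le> nl \<alpha> \<bar>f x\<bar> * \<bar>W x\<bar>"
          using l by (intro mult_right_mono nl_tangent \<alpha>) auto
        then show ?case using elim by (simp add: algebra_simps)
      qed
    qed (rule inW)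
    also have "(\<integral>x. l powr \<alpha> * ((1 + \<alpha>) * (f x * W x) - \<alpha> * l * \<bar>W x\<bar>) \<partial>M) = l powr \<alpha> * ((1 + \<alpha>) * ?S - \<alpha> * l * ?m)"
      using ifW integrable_abs[OF W] by (simp add: Bochner_Integration.integral_diff)
    also have "\<dots> = l powr \<alpha> * ?S" using m by (simp add: l_def algebra_simps)
    finally have "l powr \<alpha> * ?S * ?m powr \<alpha> \<le> ?N * ?m powr \<alpha>" by (rule mult_right_mono) simp
    moreover have "l powr \<alpha> * ?S * ?m powr \<alpha> = ?S powr (1 + \<alpha>)"
      using S m by (simp add: l_def powr_divide powr_add)
    ultimately show ?thesis by simp
  qed
  then show ?thesis using S_nn N_nn by (cases "?S = 0") auto
qed

text \<open>The time needed to double \<open>Z\<close> decreases geometrically with ratio \<open>2 powr (- \<alpha>)\<close>.\<close>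

lemma doubling_blowup:
  fixes Z q :: "real \<Rightarrow> real"
  assumes \<alpha>: "0 < \<alpha>" and \<kappa>: "0 < \<kappa>" and ab: "a \<le> b"
    and q: "integrable lborel (\<lambda>r. indicator {a..b} r * q r)"
    and Z_eq: "\<And>s t. a \<le> s \<Longrightarrow> s \<le> t \<Longrightarrow> t \<le> b \<Longrightarrow> Z t = Z s + (\<integral>r. indicator {s<..t} r * q r \<partial>lborel)"
    and Z_nn: "0 \<le> Z a" and q_ge: "\<And>r. a \<le> r \<Longrightarrow> r \<le> b \<Longrightarrow> \<kappa> * (Z r powr (1 + \<alpha>)) \<le> q r"
  shows "\<kappa> * Z a powr \<alpha> * (b - a) \<le> 1 / (1 - 2 powr (- \<alpha>))"
proof (rule ccontr)
  assume neg: "\<not> ?thesis"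
  define \<theta> where "\<theta> = 2 powr (- \<alpha>)"
  have \<theta>: "0 < \<theta>" "\<theta> < 1" using \<alpha> by (auto simp: \<theta>_def powr_less_one)
  have pos: "0 < \<kappa> * Z a powr \<alpha> * (b - a)"
    using neg \<theta> by (smt (verit) \<theta>_def divide_nonneg_pos)
  then have Za: "0 < Z a" using Z_nn by (cases "Z a = 0") auto
  \<comment> \<open>A time span that suffices for \<open>Z\<close> to grow from \<open>Z a\<close>
    to twice that value: the growth rate is at least \<kappa> (Z a)^(1+\<alpha>).\<close>
  define c where "c = 1 / (\<kappa> * Z a powr \<alpha>)"
  have c: "0 < c" using \<kappa> Za by (simp add: c_def)
  \<comment> \<open>By time \<open>s n\<close> the value has reached 2^n Z a. The geometric sum
    keeps all these times below \<open>b\<close> under the negated claim.\<close>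
  define s where "s n = a + c * (\<Sum>j<n. \<theta> ^ j)" for n
  have sum_le: "(\<Sum>j<n. \<theta> ^ j) \<le> 1 / (1 - \<theta>)" for n
    using \<theta> by (simp add: sum_gp_strict divide_right_mono)
  have s_le: "s n \<le> b" for n
  proof -
    have "c * (\<Sum>j<n. \<theta> ^ j) \<le> c * (1 / (1 - \<theta>))" using c sum_le by (intro mult_left_mono) auto
    also have "\<dots> \<le> c * (\<kappa> * Z a powr \<alpha> * (b - a))" using neg c by (intro mult_left_mono) (auto simp: \<theta>_def)
    also have "\<dots> = b - a" using \<kappa> Za by (simp add: c_def)
    finally show ?thesis by (simp add: s_def)
  qed
  have s_mono: "s n \<le> s (Suc n)" and s_ge: "a \<le> s n" for n
    using c \<theta> by (auto simp: s_def intro!: sum_nonneg mult_left_mono mult_nonneg_nonneg)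
  have q_nn: "0 \<le> q r" if "a \<le> r" "r \<le> b" for r
    using q_ge[OF that] \<kappa> by (smt (verit) mult_nonneg_nonneg powr_ge_zero)
  have q_int: "integrable lborel (\<lambda>r. indicator {x<..y} r * q r)" if "a \<le> x" "y \<le> b" for x y
  proof -
    have "integrable lborel (\<lambda>r. indicator {x<..y} r *\<^sub>R (indicator {a..b} r * q r))"
      by (rule integrable_mult_indicator[OF _ q]) simp
    moreover have "indicator {x<..y} r *\<^sub>R (indicator {a..b} r * q r) = indicator {x<..y} r * q r" for r
      using that by (auto simp: indicator_def)
    ultimately show ?thesis by (simp only:)
  qed
  have Z_mono: "Z x \<le> Z y" if "a \<le> x" "x \<le> y" "y \<le> b" for x y
  proof -
    have "0 \<le> (\<integral>r. indicator {x<..y} r * q r \<partial>lborel)"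
      by (intro integral_nonneg_AE AE_I2) (use q_nn that in \<open>auto simp: indicator_def\<close>)
    then show ?thesis using Z_eq[OF that] by simp
  qed
  have double: "2 ^ n * Z a \<le> Z (s n)" for n
  proof (induction n)
    case 0
    then show ?case by (simp add: s_def)
  next
    case (Suc n)
    let ?e = "\<kappa> * (2 ^ n * Z a) powr (1 + \<alpha>)"
    have "(s (Suc n) - s n) * ?e = (\<integral>r. indicator {s n<..s (Suc n)} r * ?e \<partial>lborel)"
      using s_mono[of n] by simp
    also have "\<dots> \<le> (\<integral>r. indicator {s n<..s (Suc n)} r * q r \<partial>lborel)"
    proof (rule integral_mono)
      show "integrable lborel (\<lambda>r. indicator {s n<..s (Suc n)} r * ?e)"
        by (intro integrable_mult_left) (auto simp: integrable_indicator_iff emeasure_lborel_Ioc[OF s_mono])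
      show "integrable lborel (\<lambda>r. indicator {s n<..s (Suc n)} r * q r)"
        by (rule q_int[OF s_ge s_le])
      fix r
      show "indicator {s n<..s (Suc n)} r * ?e \<le> indicator {s n<..s (Suc n)} r * q r"
      proof (cases "r \<in> {s n<..s (Suc n)}")
        case True
        then have r: "a \<le> r" "r \<le> b" "s n \<le> r" using s_ge[of n] s_le[of "Suc n"] by auto
        have "2 ^ n * Z a \<le> Z r" using Suc Z_mono[OF s_ge r(3,2)] by simp
        then have "?e \<le> \<kappa> * Z r powr (1 + \<alpha>)"
          using \<kappa> \<alpha> Za by (intro mult_left_mono powr_mono2) auto
        also have "\<dots> \<le> q r" by (rule q_ge[OF r(1,2)])
        finally show ?thesis using True by simp
      qed simp
    qed
    also have "\<dots> = Z (s (Suc n)) - Z (s n)" using Z_eq[OF s_ge s_mono s_le, of n] by simp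
    finally have "(s (Suc n) - s n) * ?e \<le> Z (s (Suc n)) - Z (s n)" .
    \<comment> \<open>The length of the n-th step is chosen so that the guaranteed gain equals the
      level 2^n Z a already reached.\<close>
    moreover have "(s (Suc n) - s n) * ?e = 2 ^ n * Z a"
    proof -
      have one: "\<theta> ^ n * (2 ^ n) powr \<alpha> = 1"
      proof (induction n)
        case (Suc n)
        have "\<theta> ^ Suc n * (2 ^ Suc n) powr \<alpha> = (\<theta> * 2 powr \<alpha>) * (\<theta> ^ n * (2 ^ n) powr \<alpha>)"
          by (simp add: powr_mult mult_ac)
        also have "\<theta> * 2 powr \<alpha> = 1" by (simp add: \<theta>_def powr_add[symmetric])
        finally show ?case using Suc by simp
      qed simp
      have e2: "(2 ^ n * Z a) powr (1 + \<alpha>) = (2 ^ n) powr \<alpha> * Z a powr \<alpha> * (2 ^ n * Z a)"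
        using Za by (simp add: powr_add powr_mult)
      have e3: "s (Suc n) - s n = c * \<theta> ^ n" by (simp add: s_def algebra_simps)
      have "(s (Suc n) - s n) * ?e = (c * (\<kappa> * Z a powr \<alpha>)) * (\<theta> ^ n * (2 ^ n) powr \<alpha>) * (2 ^ n * Z a)"
        unfolding e2 e3 by (simp only: mult_ac)
      moreover have "c * (\<kappa> * Z a powr \<alpha>) = 1" using \<kappa> Za by (simp add: c_def)
      ultimately show ?thesis using one by simp
    qed
    ultimately show ?case using Suc by simp
  qed
  \<comment> \<open>The single number \<open>Z b\<close> would have to exceed every 2^n Z a.\<close>
  obtain n where "Z b / Z a < 2 ^ n" using real_arch_pow[of 2 "Z b / Z a"] by auto
  then have "Z b < 2 ^ n * Z a" using Za by (simp add: pos_divide_less_eq)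
  then show False using double[of n] Z_mono[OF s_ge s_le order_refl, of n] by simp
qed

section \<open>Pairing a solution with evolved test functions\<close>

context kernel_semigroup
begin

text \<open>Fubini brings the time integral outside, and self-adjointness moves the delayed
  semigroup from the source onto \<open>h\<close>.\<close>

lemma D_pairing:
  assumes g: "meas2 g" "\<And>s y. 0 \<le> s \<Longrightarrow> s \<le> t \<Longrightarrow> \<bar>g s y\<bar> \<le> B" and h: "integrable lborel h"
  shows "integrable lborel (\<lambda>s. indicator {0..t} s * (\<integral>y. g s y * P (t - s) h y \<partial>lborel))"
    and "(\<integral>x. D g t x * h x \<partial>lborel) = (\<integral>s. indicator {0..t} s * (\<integral>y. g s y * P (t - s) h y \<partial>lborel) \<partial>lborel)"
proof -
  have [measurable]: "h \<in> borel_measurable borel" using h by (simp add: borel_measurable_integrable)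
  let ?F = "\<lambda>s x. indicator {0..t} s * P (t - s) (g s) x * h x"
  have meas: "(\<lambda>(s, x). ?F s x) \<in> borel_measurable (lborel \<Otimes>\<^sub>M lborel)"
    unfolding case_prod_beta' by (intro borel_measurable_times P_source_measurable'[OF g(1)]) measurable
  have Fb: "\<bar>?F s x\<bar> \<le> indicator {0..t} s * \<bar>B\<bar> * \<bar>h x\<bar>" for s x
  proof (cases "s \<in> {0..t}")
    case True
    then have "\<bar>P (t - s) (g s) x\<bar> \<le> \<bar>B\<bar>"
      using P_bound[OF meas2_section[OF g(1)] g(2), of s "t - s" x] by auto
    then have "\<bar>P (t - s) (g s) x\<bar> * \<bar>h x\<bar> \<le> \<bar>B\<bar> * \<bar>h x\<bar>" by (rule mult_right_mono) simp
    then show ?thesis using True by (simp add: abs_mult)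
  qed simp
  have int: "integrable (lborel \<Otimes>\<^sub>M lborel) (\<lambda>(s, x). ?F s x)"
  proof (rule Bochner_Integration.integrable_bound[OF _ meas])
    have "integrable lborel (\<lambda>s. indicator {0..t} s * \<bar>B\<bar>)"
      by (intro integrable_mult_left) (auto simp: integrable_indicator_iff emeasure_lborel_Icc_eq)
    then show "integrable (lborel \<Otimes>\<^sub>M lborel) (\<lambda>(s, x). indicator {0..t} s * \<bar>B\<bar> * \<bar>h x\<bar>)"
      using h by (intro lborel_pair.Fubini_integrable) (auto simp: abs_mult)
    show "AE p in lborel \<Otimes>\<^sub>M lborel. norm (case p of (s, x) \<Rightarrow> ?F s x) \<le> norm (case p of (s, x) \<Rightarrow> indicator {0..t} s * \<bar>B\<bar> * \<bar>h x\<bar>)"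
      using Fb by (intro AE_I2) (auto simp: abs_mult)
  qed
  have eq: "(\<integral>x. ?F s x \<partial>lborel) = indicator {0..t} s * (\<integral>y. g s y * P (t - s) h y \<partial>lborel)" for s
  proof (cases "s \<in> {0..t}")
    case True
    then show ?thesis using P_dual[OF meas2_section[OF g(1)] g(2) h, of s "t - s"] by simp
  qed simp
  show "integrable lborel (\<lambda>s. indicator {0..t} s * (\<integral>y. g s y * P (t - s) h y \<partial>lborel))"
    using lborel_pair.integrable_fst[OF int] by (simp only: eq)
  have "(\<integral>x. D g t x * h x \<partial>lborel) = (\<integral>x. (\<integral>s. ?F s x \<partial>lborel) \<partial>lborel)" by (simp add: D_eq)
  also have "\<dots> = (\<integral>s. (\<integral>x. ?F s x \<partial>lborel) \<partial>lborel)" by (rule lborel_pair.Fubini_integral[OF int])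
  finally show "(\<integral>x. D g t x * h x \<partial>lborel) = (\<integral>s. indicator {0..t} s * (\<integral>y. g s y * P (t - s) h y \<partial>lborel) \<partial>lborel)"
    by (simp only: eq)
qed

text \<open>The test function runs backwards in time: at time \<open>s\<close> it is
  \<open>P (t + \<tau> - s) w\<close>. The linear part of the equation is thereby absorbed and the
  nonlinear source alone drives the pairing.\<close>

lemma csol_pairing:
  assumes u: "csol \<alpha> v0 t u" and \<alpha>: "0 < \<alpha>" and v0: "v0 \<in> borel_measurable borel" "\<And>x. \<bar>v0 x\<bar> \<le> K"
    and w: "integrable lborel w" "\<And>x. \<bar>w x\<bar> \<le> B" and t: "0 \<le> t" "0 \<le> \<tau>"
  shows "integrable lborel (\<lambda>s. indicator {0..t} s * (\<integral>y. nl \<alpha> (u s y) * P (t + \<tau> - s) w y \<partial>lborel))"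
    and "(\<integral>x. u t x * P \<tau> w x \<partial>lborel) = (\<integral>x. v0 x * P (t + \<tau>) w x \<partial>lborel)
      + (\<integral>s. indicator {0..t} s * (\<integral>y. nl \<alpha> (u s y) * P (t + \<tau> - s) w y \<partial>lborel) \<partial>lborel)"
proof -
  have [measurable]: "w \<in> borel_measurable borel" using w by (simp add: borel_measurable_integrable)
  have u_meas [measurable]: "meas2 u" using u by (simp add: csol_def)
  have us [measurable]: "u s \<in> borel_measurable borel" for s by (rule meas2_section[OF u_meas])
  obtain C where C: "\<And>s. s \<in> {0..t} \<Longrightarrow> AE x in lborel. \<bar>u s x\<bar> \<le> C" using u unfolding csol_def by blast
  define M where "M = max C 1"
  have M: "0 < M" "C \<le> M" by (auto simp: M_def)
  define z where "z = U \<alpha> M v0"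
  have z_meas [measurable]: "meas2 z" unfolding z_def by (rule U_measurable[OF \<alpha> M(1) v0])
  have zs [measurable]: "z s \<in> borel_measurable borel" for s by (rule meas2_section[OF z_meas])
  have uz: "AE x in lborel. u s x = z s x" if "s \<in> {0..t}" for s
    unfolding z_def by (rule csol_unique[OF u C M \<alpha> v0 that])
  let ?g = "\<lambda>s y. nl \<alpha> (clip M (z s y))"
  have g: "meas2 ?g" by measurable
  have gb: "\<bar>nl \<alpha> (clip M v)\<bar> \<le> M powr \<alpha> * M" for v
    unfolding abs_nl using clip_bound[of M v] M \<alpha> by (intro mult_mono powr_mono2) auto
  let ?h = "P \<tau> w"
  have h: "integrable lborel ?h" by (rule integrable_P(1)[OF w(1)])
  have Ph: "P s (P \<tau> w) x = P (s + \<tau>) w x" if "0 \<le> s" for s x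
    by (rule P_add[OF _ w(2) that t(2)]) measurable
  have Phs: "P (t - s) (P \<tau> w) x = P (t + \<tau> - s) w x" if "s \<le> t" for s x
    using Ph[of "t - s" x] that by (simp add: algebra_simps)
  have eq: "indicator {0..t} s * (\<integral>y. ?g s y * P (t - s) ?h y \<partial>lborel)
      = indicator {0..t} s * (\<integral>y. nl \<alpha> (u s y) * P (t + \<tau> - s) w y \<partial>lborel)" for s
  proof (cases "s \<in> {0..t}")
    case True
    have "(\<integral>y. ?g s y * P (t - s) ?h y \<partial>lborel) = (\<integral>y. nl \<alpha> (u s y) * P (t + \<tau> - s) w y \<partial>lborel)"
    proof (rule integral_cong_AE)
      show "AE y in lborel. ?g s y * P (t - s) ?h y = nl \<alpha> (u s y) * P (t + \<tau> - s) w y"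
        using uz[OF True] C[OF True] by eventually_elim (use M True Phs in \<open>auto simp: clip_eq\<close>)
    qed measurable
    then show ?thesis by simp
  qed simp
  show "integrable lborel (\<lambda>s. indicator {0..t} s * (\<integral>y. nl \<alpha> (u s y) * P (t + \<tau> - s) w y \<partial>lborel))"
    using D_pairing(1)[OF g gb h, of t] unfolding eq .
  have [measurable]: "D ?g t \<in> borel_measurable borel" by (rule meas2_section[OF D_measurable[OF g]])
  have [measurable]: "P t v0 \<in> borel_measurable borel" by (rule P_measurable1[OF v0(1)])
  have z_eq: "z t y = P t v0 y + D ?g t y" for y
    unfolding z_def by (rule U_eq[OF \<alpha> M(1) v0 t(1)])
  have Db: "\<bar>D ?g t y\<bar> \<le> \<bar>K * exp (2 * ((1 + \<alpha>) * M powr \<alpha>) * t)\<bar> + K" for y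
    using z_eq[of y] U_bound[OF \<alpha> M(1) v0 t(1), of y] P_bound[OF v0, of t y] unfolding z_def by linarith
  have i1: "integrable lborel (\<lambda>x. P t v0 x * ?h x)"
    using integrable_mult_bounded[OF h, of "P t v0" K] P_bound[OF v0] by (simp add: mult.commute)
  have i2: "integrable lborel (\<lambda>x. D ?g t x * ?h x)"
    using integrable_mult_bounded[OF h, of "D ?g t" "\<bar>K * exp (2 * ((1 + \<alpha>) * M powr \<alpha>) * t)\<bar> + K"] Db
    by (simp add: mult.commute[of "P \<tau> w _"])
  have "(\<integral>x. u t x * ?h x \<partial>lborel) = (\<integral>x. P t v0 x * ?h x + D ?g t x * ?h x \<partial>lborel)"
  proof (rule integral_cong_AE)
    show "AE x in lborel. u t x * ?h x = P t v0 x * ?h x + D ?g t x * ?h x"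
      using uz[of t] t by (auto elim!: eventually_mono simp: z_eq distrib_right)
  qed measurable
  also have "\<dots> = (\<integral>x. P t v0 x * ?h x \<partial>lborel) + (\<integral>x. D ?g t x * ?h x \<partial>lborel)"
    by (rule Bochner_Integration.integral_add[OF i1 i2])
  also have "(\<integral>x. P t v0 x * ?h x \<partial>lborel) = (\<integral>x. v0 x * P (t + \<tau>) w x \<partial>lborel)"
    using P_dual[OF v0 h, of t] Ph[OF t(1)] by simp
  also have "(\<integral>x. D ?g t x * ?h x \<partial>lborel) = (\<integral>s. indicator {0..t} s * (\<integral>y. nl \<alpha> (u s y) * P (t + \<tau> - s) w y \<partial>lborel) \<partial>lborel)"
    using D_pairing(2)[OF g gb h, of t] unfolding eq .
  finally show "(\<integral>x. u t x * P \<tau> w x \<partial>lborel) = (\<integral>x. v0 x * P (t + \<tau>) w x \<partial>lborel)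
      + (\<integral>s. indicator {0..t} s * (\<integral>y. nl \<alpha> (u s y) * P (t + \<tau> - s) w y \<partial>lborel) \<partial>lborel)" .
qed

text \<open>A solution is determined up to null sets; the truncated solution is a representative
  lying in the cone.\<close>

lemma csol_cone_nonneg:
  assumes u: "csol \<alpha> v0 t u" and \<alpha>: "0 < \<alpha>" and v0: "cone k v0" "\<And>x. \<bar>v0 x\<bar> \<le> K" and t: "0 \<le> t"
    and W: "cone k W"
  shows "AE x in lborel. 0 \<le> u t x * W x"
proof -
  obtain C where C: "\<And>s. s \<in> {0..t} \<Longrightarrow> AE x in lborel. \<bar>u s x\<bar> \<le> C" using u unfolding csol_def by blast
  have "AE x in lborel. u t x = U \<alpha> (max C 1) v0 t x"
    by (rule csol_unique[OF u C _ _ \<alpha> cone_measurable[OF v0(1)] v0(2)]) (use t in auto)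
  moreover have "cone k (U \<alpha> (max C 1) v0 t)" by (rule cone_U[OF \<alpha> _ v0 t]) auto
  ultimately show ?thesis using cone_mult_nonneg[OF _ W] by (auto elim!: eventually_mono)
qed

end

section \<open>The contradiction for a global solution\<close>

lemma cone_nth: "cone k (\<lambda>x. x $ k)"
  by (simp add: cone_def)

lemma nn_integral_inverse_Icc:
  assumes "0 < a" "a \<le> b" "0 \<le> d"
  shows "(\<integral>\<^sup>+r. ennreal (d / r) * indicator {a..b} r \<partial>lborel) = ennreal (d * ln b - d * ln a)"
  by (rule nn_integral_FTC_Icc) (use assms in \<open>auto intro!: derivative_eq_intros divide_nonneg_pos\<close>)

context kernel_semigroup
begin

text \<open>Stated for an abstract family of test functions: its essential data are the cone, the
  growth of the mass, the bound by |x_k|, and the limit of the evolved functions.\<close>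

lemma no_global_solution:
  fixes w :: "real \<Rightarrow> real^'n \<Rightarrow> real"
  assumes \<alpha>: "0 < \<alpha>" and v0: "cone k v0" "\<And>x. \<bar>v0 x\<bar> \<le> K" and nz: "\<not> (AE x in lborel. v0 x = 0)"
    and w: "\<And>t. 0 < t \<Longrightarrow> cone k (w t)" "\<And>t. 0 < t \<Longrightarrow> integrable lborel (w t)" "\<And>t x. 0 < t \<Longrightarrow> \<bar>w t x\<bar> \<le> B t"
    and cw: "0 < cw" "\<And>t. 0 < t \<Longrightarrow> (\<integral>x. \<bar>w t x\<bar> \<partial>lborel) \<le> cw * t powr (1 / \<alpha>)"
    and w_le: "\<And>t x. 0 < t \<Longrightarrow> \<bar>w t x\<bar> \<le> \<bar>x $ k\<bar>"
    and c: "0 < c" "\<And>s x. 0 \<le> s \<Longrightarrow> ((\<lambda>t. P (t + s) (w t) x) \<longlongrightarrow> c * x $ k) at_top"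
    and u: "\<And>\<tau>. csol \<alpha> v0 \<tau> u"
  shows False
proof -
  have [measurable]: "v0 \<in> borel_measurable borel" using v0(1) by (rule cone_measurable)
  have u_meas [measurable]: "meas2 u" using u by (simp add: csol_def)
  have us [measurable]: "u s \<in> borel_measurable borel" for s by (rule meas2_section[OF u_meas])
  have w_meas: "w t \<in> borel_measurable borel" if "0 < t" for t
    using cone_measurable[OF w(1)[OF that]] .
  have cPw: "cone k (P s (w t))" if "0 < t" for s t
    by (rule cone_P[OF w(1,3)]) (use that in auto)
  have iPw: "integrable lborel (P s (w t))" if "0 < t" for s t
    by (rule integrable_P(1)[OF w(2)[OF that]])
  have u_bd: "\<exists>C. AE x in lborel. \<bar>u s x\<bar> \<le> C" if "0 \<le> s" for s
  proof -
    have "\<exists>C. \<forall>t\<in>{0..s}. AE x in lborel. \<bar>u t x\<bar> \<le> C" using u[of s] by (simp add: csol_def)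
    moreover have "s \<in> {0..s}" using that by simp
    ultimately show ?thesis by blast
  qed
  have u_nn: "AE x in lborel. 0 \<le> u s x * W x" if "0 \<le> s" "cone k W" for s W
    by (rule csol_cone_nonneg[OF u \<alpha> v0 that])
  have nl_nn: "AE x in lborel. 0 \<le> nl \<alpha> (u s x) * W x" if "0 \<le> s" "cone k W" for s W
    using u_nn[OF that]
  proof eventually_elim
    case (elim x)
    then have "0 \<le> \<bar>u s x\<bar> powr \<alpha> * (u s x * W x)" by simp
    then show ?case by (simp add: nl_def mult.assoc)
  qed
  have inl: "integrable lborel (\<lambda>x. nl \<alpha> (u s x) * W x)" if "0 \<le> s" "integrable lborel W" for s W
  proof -
    note prems = that
    obtain C where C: "AE x in lborel. \<bar>u s x\<bar> \<le> C" using u_bd[OF prems(1)] by blast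
    have [measurable]: "W \<in> borel_measurable borel" using that(2) by (simp add: borel_measurable_integrable)
    show ?thesis
    proof (rule Bochner_Integration.integrable_bound)
      show "integrable lborel (\<lambda>x. (C powr \<alpha> * C) * W x)" using that(2) by (rule integrable_mult_right)
      show "AE x in lborel. norm (nl \<alpha> (u s x) * W x) \<le> norm ((C powr \<alpha> * C) * W x)"
        using C
      proof eventually_elim
        case (elim x)
        then have "\<bar>nl \<alpha> (u s x)\<bar> \<le> C powr \<alpha> * C" "0 \<le> C"
          using \<alpha> by (auto simp: abs_nl intro!: mult_mono powr_mono2)
        then show ?case by (simp add: abs_mult mult_right_mono)
      qed
    qed measurable
  qed
  \<comment> \<open>\<open>Z \<tau> R s\<close> pairs the solution at time \<open>s\<close> with the
    test function evolved for the remaining time up to the horizon \<tau>. \<open>q\<close> is the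
    growth rate of this quantity in \<open>s\<close>, and \<open>J\<close> the contribution of the
    datum.\<close>
  define J where "J \<tau> R = (\<integral>x. v0 x * P \<tau> (w R) x \<partial>lborel)" for \<tau> R
  define Z where "Z \<tau> R s = (\<integral>x. u s x * P (\<tau> - s) (w R) x \<partial>lborel)" for \<tau> R s
  define q where "q \<tau> R r = (\<integral>x. nl \<alpha> (u r x) * P (\<tau> - r) (w R) x \<partial>lborel)" for \<tau> R r
  have q_int: "integrable lborel (\<lambda>r. indicator {0..s} r * q \<tau> R r)"
    and Z_eq: "Z \<tau> R s = J \<tau> R + (\<integral>r. indicator {0..s} r * q \<tau> R r \<partial>lborel)"
    if "0 < R" "0 \<le> s" "s \<le> \<tau>" for \<tau> R s
  proof -
    have "0 \<le> \<tau> - s" "s + (\<tau> - s) = \<tau>" using that by auto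
    then show "integrable lborel (\<lambda>r. indicator {0..s} r * q \<tau> R r)"
      "Z \<tau> R s = J \<tau> R + (\<integral>r. indicator {0..s} r * q \<tau> R r \<partial>lborel)"
      using csol_pairing[OF u[of s] \<alpha> cone_measurable[OF v0(1)] v0(2) w(2)[OF that(1)] w(3)[OF that(1)] that(2), of "\<tau> - s"]
      by (simp_all add: q_def Z_def J_def)
  qed
  have q_nn: "0 \<le> q \<tau> R r" if "0 < R" "0 \<le> r" for \<tau> R r
    unfolding q_def by (rule integral_nonneg_AE[OF nl_nn[OF that(2) cPw[OF that(1)]]])
  have Z_nn: "0 \<le> Z \<tau> R r" if "0 < R" "0 \<le> r" for \<tau> R r
    unfolding Z_def by (rule integral_nonneg_AE[OF u_nn[OF that(2) cPw[OF that(1)]]])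
  have J_nn: "0 \<le> J \<tau> R" if "0 < R" for \<tau> R
    unfolding J_def by (intro integral_nonneg_AE AE_I2 cone_mult_nonneg[OF v0(1) cPw[OF that]])
  \<comment> \<open>\<open>P\<close> contracts L^1, so the mass of the evolved function obeys the
    bound for \<open>w R\<close>. Its exponent 1/\<alpha> becomes 1 under the power \<alpha>, which
    leaves a factor linear in \<open>R\<close>.\<close>
  have jensen: "Z \<tau> R r powr (1 + \<alpha>) \<le> q \<tau> R r * (cw powr \<alpha> * R)" if "0 < R" "0 \<le> r" for \<tau> R r
  proof -
    note prems = that
    obtain C where C: "AE x in lborel. \<bar>u r x\<bar> \<le> C" using u_bd[OF prems(2)] by blast
    have "Z \<tau> R r powr (1 + \<alpha>) \<le> q \<tau> R r * (\<integral>x. \<bar>P (\<tau> - r) (w R) x\<bar> \<partial>lborel) powr \<alpha>"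
      unfolding Z_def q_def
      by (rule jensen_nl[OF \<alpha> iPw[OF that(1)] _ C u_nn[OF that(2) cPw[OF that(1)]]]) measurable
    also have "\<dots> \<le> q \<tau> R r * (cw * R powr (1 / \<alpha>)) powr \<alpha>"
    proof (intro mult_left_mono powr_mono2 q_nn that)
      show "(\<integral>x. \<bar>P (\<tau> - r) (w R) x\<bar> \<partial>lborel) \<le> cw * R powr (1 / \<alpha>)"
        by (rule order_trans[OF integrable_P(2)[OF w(2)[OF that(1)]] cw(2)[OF that(1)]])
    qed (use \<alpha> in auto)
    also have "(cw * R powr (1 / \<alpha>)) powr \<alpha> = cw powr \<alpha> * R"
      using cw \<alpha> that by (simp add: powr_mult powr_powr)
    finally show ?thesis .
  qed
  \<comment> \<open>The doubling bound on an interval of length \<open>t\<close> with \<kappa> =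
    1/(cw^\<alpha> t): the length cancels, so the constant depends on neither \<open>t0\<close> nor
    \<open>t\<close>.\<close>
  define C1 where "C1 = (1 / (1 - 2 powr (- \<alpha>)) * cw powr \<alpha>) powr (1 / \<alpha>)"
  have C1: "Z (t0 + t) t t0 \<le> C1" if t: "0 \<le> t0" "0 < t" for t0 t
  proof -
    let ?\<kappa> = "1 / (cw powr \<alpha> * t)"
    let ?Z = "Z (t0 + t) t" and ?q = "q (t0 + t) t"
    have \<kappa>: "0 < ?\<kappa>" using cw t by simp
    have "?\<kappa> * ?Z t0 powr \<alpha> * ((t0 + t) - t0) \<le> 1 / (1 - 2 powr (- \<alpha>))"
    proof (rule doubling_blowup[OF \<alpha> \<kappa>, where Z="?Z" and q="?q" and a=t0 and b="t0 + t"])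
      show "t0 \<le> t0 + t" using t by simp
      have "integrable lborel (\<lambda>r. indicator {t0..t0 + t} r *\<^sub>R (indicator {0..t0 + t} r * ?q r))"
        by (rule integrable_mult_indicator) (use q_int[of t "t0 + t" "t0 + t"] t in auto)
      moreover have "indicator {t0..t0 + t} r *\<^sub>R (indicator {0..t0 + t} r * ?q r) = indicator {t0..t0 + t} r * ?q r" for r
        using t by (auto simp: indicator_def)
      ultimately show "integrable lborel (\<lambda>r. indicator {t0..t0 + t} r * ?q r)" by (simp only:)
      show "0 \<le> ?Z t0" by (rule Z_nn[OF t(2,1)])
      show "?\<kappa> * (?Z r powr (1 + \<alpha>)) \<le> ?q r" if "t0 \<le> r" "r \<le> t0 + t" for r
        using jensen[of t r "t0 + t"] cw t that by (simp add: pos_divide_le_eq)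
      fix s s' assume s: "t0 \<le> s" "s \<le> s'" "s' \<le> t0 + t"
      have i: "integrable lborel (\<lambda>r. indicator {0..s} r * ?q r)" "integrable lborel (\<lambda>r. indicator {0..s'} r * ?q r)"
        using q_int[of t s "t0 + t"] q_int[of t s' "t0 + t"] s t by auto
      have "indicator {s<..s'} r * ?q r = indicator {0..s'} r * ?q r - indicator {0..s} r * ?q r" for r
        using s t by (auto simp: indicator_def)
      then have "(\<integral>r. indicator {s<..s'} r * ?q r \<partial>lborel)
          = (\<integral>r. indicator {0..s'} r * ?q r \<partial>lborel) - (\<integral>r. indicator {0..s} r * ?q r \<partial>lborel)"
        using Bochner_Integration.integral_diff[OF i(2,1)] by (simp only:)
      then show "?Z s' = ?Z s + (\<integral>r. indicator {s<..s'} r * ?q r \<partial>lborel)"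
        using Z_eq[of t s "t0 + t"] Z_eq[of t s' "t0 + t"] s t by simp
    qed
    then have "?Z t0 powr \<alpha> \<le> 1 / (1 - 2 powr (- \<alpha>)) * cw powr \<alpha>"
      using cw t by (simp add: field_simps)
    then have "(?Z t0 powr \<alpha>) powr (1 / \<alpha>) \<le> C1"
      unfolding C1_def using \<alpha> by (intro powr_mono2) auto
    then show ?thesis using \<alpha> Z_nn[OF t(2,1)] by (simp add: powr_powr)
  qed
  have q_nni: "ennreal (q \<tau> R r) = (\<integral>\<^sup>+y. ennreal (nl \<alpha> (u r y) * P (\<tau> - r) (w R) y) \<partial>lborel)"
    if "0 < R" "0 \<le> r" for \<tau> R r
    unfolding q_def using inl[OF that(2) iPw[OF that(1)]] nl_nn[OF that(2) cPw[OF that(1)]]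
    by (rule nn_integral_eq_integral[symmetric])
  \<comment> \<open>Horizon t0 + n + 1 and scale n + 1 tend to infinity together, so the evolution
    time exceeds the scale by the fixed amount t0 - r. Fatou's lemma in \<open>y\<close> and then in
    \<open>r\<close> keeps the bound.\<close>
  have bound: "(\<integral>\<^sup>+r. indicator {0..t0} r * (\<integral>\<^sup>+y. ennreal (nl \<alpha> (u r y) * (c * y $ k)) \<partial>lborel) \<partial>lborel) \<le> ennreal C1"
    if t0: "0 \<le> t0" for t0
  proof -
    define F where "F n r y = ennreal (nl \<alpha> (u r y) * P (t0 + real (Suc n) - r) (w (real (Suc n))) y)" for n r y
    have F_meas: "(\<lambda>(r, y). F n r y) \<in> borel_measurable (lborel \<Otimes>\<^sub>M lborel)" for n
    proof -
      have [measurable]: "w (real (Suc n)) \<in> borel_measurable borel" by (rule w_meas) simp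
      have m: "meas2 (\<lambda>s y. w (real (Suc n)) y)" by measurable
      show ?thesis unfolding F_def case_prod_beta'
        by (intro measurable_compose[OF _ measurable_ennreal] borel_measurable_times P_source_measurable'[OF m]) measurable
    qed
    have [measurable]: "F n r \<in> borel_measurable lborel" for n r
      using measurable_Pair2[OF F_meas, of r n] by simp
    have F_int_meas [measurable]: "(\<lambda>r. \<integral>\<^sup>+y. F n r y \<partial>lborel) \<in> borel_measurable lborel" for n
      using lborel.borel_measurable_nn_integral[OF F_meas[of n]] by simp
    have F_le: "(\<integral>\<^sup>+r. indicator {0..t0} r * (\<integral>\<^sup>+y. F n r y \<partial>lborel) \<partial>lborel) \<le> ennreal C1" for n
    proof -
      let ?q = "q (t0 + real (Suc n)) (real (Suc n))"
      have "(\<integral>\<^sup>+r. indicator {0..t0} r * (\<integral>\<^sup>+y. F n r y \<partial>lborel) \<partial>lborel) = (\<integral>\<^sup>+r. ennreal (indicator {0..t0} r * ?q r) \<partial>lborel)"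
        by (intro nn_integral_cong) (auto simp: F_def q_nni indicator_def)
      also have "\<dots> = ennreal (\<integral>r. indicator {0..t0} r * ?q r \<partial>lborel)"
        by (rule nn_integral_eq_integral) (use q_int[of "real (Suc n)" t0 "t0 + real (Suc n)"] q_nn t0 in \<open>auto simp: indicator_def\<close>)
      \<comment> \<open>The accumulated growth up to \<open>t0\<close> is \<open>Z\<close> minus the
        nonnegative contribution of the datum.\<close>
      also have "\<dots> \<le> ennreal C1"
        using Z_eq[of "real (Suc n)" t0 "t0 + real (Suc n)"] J_nn[of "real (Suc n)" "t0 + real (Suc n)"] C1[OF t0, of "real (Suc n)"] t0
        by (intro ennreal_leI) auto
      finally show ?thesis .
    qed
    have lim: "(\<lambda>n. F n r y) \<longlonglongrightarrow> ennreal (nl \<alpha> (u r y) * (c * y $ k))" if "r \<in> {0..t0}" for r y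
    proof -
      have "filterlim (\<lambda>n. real (Suc n)) at_top sequentially"
        using filterlim_real_sequentially by (rule filterlim_compose) (rule filterlim_Suc)
      from filterlim_compose[OF c(2)[of "t0 - r" y] this] that
      have "(\<lambda>n. P (t0 + real (Suc n) - r) (w (real (Suc n))) y) \<longlonglongrightarrow> c * y $ k"
        by (simp add: algebra_simps)
      then show ?thesis unfolding F_def by (intro tendsto_intros tendsto_ennrealI)
    qed
    have "(\<integral>\<^sup>+r. indicator {0..t0} r * (\<integral>\<^sup>+y. ennreal (nl \<alpha> (u r y) * (c * y $ k)) \<partial>lborel) \<partial>lborel)
        \<le> (\<integral>\<^sup>+r. liminf (\<lambda>n. indicator {0..t0} r * (\<integral>\<^sup>+y. F n r y \<partial>lborel)) \<partial>lborel)"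
    proof (rule nn_integral_mono)
      fix r
      show "indicator {0..t0} r * (\<integral>\<^sup>+y. ennreal (nl \<alpha> (u r y) * (c * y $ k)) \<partial>lborel)
          \<le> liminf (\<lambda>n. indicator {0..t0} r * (\<integral>\<^sup>+y. F n r y \<partial>lborel))"
      proof (cases "r \<in> {0..t0}")
        case True
        have "(\<integral>\<^sup>+y. ennreal (nl \<alpha> (u r y) * (c * y $ k)) \<partial>lborel) = (\<integral>\<^sup>+y. liminf (\<lambda>n. F n r y) \<partial>lborel)"
          using lim_imp_Liminf[OF _ lim[OF True]] by simp
        also have "\<dots> \<le> liminf (\<lambda>n. \<integral>\<^sup>+y. F n r y \<partial>lborel)"
          by (rule nn_integral_liminf) measurable
        finally show ?thesis using True by simp
      qed simp
    qed
    also have "\<dots> \<le> liminf (\<lambda>n. \<integral>\<^sup>+r. indicator {0..t0} r * (\<integral>\<^sup>+y. F n r y \<partial>lborel) \<partial>lborel)"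
      by (rule nn_integral_liminf) measurable
    also have "\<dots> \<le> ennreal C1"
      using F_le by (intro Liminf_le) auto
    finally show ?thesis .
  qed
  \<comment> \<open>If the contribution of the datum came arbitrarily close to 0 along times tending
    to infinity, Fatou's lemma would make the integral of \<open>v0 x * x $ k\<close> vanish, and by
    its sign \<open>v0\<close> would vanish too.\<close>
  obtain c0 r0 where c0: "0 < c0" "0 < r0" "\<And>r. r0 \<le> r \<Longrightarrow> c0 \<le> J r r"
  proof -
    have "\<exists>n. \<forall>r\<ge>real (Suc n). 1 / real (Suc n) \<le> J r r"
    proof (rule ccontr)
      assume "\<not> ?thesis"
      then have "\<forall>n. \<exists>r. real (Suc n) \<le> r \<and> J r r < 1 / real (Suc n)" by (simp add: not_le)
      then obtain \<rho> where \<rho>: "\<And>n. real (Suc n) \<le> \<rho> n" "\<And>n. J (\<rho> n) (\<rho> n) < 1 / real (Suc n)" by metis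
      have \<rho>_pos: "0 < \<rho> n" for n by (rule less_le_trans[OF _ \<rho>(1)]) simp
      have "filterlim (\<lambda>n. real (Suc n)) at_top sequentially"
        using filterlim_real_sequentially by (rule filterlim_compose) (rule filterlim_Suc)
      then have \<rho>_lim: "filterlim \<rho> at_top sequentially"
        by (rule filterlim_at_top_mono) (use \<rho>(1) in auto)
      have lim: "(\<lambda>n. ennreal (v0 x * P (\<rho> n) (w (\<rho> n)) x)) \<longlonglongrightarrow> ennreal (v0 x * (c * x $ k))" for x
        using filterlim_compose[OF c(2)[of 0 x] \<rho>_lim] by (intro tendsto_ennrealI tendsto_intros) simp
      have Pm [measurable]: "P (\<rho> n) (w (\<rho> n)) \<in> borel_measurable borel" for n
        using cone_measurable[OF cPw[OF \<rho>_pos[of n]]] .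
      have i: "integrable lborel (\<lambda>x. v0 x * P (\<rho> n) (w (\<rho> n)) x)" for n
        using integrable_mult_bounded[OF iPw[OF \<rho>_pos[of n]], of v0 K] v0(2) by (simp add: mult.commute)
      have "(\<integral>\<^sup>+x. ennreal (v0 x * (c * x $ k)) \<partial>lborel) = (\<integral>\<^sup>+x. liminf (\<lambda>n. ennreal (v0 x * P (\<rho> n) (w (\<rho> n)) x)) \<partial>lborel)"
        using lim_imp_Liminf[OF _ lim] by simp
      also have "\<dots> \<le> liminf (\<lambda>n. \<integral>\<^sup>+x. ennreal (v0 x * P (\<rho> n) (w (\<rho> n)) x) \<partial>lborel)"
        by (rule nn_integral_liminf) measurable
      also have "(\<lambda>n. \<integral>\<^sup>+x. ennreal (v0 x * P (\<rho> n) (w (\<rho> n)) x) \<partial>lborel) = (\<lambda>n. ennreal (J (\<rho> n) (\<rho> n)))"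
        unfolding J_def by (intro ext nn_integral_eq_integral i AE_I2 cone_mult_nonneg[OF v0(1) cPw[OF \<rho>_pos]])
      also have "liminf (\<lambda>n. ennreal (J (\<rho> n) (\<rho> n))) \<le> liminf (\<lambda>n. ennreal (1 / real (Suc n)))"
        by (intro Liminf_mono always_eventually allI ennreal_leI less_imp_le \<rho>(2))
      also have "\<dots> = 0"
      proof (rule lim_imp_Liminf)
        have "(\<lambda>n. 1 / real (Suc n)) \<longlonglongrightarrow> 0" using LIMSEQ_inverse_real_of_nat by (simp add: inverse_eq_divide)
        then show "(\<lambda>n. ennreal (1 / real (Suc n))) \<longlonglongrightarrow> 0" using tendsto_ennrealI by fastforce
      qed simp
      finally have "(\<integral>\<^sup>+x. ennreal (v0 x * (c * x $ k)) \<partial>lborel) = 0" by simp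
      then have "AE x in lborel. ennreal (v0 x * (c * x $ k)) = 0"
        by (subst (asm) nn_integral_0_iff_AE) auto
      then have "AE x in lborel. v0 x = 0"
        using AE_lborel_component_ne[of k 0]
      proof eventually_elim
        case (elim x)
        then have "c * (v0 x * x $ k) \<le> 0" by (simp add: ennreal_eq_0_iff mult_ac)
        then have "v0 x * x $ k \<le> 0" using c(1) by (simp add: mult_le_0_iff)
        then show ?case using cone_mult_nonneg[OF v0(1) cone_nth, of x] elim by simp
      qed
      then show False using nz by simp
    qed
    then obtain n where "\<And>r. real (Suc n) \<le> r \<Longrightarrow> 1 / real (Suc n) \<le> J r r" by blast
    then show ?thesis by (rule that[rotated 2]) auto
  qed
  define d where "d = c * (c0 powr (1 + \<alpha>) / cw powr \<alpha>)"
  have d: "0 < d" using c c0 cw by (simp add: d_def)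
  \<comment> \<open>With the horizon equal to the current time the test function is not evolved at
    all, so \<open>w r\<close> itself appears and is dominated by |x_k|. The lower bound
    \<open>c0\<close> and Jensen's inequality supply the factor 1/r.\<close>
  have lower: "ennreal (d / r) \<le> (\<integral>\<^sup>+y. ennreal (nl \<alpha> (u r y) * (c * y $ k)) \<partial>lborel)" if r: "r0 \<le> r" for r
  proof -
    have r_pos: "0 < r" "0 \<le> r" using r c0 by auto
    have "0 \<le> (\<integral>s. indicator {0..r} s * q r r s \<partial>lborel)"
      by (intro integral_nonneg_AE AE_I2) (use q_nn[OF r_pos(1)] in \<open>auto simp: indicator_def\<close>)
    then have "c0 \<le> Z r r r" using Z_eq[of r r r] c0(3)[OF r] r_pos by simp
    then have "c0 powr (1 + \<alpha>) \<le> Z r r r powr (1 + \<alpha>)" using c0 \<alpha> by (intro powr_mono2) auto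
    also have "\<dots> \<le> q r r r * (cw powr \<alpha> * r)" by (rule jensen[OF r_pos])
    finally have "c0 powr (1 + \<alpha>) / cw powr \<alpha> / r \<le> q r r r" using cw r_pos by (simp add: pos_divide_le_eq mult_ac)
    then have "c * (c0 powr (1 + \<alpha>) / cw powr \<alpha> / r) \<le> c * q r r r" using c(1) by (intro mult_left_mono) auto
    then have "d / r \<le> c * q r r r" by (simp add: d_def)
    then have "ennreal (d / r) \<le> ennreal c * ennreal (q r r r)" using c(1) by (simp add: ennreal_mult[symmetric] q_nn r_pos ennreal_leI)
    also have "\<dots> = ennreal c * (\<integral>\<^sup>+y. ennreal (nl \<alpha> (u r y) * w r y) \<partial>lborel)"
      using w_meas[OF r_pos(1)] by (simp add: q_nni r_pos P_0)
    also have "\<dots> = (\<integral>\<^sup>+y. ennreal c * ennreal (nl \<alpha> (u r y) * w r y) \<partial>lborel)"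
      using w_meas[OF r_pos(1)] by (intro nn_integral_cmult[symmetric]) measurable
    also have "\<dots> \<le> (\<integral>\<^sup>+y. ennreal (nl \<alpha> (u r y) * (c * y $ k)) \<partial>lborel)"
    proof (rule nn_integral_mono_AE)
      show "AE y in lborel. ennreal c * ennreal (nl \<alpha> (u r y) * w r y) \<le> ennreal (nl \<alpha> (u r y) * (c * y $ k))"
        using nl_nn[OF r_pos(2) w(1)[OF r_pos(1)]] nl_nn[OF r_pos(2) cone_nth]
      proof eventually_elim
        case (elim y)
        have "nl \<alpha> (u r y) * w r y = \<bar>nl \<alpha> (u r y)\<bar> * \<bar>w r y\<bar>" using elim by (simp add: abs_mult[symmetric])
        also have "\<dots> \<le> \<bar>nl \<alpha> (u r y)\<bar> * \<bar>y $ k\<bar>" by (intro mult_left_mono w_le r_pos) auto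
        also have "\<dots> = nl \<alpha> (u r y) * y $ k" using elim by (simp add: abs_mult[symmetric])
        finally have "c * (nl \<alpha> (u r y) * w r y) \<le> c * (nl \<alpha> (u r y) * y $ k)"
          by (rule mult_left_mono) (use c(1) in simp)
        also have "\<dots> = nl \<alpha> (u r y) * (c * y $ k)" by simp
        finally have "ennreal (c * (nl \<alpha> (u r y) * w r y)) \<le> ennreal (nl \<alpha> (u r y) * (c * y $ k))" by (rule ennreal_leI)
        then show ?case using c(1) elim by (simp only: ennreal_mult[OF less_imp_le])
      qed
    qed
    finally show ?thesis .
  qed
  \<comment> \<open>Chosen so that d ln(t0/r0) equals |C1| + 1, just beyond the bound.\<close>
  define t0 where "t0 = r0 * exp ((\<bar>C1\<bar> + 1) / d)"
  have t0: "r0 \<le> t0" "0 \<le> t0"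
    unfolding t0_def using c0 d by auto
  have "ennreal (d * ln t0 - d * ln r0) = (\<integral>\<^sup>+r. ennreal (d / r) * indicator {r0..t0} r \<partial>lborel)"
    using nn_integral_inverse_Icc[of r0 t0 d] c0 t0 d by simp
  also have "\<dots> \<le> (\<integral>\<^sup>+r. indicator {0..t0} r * (\<integral>\<^sup>+y. ennreal (nl \<alpha> (u r y) * (c * y $ k)) \<partial>lborel) \<partial>lborel)"
    by (rule nn_integral_mono) (use lower c0 in \<open>auto simp: indicator_def\<close>)
  also have "\<dots> \<le> ennreal C1" by (rule bound[OF t0(2)])
  finally have "ennreal (d * ln t0 - d * ln r0) \<le> ennreal C1" .
  moreover have "d * ln t0 - d * ln r0 = \<bar>C1\<bar> + 1"
  proof -
    have "ln t0 - ln r0 = (\<bar>C1\<bar> + 1) / d" using c0 by (simp add: t0_def ln_mult)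
    then have "d * (ln t0 - ln r0) = \<bar>C1\<bar> + 1" using d by simp
    then show ?thesis by (simp only: right_diff_distrib)
  qed
  ultimately have "\<bar>C1\<bar> + 1 \<le> C1" by (metis abs_ge_zero add_nonneg_pos ennreal_le_iff2 not_le zero_less_one)
  then show False by simp
qed

end

section \<open>The test functions and their large-time limit\<close>

text \<open>The coordinate \<open>x $ k\<close>, a positive harmonic function of the half-space
  vanishing on its boundary, cut off at scale \<open>R\<close>. The Gaussian cutoff keeps the
  Fourier transform explicit.\<close>

definition test_fun :: "'n \<Rightarrow> real \<Rightarrow> real^'n \<Rightarrow> real" where
  "test_fun k R x = x $ k * gauss ((1 / R) *\<^sub>R x)"

lemma cone_test_fun: "cone k (test_fun k R)"
  unfolding cone_def test_fun_def by (auto simp: reflN_scaleR[symmetric])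

lemma abs_test_fun_le: "\<bar>test_fun k R x\<bar> \<le> \<bar>x $ k\<bar>"
  using mult_left_mono[OF gauss_le_1[of "(1 / R) *\<^sub>R x"], of "\<bar>x $ k\<bar>"] by (simp add: test_fun_def abs_mult)

lemma test_fun_scale: "R > 0 \<Longrightarrow> test_fun k R x = R * test_fun k 1 ((1 / R) *\<^sub>R x)"
  by (simp add: test_fun_def)

lemma abs_test_fun_bound:
  fixes x :: "real^'n"
  assumes R: "R > 0"
  shows "\<bar>test_fun k R x\<bar> \<le> R"
proof -
  have one: "\<bar>test_fun k 1 y\<bar> \<le> 1" for y :: "real^'n"
  proof -
    have "norm y \<le> 1 + (norm y)\<^sup>2 / 2" using sum_squares_bound[of "norm y" 1] by (simp add: power2_eq_square)
    also have "\<dots> \<le> exp ((norm y)\<^sup>2 / 2)" by (rule exp_ge_add_one_self)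
    finally have "norm y * exp (- ((norm y)\<^sup>2 / 2)) \<le> exp ((norm y)\<^sup>2 / 2) * exp (- ((norm y)\<^sup>2 / 2))"
      by (intro mult_right_mono) auto
    then have "norm y * gauss y \<le> 1" by (simp add: gauss_def exp_add[symmetric])
    moreover have "\<bar>y $ k\<bar> * gauss y \<le> norm y * gauss y"
      by (intro mult_right_mono component_le_norm_cart) auto
    ultimately show ?thesis by (simp add: test_fun_def abs_mult)
  qed
  show ?thesis using mult_left_mono[OF one, of R] R by (simp add: test_fun_scale[OF R] abs_mult)
qed

lemma integrable_test_fun:
  assumes R: "R > 0"
  shows "integrable lborel (test_fun k R :: real^'n \<Rightarrow> real)"
proof -
  have "integrable lborel (\<lambda>x::real^'n. R * test_fun k 1 ((1 / R) *\<^sub>R x))"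
    using integrable_lborel_scaleR[OF integrable_nth_gauss[of k], of "1 / R"] R
    by (intro integrable_mult_right) (simp add: test_fun_def)
  then show ?thesis by (simp add: test_fun_scale[OF R, abs_def])
qed

lemma integral_abs_test_fun:
  assumes R: "R > 0"
  shows "(\<integral>(x::real^'n). \<bar>test_fun k R x\<bar> \<partial>lborel) = R ^ (CARD('n) + 1) * (\<integral>(x::real^'n). \<bar>test_fun k 1 x\<bar> \<partial>lborel)"
proof -
  have "(\<integral>(x::real^'n). \<bar>test_fun k R x\<bar> \<partial>lborel) = \<bar>R\<bar> ^ DIM(real^'n) *\<^sub>R (\<integral>(x::real^'n). \<bar>test_fun k R (R *\<^sub>R x)\<bar> \<partial>lborel)"
    by (rule integral_lborel_scaleR) (use R in \<open>auto intro!: borel_measurable_abs cone_measurable[OF cone_test_fun]\<close>)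
  also have "(\<lambda>x::real^'n. \<bar>test_fun k R (R *\<^sub>R x)\<bar>) = (\<lambda>x. R * \<bar>test_fun k 1 x\<bar>)"
    using R by (auto simp: test_fun_def abs_mult fun_eq_iff)
  finally show ?thesis using R by simp
qed

text \<open>With r = |\<xi>|^2/4 the inequality r \<le> e^r trades the quadratic factor for half of
  the Gaussian exponent.\<close>

lemma integrable_norm_sq_gauss: "integrable lborel (\<lambda>\<xi>::real^'n. (norm \<xi>)\<^sup>2 * gauss \<xi>)"
proof (rule Bochner_Integration.integrable_bound)
  show "integrable lborel (\<lambda>\<xi>::real^'n. 4 * gauss ((1 / sqrt 2) *\<^sub>R \<xi>))"
    by (intro integrable_mult_right integrable_lborel_scaleR[OF integrable_gauss]) auto
  show "AE \<xi> in lborel. norm ((norm \<xi>)\<^sup>2 * gauss \<xi>) \<le> norm (4 * gauss ((1 / sqrt 2) *\<^sub>R (\<xi>::real^'n)))"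
  proof (rule AE_I2)
    fix \<xi> :: "real^'n"
    define r where "r = (norm \<xi>)\<^sup>2 / 4"
    have "r \<le> exp r" using exp_ge_add_one_self[of r] by linarith
    then have "r * (exp (- r) * exp (- r)) \<le> exp r * (exp (- r) * exp (- r))" by (intro mult_right_mono) auto
    then have "r * exp (- (2 * r)) \<le> exp (- r)" by (simp add: exp_add[symmetric])
    moreover have "gauss \<xi> = exp (- (2 * r))" "gauss ((1 / sqrt 2) *\<^sub>R \<xi>) = exp (- r)"
      by (simp_all add: gauss_def r_def power_divide)
    ultimately show "norm ((norm \<xi>)\<^sup>2 * gauss \<xi>) \<le> norm (4 * gauss ((1 / sqrt 2) *\<^sub>R \<xi>))"
      by (simp add: r_def abs_mult)
  qed
qed measurable

text \<open>With h = 1/r this is the derivative of sin(\<theta> h) at h = 0.\<close>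

lemma tendsto_mult_sin_divide: "((\<lambda>r::real. r * sin (\<theta> / r)) \<longlongrightarrow> \<theta>) at_top"
proof -
  have "((\<lambda>h. sin (\<theta> * h)) has_real_derivative \<theta>) (at 0)"
    by (auto intro!: derivative_eq_intros)
  then have "((\<lambda>h. sin (\<theta> * h) / h) \<longlongrightarrow> \<theta>) (at 0)" by (simp add: DERIV_def)
  moreover have "filterlim (\<lambda>r::real. inverse r) (at 0) at_top"
    using filterlim_inverse_at_top_iff by (intro filterlim_mono[OF filterlim_inverse_at_right_top]) (auto simp: at_within_le_at)
  ultimately have "((\<lambda>r. sin (\<theta> * inverse r) / inverse r) \<longlongrightarrow> \<theta>) at_top" by (rule filterlim_compose)
  then show ?thesis by (simp add: divide_inverse mult.commute)
qed

lemma filterlim_powr_at_top: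
  assumes "0 < (p::real)"
  shows "filterlim (\<lambda>t::real. t powr p) at_top at_top"
proof -
  have "filterlim (\<lambda>t::real. exp (p * ln t)) at_top at_top"
    by (rule filterlim_compose[OF exp_at_top], rule filterlim_tendsto_pos_mult_at_top[OF tendsto_const assms ln_at_top])
  moreover have "eventually (\<lambda>t::real. exp (p * ln t) = t powr p) at_top"
    using eventually_gt_at_top[of 0] by eventually_elim (simp add: powr_def)
  ultimately show ?thesis by (simp add: filterlim_cong)
qed

text \<open>At scale R = t^(1/\<beta>) one has |\<xi>/R|^\<beta> = |\<xi>|^\<beta>/t, so
  \<open>t\<close> times the expansion at 0 leaves its leading term. The shift by \<open>s\<close>
  contributes only the factor 1 + s/t.\<close>

lemma tendsto_symbol_scaling:
  fixes J0 :: "real^'n \<Rightarrow> real"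
  assumes asym: "(\<lambda>\<xi>. J0 \<xi> - (1 - a * norm \<xi> powr \<beta>)) \<in> o[at 0](\<lambda>\<xi>. norm \<xi> powr \<beta>)"
    and \<beta>: "0 < \<beta>" and \<xi>: "\<xi> \<noteq> 0"
  shows "((\<lambda>t. (t + s) * (J0 ((1 / t powr (1 / \<beta>)) *\<^sub>R \<xi>) - 1)) \<longlongrightarrow> - a * norm \<xi> powr \<beta>) at_top"
proof -
  let ?R = "\<lambda>t::real. t powr (1 / \<beta>)"
  have R: "filterlim ?R at_top at_top" using \<beta> by (intro filterlim_powr_at_top) auto
  have "((\<lambda>t. inverse (?R t)) \<longlongrightarrow> 0) at_top" by (rule filterlim_compose[OF tendsto_inverse_0_at_top R]) (rule filterlim_ident)
  then have "((\<lambda>t. (1 / ?R t) *\<^sub>R \<xi>) \<longlongrightarrow> 0 *\<^sub>R \<xi>) at_top" by (intro tendsto_intros) (simp add: divide_inverse)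
  moreover have "eventually (\<lambda>t. (1 / ?R t) *\<^sub>R \<xi> \<noteq> 0) at_top"
    using eventually_gt_at_top[of 0] by eventually_elim (use \<xi> in auto)
  ultimately have lim0: "filterlim (\<lambda>t. (1 / ?R t) *\<^sub>R \<xi>) (at 0) at_top" by (simp add: filterlim_at)
  have "((\<lambda>\<xi>. (J0 \<xi> - (1 - a * norm \<xi> powr \<beta>)) / norm \<xi> powr \<beta>) \<longlongrightarrow> 0) (at 0)"
    by (rule smalloD_tendsto[OF asym])
  from filterlim_compose[OF this lim0]
  have "((\<lambda>t. (J0 ((1 / ?R t) *\<^sub>R \<xi>) - (1 - a * norm ((1 / ?R t) *\<^sub>R \<xi>) powr \<beta>)) / norm ((1 / ?R t) *\<^sub>R \<xi>) powr \<beta>) \<longlongrightarrow> 0) at_top" .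
  then have "((\<lambda>t. (1 + s * inverse t) * (norm \<xi> powr \<beta> * ((J0 ((1 / ?R t) *\<^sub>R \<xi>) - (1 - a * norm ((1 / ?R t) *\<^sub>R \<xi>) powr \<beta>)) / norm ((1 / ?R t) *\<^sub>R \<xi>) powr \<beta>) - a * norm \<xi> powr \<beta>))
      \<longlongrightarrow> (1 + s * 0) * (norm \<xi> powr \<beta> * 0 - a * norm \<xi> powr \<beta>)) at_top"
    by (intro tendsto_intros tendsto_inverse_0_at_top filterlim_ident)
  moreover have "eventually (\<lambda>t. (1 + s * inverse t) * (norm \<xi> powr \<beta> * ((J0 ((1 / ?R t) *\<^sub>R \<xi>) - (1 - a * norm ((1 / ?R t) *\<^sub>R \<xi>) powr \<beta>)) / norm ((1 / ?R t) *\<^sub>R \<xi>) powr \<beta>) - a * norm \<xi> powr \<beta>)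
      = (t + s) * (J0 ((1 / ?R t) *\<^sub>R \<xi>) - 1)) at_top"
    using eventually_gt_at_top[of 0]
  proof eventually_elim
    case (elim t)
    define n where "n = norm \<xi> powr \<beta>"
    have n: "n > 0" using \<xi> by (simp add: n_def)
    have e: "norm ((1 / ?R t) *\<^sub>R \<xi>) powr \<beta> = n / t"
      using elim \<beta> by (simp add: n_def powr_divide powr_powr)
    have eq: "n * ((J0 ((1 / ?R t) *\<^sub>R \<xi>) - (1 - a * (n / t))) / (n / t)) - a * n = t * (J0 ((1 / ?R t) *\<^sub>R \<xi>) - 1)"
      using n elim by (simp add: field_simps)
    have "(1 + s * inverse t) * (t * X) = (t + s) * X" for X using elim by (simp add: field_simps)
    then show ?case unfolding e n_def[symmetric] eq .
  qed
  ultimately show ?thesis by (simp add: tendsto_cong)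
qed

text \<open>The component of \<open>x\<close> orthogonal to the k-th axis contributes an integrand
  that is odd in \<open>\<xi> $ k\<close>.\<close>

lemma integral_inner_nth:
  fixes W :: "real^'n \<Rightarrow> real"
  assumes [measurable]: "W \<in> borel_measurable borel" and refl: "\<And>\<xi>. W (reflN k \<xi>) = W \<xi>"
    and int: "integrable lborel (\<lambda>\<xi>. (norm \<xi>)\<^sup>2 * W \<xi>)"
  shows "(\<integral>\<xi>. (x \<bullet> \<xi>) * \<xi> $ k * W \<xi> \<partial>lborel) = x $ k * (\<integral>\<xi>. (\<xi> $ k)\<^sup>2 * W \<xi> \<partial>lborel)"
proof -
  have i1: "integrable lborel (\<lambda>\<xi>. (x \<bullet> \<xi>) * \<xi> $ k * W \<xi>)" for x
  proof (rule Bochner_Integration.integrable_bound[OF integrable_mult_right[OF int, of "norm x"]])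
    show "AE \<xi> in lborel. norm ((x \<bullet> \<xi>) * \<xi> $ k * W \<xi>) \<le> norm (norm x * ((norm \<xi>)\<^sup>2 * W \<xi>))"
    proof (rule AE_I2)
      fix \<xi> :: "real^'n"
      have "\<bar>x \<bullet> \<xi>\<bar> * \<bar>\<xi> $ k\<bar> \<le> (norm x * norm \<xi>) * norm \<xi>"
        by (intro mult_mono Cauchy_Schwarz_ineq2 component_le_norm_cart) auto
      then have "\<bar>x \<bullet> \<xi>\<bar> * \<bar>\<xi> $ k\<bar> * \<bar>W \<xi>\<bar> \<le> (norm x * norm \<xi>) * norm \<xi> * \<bar>W \<xi>\<bar>" by (rule mult_right_mono) simp
      then show "norm ((x \<bullet> \<xi>) * \<xi> $ k * W \<xi>) \<le> norm (norm x * ((norm \<xi>)\<^sup>2 * W \<xi>))"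
        by (simp add: abs_mult power2_eq_square mult_ac)
    qed
  qed measurable
  define y where "y = x - x $ k *\<^sub>R axis k 1"
  have y: "y $ k = 0" by (simp add: y_def axis_def)
  have odd: "(y \<bullet> reflN k \<xi>) = y \<bullet> \<xi>" for \<xi>
    using inner_reflN[of k y \<xi>] reflN_fixed[OF y] by simp
  have "(\<integral>\<xi>. (y \<bullet> \<xi>) * \<xi> $ k * W \<xi> \<partial>lborel) = (\<integral>\<xi>. (y \<bullet> reflN k \<xi>) * reflN k \<xi> $ k * W (reflN k \<xi>) \<partial>lborel)"
    by (rule integral_lborel_reflN[symmetric]) measurable
  also have "\<dots> = - (\<integral>\<xi>. (y \<bullet> \<xi>) * \<xi> $ k * W \<xi> \<partial>lborel)" by (simp add: odd refl)
  finally have y0: "(\<integral>\<xi>. (y \<bullet> \<xi>) * \<xi> $ k * W \<xi> \<partial>lborel) = 0" by simp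
  have "(x \<bullet> \<xi>) * \<xi> $ k * W \<xi> = (y \<bullet> \<xi>) * \<xi> $ k * W \<xi> + x $ k * ((axis k 1 \<bullet> \<xi>) * \<xi> $ k * W \<xi>)" for \<xi>
    by (simp add: y_def inner_diff_left algebra_simps)
  then have "(\<integral>\<xi>. (x \<bullet> \<xi>) * \<xi> $ k * W \<xi> \<partial>lborel) = (\<integral>\<xi>. (y \<bullet> \<xi>) * \<xi> $ k * W \<xi> \<partial>lborel) + x $ k * (\<integral>\<xi>. (axis k 1 \<bullet> \<xi>) * \<xi> $ k * W \<xi> \<partial>lborel)"
    using Bochner_Integration.integral_add[OF i1[of y] integrable_mult_right[OF i1[of "axis k 1"], of "x $ k"]]
    by (simp only: integral_mult_right_zero)
  then show ?thesis by (simp add: y0 inner_axis' power2_eq_square)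
qed

context kernel_semigroup
begin

text \<open>Dilating space by 1/R evaluates the symbol at \<xi>/R. The Fourier transform of the
  coordinate times a Gaussian carries a factor -i, so taking real parts leaves the sine.\<close>

lemma P_test_fun:
  fixes J0 :: "real^'n \<Rightarrow> real"
  assumes fourier: "\<And>\<xi>. mfourier (Q \<tau>) \<xi> = exp (complex_of_real (\<tau> * (J0 \<xi> - 1)))" and R: "0 < R"
    and [measurable]: "J0 \<in> borel_measurable borel" and J0_le: "\<And>\<xi>. J0 \<xi> \<le> 1" and \<tau>: "0 \<le> \<tau>"
  shows "P \<tau> (test_fun k R) x = (\<integral>\<xi>. (1 / gauss_const TYPE('n)) * (exp (\<tau> * (J0 ((1 / R) *\<^sub>R \<xi>) - 1)) * (\<xi> $ k * gauss \<xi>) * (R * sin (x \<bullet> \<xi> / R))) \<partial>lborel)"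
proof -
  define E where "E \<xi> = exp (\<tau> * (J0 ((1 / R) *\<^sub>R \<xi>) - 1))" for \<xi>
  have [measurable]: "E \<in> borel_measurable borel" unfolding E_def by measurable
  have E: "0 \<le> E \<xi>" "E \<xi> \<le> 1" for \<xi>
    using J0_le \<tau> by (auto simp: E_def mult_nonneg_nonpos)
  define \<Phi> where "\<Phi> \<xi> = (- \<i> / gauss_const TYPE('n)) * complex_of_real (\<xi> $ k * gauss \<xi>)" for \<xi> :: "real^'n"
  have int\<Phi>: "integrable lborel \<Phi>" unfolding \<Phi>_def
    by (intro integrable_mult_right) (simp only: complex_of_real_integrable_eq integrable_nth_gauss)
  have tr: "complex_of_real (test_fun k 1 y) = ftrans \<Phi> y" for y :: "real^'n"
  proof -
    have "ftrans \<Phi> y = (- \<i> / gauss_const TYPE('n)) * (\<integral>\<xi>. complex_of_real (\<xi> $ k * gauss \<xi>) * cis (y \<bullet> \<xi>) \<partial>lborel)"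
      unfolding ftrans_def \<Phi>_def mult.assoc by simp
    also have "\<dots> = complex_of_real (test_fun k 1 y)"
      unfolding integral_cis_nth_gauss using gauss_const_pos[where 'n='n] by (simp add: test_fun_def)
    finally show ?thesis by simp
  qed
  interpret q: prob_space "Q \<tau>" by (rule prob_space_Q)
  define \<nu> where "\<nu> = distr (Q \<tau>) borel (\<lambda>z. (1 / R) *\<^sub>R z)"
  have \<nu>: "finite_measure \<nu>" "sets \<nu> = sets borel"
    unfolding \<nu>_def by (auto intro!: q.finite_measure_distr)
  have [measurable]: "test_fun k r \<in> borel_measurable borel" for r by (rule cone_measurable[OF cone_test_fun])
  have f\<nu>: "mfourier \<nu> \<xi> = complex_of_real (E \<xi>)" for \<xi>
  proof -
    have "mfourier \<nu> \<xi> = mfourier (Q \<tau>) ((1 / R) *\<^sub>R \<xi>)"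
      unfolding \<nu>_def mfourier_def by (subst integral_distr) auto
    then show ?thesis by (simp only: fourier E_def exp_of_real)
  qed
  have "complex_of_real (P \<tau> (test_fun k R) x) = (\<integral>y. complex_of_real (R * test_fun k 1 ((1 / R) *\<^sub>R x - (1 / R) *\<^sub>R y)) \<partial>Q \<tau>)"
    unfolding P_def test_fun_scale[OF R] integral_complex_of_real[symmetric]
    by (simp only: scaleR_right_diff_distrib)
  also have "\<dots> = complex_of_real R * (\<integral>y. ftrans \<Phi> ((1 / R) *\<^sub>R x - (1 / R) *\<^sub>R y) \<partial>Q \<tau>)"
    by (simp add: tr)
  also have "(\<integral>y. ftrans \<Phi> ((1 / R) *\<^sub>R x - (1 / R) *\<^sub>R y) \<partial>Q \<tau>) = (\<integral>z. ftrans \<Phi> ((1 / R) *\<^sub>R x - z) \<partial>\<nu>)"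
    unfolding \<nu>_def using int\<Phi>
    by (subst integral_distr) (auto intro!: measurable_compose[OF _ borel_measurable_trans] simp: borel_measurable_integrable)
  also have "\<dots> = ftrans (\<lambda>\<xi>. complex_of_real (E \<xi>) * \<Phi> \<xi>) ((1 / R) *\<^sub>R x)"
    using mconv_trans[OF \<nu> int\<Phi>] by (simp add: f\<nu>)
  finally have "complex_of_real (P \<tau> (test_fun k R) x)
      = (\<integral>\<xi>. complex_of_real R * (complex_of_real (E \<xi>) * \<Phi> \<xi> * cis ((1 / R) *\<^sub>R x \<bullet> \<xi>)) \<partial>lborel)"
    by (simp add: ftrans_def)
  then have "P \<tau> (test_fun k R) x = Re (\<integral>\<xi>. complex_of_real R * (complex_of_real (E \<xi>) * \<Phi> \<xi> * cis ((1 / R) *\<^sub>R x \<bullet> \<xi>)) \<partial>lborel)"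
    by (metis Re_complex_of_real)
  also have "\<dots> = (\<integral>\<xi>. Re (complex_of_real R * (complex_of_real (E \<xi>) * \<Phi> \<xi> * cis ((1 / R) *\<^sub>R x \<bullet> \<xi>))) \<partial>lborel)"
  proof (rule integral_Re[symmetric])
    have "integrable lborel (\<lambda>\<xi>. complex_of_real (E \<xi>) * \<Phi> \<xi>)"
      by (rule integrable_bounded_mult[OF int\<Phi>, where B=1]) (use E in auto)
    then show "integrable lborel (\<lambda>\<xi>. complex_of_real R * (complex_of_real (E \<xi>) * \<Phi> \<xi> * cis ((1 / R) *\<^sub>R x \<bullet> \<xi>)))"
      by (intro integrable_mult_right integrable_trans)
  qed
  also have "\<dots> = (\<integral>\<xi>. (1 / gauss_const TYPE('n)) * (E \<xi> * (\<xi> $ k * gauss \<xi>) * (R * sin (x \<bullet> \<xi> / R))) \<partial>lborel)"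
    by (intro Bochner_Integration.integral_cong) (auto simp: \<Phi>_def)
  finally show ?thesis by (simp add: E_def)
qed

text \<open>Dominated convergence in the Fourier integral: the symbol factor tends to exp(-a
  |\<xi>|^\<beta>) and the sine factor to the inner product of \<open>x\<close> and \<xi>. Symmetry
  leaves a multiple of \<open>x $ k\<close>, whose coefficient is a positive second moment.\<close>

lemma P_test_fun_tendsto:
  fixes J0 :: "real^'n \<Rightarrow> real"
  assumes fourier: "\<And>\<tau> \<xi>. 0 \<le> \<tau> \<Longrightarrow> mfourier (Q \<tau>) \<xi> = exp (complex_of_real (\<tau> * (J0 \<xi> - 1)))"
    and J0_meas [measurable]: "J0 \<in> borel_measurable borel"
    and asym: "(\<lambda>\<xi>. J0 \<xi> - (1 - a * norm \<xi> powr \<beta>)) \<in> o[at 0](\<lambda>\<xi>. norm \<xi> powr \<beta>)"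
    and a: "0 < a" and \<beta>: "0 < \<beta>"
  obtains c where "0 < c"
    "\<And>s x. 0 \<le> s \<Longrightarrow> ((\<lambda>t. P (t + s) (test_fun k (t powr (1 / \<beta>))) x) \<longlongrightarrow> c * x $ k) at_top"
proof -
  \<comment> \<open>The Fourier transform of a probability measure has modulus at most 1; time 1
    already gives the claim.\<close>
  have J0_le: "J0 \<xi> \<le> 1" for \<xi>
  proof -
    interpret prob_space "Q 1" by (rule prob_space_Q)
    have "norm (mfourier (Q 1) \<xi>) \<le> 1"
      unfolding mfourier_def by (rule order_trans[OF integral_norm_bound]) (simp add: prob_space)
    then show ?thesis using fourier[of 1 \<xi>] by (simp add: norm_exp_eq_Re)
  qed
  define W where "W \<xi> = gauss \<xi> * exp (- a * norm \<xi> powr \<beta>)" for \<xi> :: "real^'n"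
  have [measurable]: "W \<in> borel_measurable borel" unfolding W_def by measurable
  have W_pos: "0 < W \<xi>" for \<xi> by (simp add: W_def gauss_pos)
  have W_le: "W \<xi> \<le> gauss \<xi>" for \<xi>
    using a by (auto simp: W_def intro!: mult_left_le)
  have W_int: "integrable lborel (\<lambda>\<xi>. (norm \<xi>)\<^sup>2 * W \<xi>)"
    by (rule Bochner_Integration.integrable_bound[OF integrable_norm_sq_gauss])
       (use W_le W_pos in \<open>auto simp: abs_mult abs_of_pos intro!: mult_left_mono\<close>)
  have Wk_int: "integrable lborel (\<lambda>\<xi>. (\<xi> $ k)\<^sup>2 * W \<xi>)"
  proof (rule Bochner_Integration.integrable_bound[OF W_int])
    show "AE \<xi> in lborel. norm ((\<xi> $ k)\<^sup>2 * W \<xi>) \<le> norm ((norm \<xi>)\<^sup>2 * W \<xi>)"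
    proof (rule AE_I2)
      fix \<xi> :: "real^'n"
      have "(\<xi> $ k)\<^sup>2 \<le> (norm \<xi>)\<^sup>2" using component_le_norm_cart[of \<xi> k] by (simp add: abs_le_square_iff[symmetric])
      then show "norm ((\<xi> $ k)\<^sup>2 * W \<xi>) \<le> norm ((norm \<xi>)\<^sup>2 * W \<xi>)"
        using W_pos[of \<xi>] by (simp add: abs_mult mult_right_mono)
    qed
  qed measurable
  define I where "I = (\<integral>\<xi>. (\<xi> $ k)\<^sup>2 * W \<xi> \<partial>lborel)"
  have I: "0 < I"
  proof -
    have nn: "0 \<le> (\<xi> $ k)\<^sup>2 * W \<xi>" for \<xi> using W_pos[of \<xi>] by simp
    have "I \<noteq> 0"
    proof
      assume "I = 0"
      then have "AE \<xi> in lborel. (\<xi> $ k)\<^sup>2 * W \<xi> = 0"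
        unfolding I_def using integral_nonneg_eq_0_iff_AE[OF Wk_int] nn by auto
      then have "AE \<xi> in (lborel :: (real^'n) measure). False"
        using AE_lborel_component_ne[of k 0]
      proof eventually_elim
        case (elim \<xi>)
        then show ?case using W_pos[of \<xi>] by simp
      qed
      then have "emeasure lborel (UNIV :: (real^'n) set) = 0" by (simp add: AE_iff_null null_sets_def)
      then show False by simp
    qed
    moreover have "0 \<le> I" unfolding I_def by (intro integral_nonneg_AE AE_I2 nn)
    ultimately show ?thesis by simp
  qed
  let ?g = "1 / gauss_const TYPE('n)"
  have g: "0 < ?g" using gauss_const_pos[where 'n='n] by simp
  show ?thesis
  proof (rule that[of "?g * I"])
    show "0 < ?g * I" using g I by simp
    fix s :: real and x :: "real^'n" assume s: "0 \<le> s"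
    let ?R = "\<lambda>t::real. t powr (1 / \<beta>)"
    let ?h = "\<lambda>t \<xi>. ?g * (exp ((t + s) * (J0 ((1 / ?R t) *\<^sub>R \<xi>) - 1)) * (\<xi> $ k * gauss \<xi>) * (?R t * sin (x \<bullet> \<xi> / ?R t)))"
    have "((\<lambda>t. \<integral>\<xi>. ?h t \<xi> \<partial>lborel) \<longlongrightarrow> (\<integral>\<xi>. ?g * ((x \<bullet> \<xi>) * \<xi> $ k * W \<xi>) \<partial>lborel)) at_top"
    proof (rule integral_dominated_convergence_at_top)
      show "integrable lborel (\<lambda>\<xi>::real^'n. ?g * (norm x * ((norm \<xi>)\<^sup>2 * gauss \<xi>)))"
        by (intro integrable_mult_right integrable_norm_sq_gauss)
      show "\<forall>\<^sub>F t in at_top. AE \<xi> in lborel. norm (?h t \<xi>) \<le> ?g * (norm x * ((norm \<xi>)\<^sup>2 * gauss \<xi>))"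
        using eventually_gt_at_top[of 0]
      proof eventually_elim
        case (elim t)
        have R: "0 < ?R t" using elim by simp
        show ?case
        proof (rule AE_I2)
          fix \<xi> :: "real^'n"
          have e: "exp ((t + s) * (J0 ((1 / ?R t) *\<^sub>R \<xi>) - 1)) \<le> 1"
            using J0_le[of "(1 / ?R t) *\<^sub>R \<xi>"] elim s by (simp add: mult_nonneg_nonpos)
          \<comment> \<open>|sin y| \<le> |y| cancels the growing factor \<open>R\<close>, so the
            dominating function does not depend on \<open>t\<close>.\<close>
          have "\<bar>?R t * sin (x \<bullet> \<xi> / ?R t)\<bar> \<le> ?R t * \<bar>x \<bullet> \<xi> / ?R t\<bar>"
            unfolding abs_mult abs_of_pos[OF R] by (rule mult_left_mono[OF abs_sin_x_le_abs_x]) simp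
          also have "\<dots> = \<bar>x \<bullet> \<xi>\<bar>" using R by (simp add: abs_divide)
          also have "\<dots> \<le> norm x * norm \<xi>" by (rule Cauchy_Schwarz_ineq2)
          finally have s: "\<bar>?R t * sin (x \<bullet> \<xi> / ?R t)\<bar> \<le> norm x * norm \<xi>" .
          have "norm (?h t \<xi>) = ?g * (exp ((t + s) * (J0 ((1 / ?R t) *\<^sub>R \<xi>) - 1)) * (\<bar>\<xi> $ k\<bar> * gauss \<xi>) * \<bar>?R t * sin (x \<bullet> \<xi> / ?R t)\<bar>)"
            using g by (simp add: abs_mult)
          also have "\<dots> \<le> ?g * (1 * (norm \<xi> * gauss \<xi>) * (norm x * norm \<xi>))"
            using g e s by (intro mult_left_mono mult_mono component_le_norm_cart) auto
          also have "\<dots> = ?g * (norm x * ((norm \<xi>)\<^sup>2 * gauss \<xi>))" by (simp add: power2_eq_square)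
          finally show "norm (?h t \<xi>) \<le> ?g * (norm x * ((norm \<xi>)\<^sup>2 * gauss \<xi>))" .
        qed
      qed
      have "AE \<xi> in lborel. \<xi> \<noteq> (0::real^'n)" by (rule AE_lborel_singleton)
      then show "AE \<xi> in lborel. ((\<lambda>t. ?h t \<xi>) \<longlongrightarrow> ?g * ((x \<bullet> \<xi>) * \<xi> $ k * W \<xi>)) at_top"
      proof eventually_elim
        case (elim \<xi>)
        have R: "filterlim ?R at_top at_top" using \<beta> by (intro filterlim_powr_at_top) auto
        have "((\<lambda>t. ?h t \<xi>) \<longlongrightarrow> ?g * (exp (- a * norm \<xi> powr \<beta>) * (\<xi> $ k * gauss \<xi>) * (x \<bullet> \<xi>))) at_top"
          by (intro tendsto_intros tendsto_symbol_scaling[OF asym \<beta> elim] filterlim_compose[OF tendsto_mult_sin_divide R])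
        then show ?case by (simp add: W_def mult_ac)
      qed
    qed measurable
    also have "(\<integral>\<xi>. ?g * ((x \<bullet> \<xi>) * \<xi> $ k * W \<xi>) \<partial>lborel) = ?g * I * x $ k"
    proof -
      have "(\<integral>\<xi>. (x \<bullet> \<xi>) * \<xi> $ k * W \<xi> \<partial>lborel) = x $ k * I"
        unfolding I_def by (rule integral_inner_nth[OF _ _ W_int]) (auto simp: W_def)
      then show ?thesis by simp
    qed
    finally have "((\<lambda>t. \<integral>\<xi>. ?h t \<xi> \<partial>lborel) \<longlongrightarrow> ?g * I * x $ k) at_top" .
    moreover have "eventually (\<lambda>t. (\<integral>\<xi>. ?h t \<xi> \<partial>lborel) = P (t + s) (test_fun k (?R t)) x) at_top"
      using eventually_gt_at_top[of 0]
    proof eventually_elim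
      case (elim t)
      have "0 \<le> t + s" "0 < ?R t" using elim s by auto
      then show ?case by (intro P_test_fun[OF fourier _ J0_meas J0_le, symmetric]) auto
    qed
    ultimately show "((\<lambda>t. P (t + s) (test_fun k (?R t)) x) \<longlongrightarrow> ?g * I * x $ k) at_top"
      by (simp add: tendsto_cong)
  qed
qed

end

section \<open>The maximal solution\<close>

context kernel_semigroup
begin

text \<open>The norm sees the half-space alone. The representative in the cone is odd, which
  transports the bound to the other side, and the hyperplane is negligible.\<close>

lemma hs_norm_le_AE:
  assumes u: "csol \<alpha> v0 t u" and \<alpha>: "0 < \<alpha>" and v0: "cone k v0" "\<And>x. \<bar>v0 x\<bar> \<le> K" and t: "0 \<le> t"
    and le: "hs_norm k (u t) \<le> ereal r"
  shows "AE x in lborel. \<bar>u t x\<bar> \<le> r"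
proof -
  obtain C where C: "\<And>s. s \<in> {0..t} \<Longrightarrow> AE x in lborel. \<bar>u s x\<bar> \<le> C" using u unfolding csol_def by blast
  define z where "z = U \<alpha> (max C 1) v0 t"
  have uz: "AE x in lborel. u t x = z x" unfolding z_def
    by (rule csol_unique[OF u C _ _ \<alpha> cone_measurable[OF v0(1)] v0(2)]) (use t in auto)
  have z: "cone k z" unfolding z_def by (rule cone_U[OF \<alpha> _ v0 t]) auto
  have "AE x in lborel. (if 0 < x $ k then ereal \<bar>u t x\<bar> else 0) \<le> hs_norm k (u t)"
    unfolding hs_norm_def by (rule esssup_AE)
  then have H: "AE x in lborel. 0 < x $ k \<longrightarrow> \<bar>z x\<bar> \<le> r"
    using uz
  proof eventually_elim
    case (elim x)
    then show ?case using order_trans[OF elim(1) le] by auto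
  qed
  have "AE x in lborel. 0 < reflN k x $ k \<longrightarrow> \<bar>z (reflN k x)\<bar> \<le> r"
    by (rule AE_lborel_reflN[OF H])
  then show ?thesis using H uz AE_lborel_component_ne[of k 0]
  proof eventually_elim
    case (elim x)
    then show ?case by (cases "0 < x $ k") (auto simp: cone_odd[OF z])
  qed
qed

text \<open>\<open>T\<close> is the supremum of the existence times, finite because no solution is
  global. If the norm were below some level at a time close enough to \<open>T\<close>, a restart
  would carry the solution past \<open>T\<close>.\<close>

lemma maximal_solution:
  assumes \<alpha>: "0 < \<alpha>" and v0: "cone k v0" "\<And>x. \<bar>v0 x\<bar> \<le> K" and K: "0 < K"
    and no_global: "\<And>u. \<not> (\<forall>\<tau>. csol \<alpha> v0 \<tau> u)"
  obtains T u where "0 < T" "meas2 u" "\<And>\<tau>. 0 \<le> \<tau> \<Longrightarrow> \<tau> < T \<Longrightarrow> csol \<alpha> v0 \<tau> u"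
    "\<And>\<tau> w. 0 \<le> \<tau> \<Longrightarrow> csol \<alpha> v0 \<tau> w \<Longrightarrow> \<tau> \<le> T"
    "((\<lambda>t. hs_norm k (u t)) \<longlongrightarrow> \<infinity>) (at_left T)"
proof -
  note v0m = cone_measurable[OF v0(1)]
  \<comment> \<open>For \<open>t < T\<close> this sequence is eventually constant, at almost every \<open>x\<close>.\<close>
  define u where "u t x = lim (\<lambda>m::nat. U \<alpha> (real (Suc m)) v0 t x)" for t x
  have Um [measurable]: "meas2 (U \<alpha> (real (Suc m)) v0)" for m
    by (rule U_measurable[OF \<alpha> _ v0m v0(2)]) simp
  have u_meas: "meas2 u"
  proof -
    have "(\<lambda>p. lim (\<lambda>m. case p of (t, x) \<Rightarrow> U \<alpha> (real (Suc m)) v0 t x)) \<in> borel_measurable (borel \<Otimes>\<^sub>M borel)"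
      by measurable
    then show ?thesis by (simp add: u_def case_prod_beta')
  qed
  define A where "A = {\<tau>. 0 \<le> \<tau> \<and> (\<exists>w. csol \<alpha> v0 \<tau> w)}"
  \<comment> \<open>One function serves all existence intervals at once, so unbounded existence
    times would produce a single global solution.\<close>
  have A_u: "csol \<alpha> v0 \<tau> u" if \<tau>: "\<tau> \<in> A" for \<tau>
  proof -
    obtain w where w: "csol \<alpha> v0 \<tau> w" using \<tau> by (auto simp: A_def)
    obtain C where C: "\<And>t. t \<in> {0..\<tau>} \<Longrightarrow> AE x in lborel. \<bar>w t x\<bar> \<le> C" using w unfolding csol_def by blast
    show ?thesis
    proof (rule csol_cong[OF w u_meas])
      fix t assume t: "t \<in> {0..\<tau>}"
      have "AE x in lborel. C \<le> real (Suc m) \<longrightarrow> w t x = U \<alpha> (real (Suc m)) v0 t x" for m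
        using csol_unique[OF w C _ _ \<alpha> v0m v0(2) t, of "real (Suc m)"] by (cases "C \<le> real (Suc m)") auto
      then have "AE x in lborel. \<forall>m. C \<le> real (Suc m) \<longrightarrow> w t x = U \<alpha> (real (Suc m)) v0 t x"
        by (simp add: AE_all_countable)
      then show "AE x in lborel. u t x = w t x"
      proof eventually_elim
        case (elim x)
        obtain m0 :: nat where m0: "C \<le> real m0" using real_arch_simple by blast
        have "eventually (\<lambda>m. U \<alpha> (real (Suc m)) v0 t x = w t x) sequentially"
        proof (rule eventually_mono[OF eventually_ge_at_top[of m0]])
          fix m assume "m0 \<le> m"
          then have "C \<le> real (Suc m)" using m0 by simp
          then show "U \<alpha> (real (Suc m)) v0 t x = w t x" using elim by auto
        qed
        then have "(\<lambda>m. U \<alpha> (real (Suc m)) v0 t x) \<longlonglongrightarrow> w t x" by (rule tendsto_eventually)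
        then show ?case unfolding u_def by (rule limI)
      qed
    qed
  qed
  have bdd: "bdd_above A"
  proof (rule ccontr)
    assume "\<not> bdd_above A"
    then have "\<exists>\<sigma>\<in>A. \<tau> < \<sigma>" for \<tau> by (auto simp: bdd_above_def not_le)
    then have "csol \<alpha> v0 \<tau> u" for \<tau> using A_u csol_mono less_imp_le by metis
    then show False using no_global by blast
  qed
  define T where "T = Sup A"
  have life: "lifespan \<alpha> K \<in> A"
    using csol_local[OF \<alpha> K v0m v0(2)] lifespan_pos[OF \<alpha> K] by (auto simp: A_def)
  have upper: "\<tau> \<le> T" if "0 \<le> \<tau>" "csol \<alpha> v0 \<tau> w" for \<tau> w
    unfolding T_def by (rule cSup_upper[OF _ bdd]) (use that in \<open>auto simp: A_def\<close>)
  have T: "0 < T" using cSup_upper[OF life bdd] lifespan_pos[OF \<alpha> K] by (simp add: T_def)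
  have below: "csol \<alpha> v0 \<tau> u" if \<tau>: "0 \<le> \<tau>" "\<tau> < T" for \<tau>
  proof -
    obtain \<sigma> where "\<sigma> \<in> A" "\<tau> < \<sigma>" using less_cSupD[of A \<tau>] life \<tau> by (auto simp: T_def)
    then show ?thesis using csol_mono[OF A_u] by auto
  qed
  have "((\<lambda>t. hs_norm k (u t)) \<longlongrightarrow> \<infinity>) (at_left T)"
    unfolding tendsto_PInfty
  proof (rule allI)
    fix r :: real
    \<comment> \<open>The maximum with 1 keeps the level positive, as the restart requires.\<close>
    define K' where "K' = max r 1"
    have K': "0 < K'" by (simp add: K'_def)
    \<comment> \<open>After \<open>b\<close> the remaining time to \<open>T\<close> is shorter than
      the lifespan at level \<open>K'\<close>.\<close>
    define b where "b = max 0 (T - lifespan \<alpha> K')"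
    have b: "b < T" using T lifespan_pos[OF \<alpha> K'] by (simp add: b_def)
    show "eventually (\<lambda>t. ereal r < hs_norm k (u t)) (at_left T)"
      unfolding eventually_at_left[OF b]
    proof (intro exI[of _ b] conjI allI impI b)
      fix t assume t: "b < t" "t < T"
      then have t': "0 \<le> t" "T < t + lifespan \<alpha> K'" by (auto simp: b_def)
      have u: "csol \<alpha> v0 t u" by (rule below[OF t'(1) t(2)])
      show "ereal r < hs_norm k (u t)"
      proof (rule ccontr)
        assume "\<not> ereal r < hs_norm k (u t)"
        then have "hs_norm k (u t) \<le> ereal r" by simp
        from hs_norm_le_AE[OF u \<alpha> v0 t'(1) this] have "AE x in lborel. \<bar>u t x\<bar> \<le> K'"
          by eventually_elim (simp add: K'_def)
        from csol_restart[OF u t'(1) K' this \<alpha> v0m v0(2)]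
        obtain w where "csol \<alpha> v0 (t + lifespan \<alpha> K') w" by blast
        from upper[OF _ this] show False using t' lifespan_pos[OF \<alpha> K'] by simp
      qed
    qed
  qed
  then show ?thesis using that T u_meas below upper by blast
qed

end

section \<open>Comparison with the stated notion of solution\<close>

text \<open>At s = t the left integrand contains \<open>G 0\<close>, about which nothing is known; a
  single time does not affect the integral.\<close>

lemma D_ext_kernel:
  fixes G :: "real \<Rightarrow> (real^'n) measure"
  assumes "kernel_semigroup (ext_kernel G) k"
    and g: "(\<lambda>(s, y). g s y) \<in> borel_measurable (borel \<Otimes>\<^sub>M borel)"
  shows "(LBINT s:{0..t}. mconv (G (t - s)) (g s) x) = kernel_semigroup.D (ext_kernel G) g t x"
proof -
  interpret kernel_semigroup "ext_kernel G" k by fact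
  have eq: "mconv (G (t - s)) (g s) x = P (t - s) (g s) x" if "s < t" for s
    using that by (simp add: mconv_def P_def ext_kernel_def)
  define c where "c = indicator {0..t} t * mconv (G 0) (g t) x"
  have [measurable]: "(\<lambda>s. P (t - s) (g s) x) \<in> borel_measurable borel"
    by (intro P_source_measurable'[OF g]) measurable
  have "(\<lambda>s. indicator {0..t} s *\<^sub>R mconv (G (t - s)) (g s) x) = (\<lambda>s. if s = t then c else indicator {0..t} s * P (t - s) (g s) x)"
    using eq by (auto simp: fun_eq_iff c_def indicator_def)
  then have "(LBINT s:{0..t}. mconv (G (t - s)) (g s) x) = (\<integral>s. (if s = t then c else indicator {0..t} s * P (t - s) (g s) x) \<partial>lborel)"
    by (simp add: set_lebesgue_integral_def)
  also have "\<dots> = D g t x" unfolding D_eq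
  proof (rule integral_cong_AE)
    show "AE s in lborel. (if s = t then c else indicator {0..t} s * P (t - s) (g s) x) = indicator {0..t} s * P (t - s) (g s) x"
      using AE_lborel_singleton[of t] by eventually_elim simp
  qed measurable
  finally show ?thesis .
qed

text \<open>At time 0 the Duhamel term vanishes and \<open>P 0\<close> is the identity, so the
  initial condition is the equation at t = 0. The half-open interval is exhausted by closed ones,
  and the datum matters only up to null sets.\<close>

lemma mild_sol_iff_csol:
  fixes G :: "real \<Rightarrow> (real^'n) measure"
  assumes "kernel_semigroup (ext_kernel G) k"
    and v: "v \<in> borel_measurable borel" "v0 \<in> borel_measurable borel" "AE x in lborel. v x = v0 x" and T: "0 < T"
  shows "mild_sol G \<alpha> v T u \<longleftrightarrow> (\<lambda>(t, x). u t x) \<in> borel_measurable (borel \<Otimes>\<^sub>M borel) \<and>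
    (\<forall>\<tau>. 0 \<le> \<tau> \<and> \<tau> < T \<longrightarrow> kernel_semigroup.csol (ext_kernel G) \<alpha> v0 \<tau> u)"
proof (cases "(\<lambda>(t, x). u t x) \<in> borel_measurable (borel \<Otimes>\<^sub>M borel)")
  case True
  interpret kernel_semigroup "ext_kernel G" k by fact
  note [measurable] = True v(1,2)
  have nlu: "(\<lambda>(s, y). nl \<alpha> (u s y)) \<in> borel_measurable (borel \<Otimes>\<^sub>M borel)" by measurable
  have duh: "(LBINT s:{0..t}. mconv (G (t - s)) (\<lambda>y. \<bar>u s y\<bar> powr \<alpha> * u s y) x) = D (\<lambda>s y. nl \<alpha> (u s y)) t x" for t x
    using D_ext_kernel[OF assms(1) nlu, of t x] by (simp add: nl_def)
  have eq: "(AE x in lborel. u t x = mconv (G t) v x + (LBINT s:{0..t}. mconv (G (t - s)) (\<lambda>y. \<bar>u s y\<bar> powr \<alpha> * u s y) x))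
      \<longleftrightarrow> (AE x in lborel. u t x = P t v0 x + D (\<lambda>s y. nl \<alpha> (u s y)) t x)" if "0 < t" for t
  proof -
    have Pv: "AE x in lborel. P t v x = P t v0 x" by (rule P_AE_cong[OF v])
    have m: "mconv (G t) v x = P t v x" for x using that by (simp add: mconv_def P_def ext_kernel_def)
    show ?thesis unfolding duh m
    proof
      assume "AE x in lborel. u t x = P t v x + D (\<lambda>s y. nl \<alpha> (u s y)) t x"
      then show "AE x in lborel. u t x = P t v0 x + D (\<lambda>s y. nl \<alpha> (u s y)) t x"
        using Pv by eventually_elim simp
    next
      assume "AE x in lborel. u t x = P t v0 x + D (\<lambda>s y. nl \<alpha> (u s y)) t x"
      then show "AE x in lborel. u t x = P t v x + D (\<lambda>s y. nl \<alpha> (u s y)) t x"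
        using Pv by eventually_elim simp
    qed
  qed
  have D0: "D (\<lambda>s y. nl \<alpha> (u s y)) 0 x = 0" for x
  proof -
    have "D (\<lambda>s y. nl \<alpha> (u s y)) 0 x = (\<integral>s. indicator {0::real} s * P 0 (\<lambda>y. nl \<alpha> (u 0 y)) x \<partial>lborel)"
      unfolding D_eq by (intro Bochner_Integration.integral_cong) (auto simp: indicator_def)
    then show ?thesis by simp
  qed
  have eq0: "(AE x in lborel. u 0 x = v x) \<longleftrightarrow> (AE x in lborel. u 0 x = P 0 v0 x + D (\<lambda>s y. nl \<alpha> (u s y)) 0 x)"
    using v(3) by (auto simp: D0 P_0[OF v(2)] elim: eventually_elim2)
  show ?thesis
  proof
    assume m: "mild_sol G \<alpha> v T u"
    show "(\<lambda>(t, x). u t x) \<in> borel_measurable (borel \<Otimes>\<^sub>M borel) \<and> (\<forall>\<tau>. 0 \<le> \<tau> \<and> \<tau> < T \<longrightarrow> csol \<alpha> v0 \<tau> u)"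
    proof (intro conjI True allI impI)
      fix \<tau> assume \<tau>: "0 \<le> \<tau> \<and> \<tau> < T"
      have "AE x in lborel. u t x = P t v0 x + D (\<lambda>s y. nl \<alpha> (u s y)) t x" if "t \<in> {0..\<tau>}" for t
      proof (cases "t = 0")
        case True
        then show ?thesis using m eq0 by (simp add: mild_sol_def)
      next
        case False
        then have "0 < t" "t < T" using that \<tau> by auto
        then show ?thesis using m eq[of t] by (simp add: mild_sol_def)
      qed
      moreover have "\<exists>C. \<forall>t\<in>{0..\<tau>}. AE x in lborel. \<bar>u t x\<bar> \<le> C"
        using m \<tau> unfolding mild_sol_def by blast
      ultimately show "csol \<alpha> v0 \<tau> u" unfolding csol_def using True by blast
    qed
  next
    assume c: "(\<lambda>(t, x). u t x) \<in> borel_measurable (borel \<Otimes>\<^sub>M borel) \<and> (\<forall>\<tau>. 0 \<le> \<tau> \<and> \<tau> < T \<longrightarrow> csol \<alpha> v0 \<tau> u)"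
    then have cs: "csol \<alpha> v0 \<tau> u" if "0 \<le> \<tau>" "\<tau> < T" for \<tau> using that by blast
    have e: "AE x in lborel. u t x = P t v0 x + D (\<lambda>s y. nl \<alpha> (u s y)) t x" if "0 \<le> t" "t < T" for t
      using cs[OF that] that by (simp add: csol_def)
    show "mild_sol G \<alpha> v T u"
      unfolding mild_sol_def
    proof (intro conjI allI impI)
      show "(\<lambda>(t, x). u t x) \<in> borel_measurable borel" using True by (simp add: borel_prod)
      show "\<exists>C. \<forall>t\<in>{0..\<tau>}. AE x in lborel. \<bar>u t x\<bar> \<le> C" if "0 \<le> \<tau> \<and> \<tau> < T" for \<tau>
        using cs[of \<tau>] that by (simp add: csol_def)
      show "AE x in lborel. u 0 x = v x" unfolding eq0 by (rule e) (use T in auto)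
      show "AE x in lborel. u t x = mconv (G t) v x + (LBINT s:{0..t}. mconv (G (t - s)) (\<lambda>y. \<bar>u s y\<bar> powr \<alpha> * u s y) x)"
        if "0 < t \<and> t < T" for t
        unfolding eq[OF conjunct1[OF that]] by (rule e) (use that in auto)
    qed
  qed
next
  case False
  then show ?thesis by (simp add: mild_sol_def borel_prod)
qed

lemma oddext_measurable [measurable]:
  assumes [measurable]: "f \<in> borel_measurable borel"
  shows "oddext k f \<in> borel_measurable borel"
  unfolding oddext_def[abs_def] by measurable

theorem theorem2p2:
  fixes k :: "'n::finite"
    and a \<beta> \<alpha> :: real
    and J0 :: "real^'n \<Rightarrow> real"
    and G :: "real \<Rightarrow> (real^'n) measure"
    and u0 :: "real^'n \<Rightarrow> real"
  assumes a_pos: "a > 0"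
    and beta: "0 < \<beta>" "\<beta> \<le> 2"
    and alpha: "\<alpha> = \<beta> / (real CARD('n) + 1)"
    \<comment> \<open>assumption on J0\<close>
    and J0_cont: "continuous_on UNIV J0"
    and J0_asym: "(\<lambda>\<xi>. J0 \<xi> - (1 - a * norm \<xi> powr \<beta>)) \<in> o[at 0](\<lambda>\<xi>. norm \<xi> powr \<beta>)"
    and J0_sup: "\<forall>r>0. \<exists>c<1. \<forall>\<xi>. r \<le> norm \<xi> \<longrightarrow> J0 \<xi> \<le> c"
    \<comment> \<open>assumption on G\<close>
    and G_sets: "\<forall>t>0. sets (G t) = sets borel"
    and G_prob: "\<forall>t>0. prob_space (G t)"
    and G_cont: "\<forall>\<phi>::real^'n \<Rightarrow> real. continuous_on UNIV \<phi> \<longrightarrow> bounded (range \<phi>) \<longrightarrow>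
                   continuous_on {0<..} (\<lambda>t. integral\<^sup>L (G t) \<phi>)"
    and G_evenN: "\<forall>t>0. meas_even (reflN k) (G t)"
    and G_evenP: "\<forall>t>0. meas_even (reflP k) (G t)"
    and G_fourier: "\<forall>t>0. \<forall>\<xi>. mfourier (G t) \<xi> = exp (complex_of_real (t * (J0 \<xi> - 1)))"
    \<comment> \<open>A is one of the three operators (described through its semigroup G, i.e. through J0)\<close>
    and A_cases:
      "(\<beta> = 2 \<and> (\<forall>\<xi>. J0 \<xi> = 1 - norm \<xi> ^ 2))
       \<or> (\<beta> < 2 \<and> (\<forall>\<xi>. J0 \<xi> = 1 - norm \<xi> powr \<beta>))
       \<or> (\<exists>J :: real^'n \<Rightarrow> real.
            (\<forall>x. 0 \<le> J x) \<and> integrable lborel J \<and> J \<in> borel_measurable lborel \<and>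
            (\<exists>C. AE x in lborel. \<bar>J x\<bar> \<le> C) \<and>
            (\<forall>\<xi>. complex_of_real (J0 \<xi>) = ffourier J \<xi>) \<and>
            (\<forall>x. J (reflN k x) = J x) \<and> (\<forall>x. J (reflP k x) = J x) \<and>
            (\<forall>z s t. 0 < s \<and> s \<le> t \<longrightarrow> J (upd z k t) \<le> J (upd z k s)))"
    \<comment> \<open>initial data\<close>
    and u0_meas: "u0 \<in> borel_measurable lborel"
    and u0_bdd: "\<exists>C. AE x in lborel. x \<in> halfspace k \<longrightarrow> \<bar>u0 x\<bar> \<le> C"
    and u0_int: "set_integrable lborel (halfspace k) u0"
    and u0_nonneg: "AE x in lborel. x \<in> halfspace k \<longrightarrow> 0 \<le> u0 x"
    and u0_nonzero: "\<not> (AE x in lborel. x \<in> halfspace k \<longrightarrow> u0 x = 0)"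
    and u0_m1: "set_integrable lborel (halfspace k) (\<lambda>x. x$k * u0 x)"
  shows "\<exists>T u. 0 < T \<and> mild_sol G \<alpha> (oddext k u0) T u
           \<and> (\<forall>T' > T. \<not> (\<exists>v. mild_sol G \<alpha> (oddext k u0) T' v))
           \<and> ((\<lambda>t. hs_norm k (u t)) \<longlongrightarrow> \<infinity>) (at_left T)"
proof -
  have \<alpha>: "0 < \<alpha>" using beta by (simp add: alpha)
  have ks: "kernel_semigroup (ext_kernel G) k"
    by (rule kernel_semigroup_ext_kernel[OF G_sets G_prob G_cont G_evenN G_evenP G_fourier
          cone_mult_generator[OF beta _ A_cases]]) simp
  interpret kernel_semigroup "ext_kernel G" k by (rule ks)
  have [measurable]: "u0 \<in> borel_measurable borel" using u0_meas by simp
  obtain C where C: "AE x in lborel. x \<in> halfspace k \<longrightarrow> \<bar>u0 x\<bar> \<le> C" using u0_bdd by blast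
  define K where "K = max C 1"
  \<comment> \<open>A representative of the datum with values in [0, K] at every point, so that its
    odd extension lies in the cone exactly.\<close>
  define f where "f x = (if 0 \<le> u0 x \<and> u0 x \<le> K then u0 x else 0)" for x
  have [measurable]: "f \<in> borel_measurable borel" unfolding f_def by measurable
  have f: "0 \<le> f x" "f x \<le> K" for x by (auto simp: f_def K_def)
  define v0 where "v0 = oddext k f"
  have v0m: "v0 \<in> borel_measurable borel" unfolding v0_def by measurable
  have K: "0 < K" by (simp add: K_def)
  have v0: "cone k v0" "\<And>x. \<bar>v0 x\<bar> \<le> K"
    using v0m f K by (auto simp: cone_def v0_def oddext_def)
  have fu: "AE x in lborel. 0 < x $ k \<longrightarrow> f x = u0 x"
    using C u0_nonneg by eventually_elim (auto simp: f_def K_def halfspace_def)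
  have v_eq: "AE x in lborel. oddext k u0 x = v0 x"
    using fu AE_lborel_reflN[OF fu, of k] by eventually_elim (auto simp: v0_def oddext_def)
  have nz: "\<not> (AE x in lborel. v0 x = 0)"
  proof
    assume "AE x in lborel. v0 x = 0"
    then have "AE x in lborel. x \<in> halfspace k \<longrightarrow> u0 x = 0"
      using fu by eventually_elim (auto simp: v0_def oddext_def halfspace_def)
    then show False using u0_nonzero by blast
  qed
  have fourier: "mfourier (ext_kernel G \<tau>) \<xi> = exp (complex_of_real (\<tau> * (J0 \<xi> - 1)))" if "0 \<le> \<tau>" for \<tau> \<xi>
    using G_fourier that by (cases "\<tau> = 0") (auto simp: ext_kernel_def mfourier_return_0)
  obtain c where c: "0 < c"
    "\<And>s x. 0 \<le> s \<Longrightarrow> ((\<lambda>t. P (t + s) (test_fun k (t powr (1 / \<beta>))) x) \<longlongrightarrow> c * x $ k) at_top"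
    using P_test_fun_tendsto[OF fourier borel_measurable_continuous_onI[OF J0_cont] J0_asym a_pos beta(1)] by blast
  \<comment> \<open>Adding 1 makes the constant positive without evaluating the integral.\<close>
  define cw where "cw = (\<integral>(x::real^'n). \<bar>test_fun k 1 x\<bar> \<partial>lborel) + 1"
  have cw0: "0 \<le> (\<integral>(x::real^'n). \<bar>test_fun k 1 x\<bar> \<partial>lborel)" by (rule integral_nonneg_AE) simp
  have cw: "(\<integral>x. \<bar>test_fun k (t powr (1 / \<beta>)) (x::real^'n)\<bar> \<partial>lborel) \<le> cw * t powr (1 / \<alpha>)" if t: "0 < t" for t
  proof -
    \<comment> \<open>The critical relation (N + 1)/\<beta> = 1/\<alpha> between exponent and
      dimension.\<close>
    have "(t powr (1 / \<beta>)) ^ (CARD('n) + 1) = t powr (1 / \<alpha>)"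
      using t by (simp add: powr_realpow[symmetric] powr_powr alpha add.commute del: power_Suc)
    then show ?thesis
      using integral_abs_test_fun[of "t powr (1 / \<beta>)" k] t by (simp add: cw_def algebra_simps)
  qed
  have no_global: "\<not> (\<forall>\<tau>. csol \<alpha> v0 \<tau> u)" for u
  proof
    assume "\<forall>\<tau>. csol \<alpha> v0 \<tau> u"
    then have u: "csol \<alpha> v0 \<tau> u" for \<tau> by blast
    show False
    proof (rule no_global_solution[OF \<alpha> v0 nz _ _ _ _ cw _ c u])
      show "cone k (test_fun k (t powr (1 / \<beta>)))" for t by (rule cone_test_fun)
      show "integrable lborel (test_fun k (t powr (1 / \<beta>)))" if "0 < t" for t
        using that by (intro integrable_test_fun) simp
      show "\<bar>test_fun k (t powr (1 / \<beta>)) x\<bar> \<le> t powr (1 / \<beta>)" if "0 < t" for t x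
        using that by (intro abs_test_fun_bound) simp
      show "0 < cw" unfolding cw_def using cw0 by linarith
      show "\<bar>test_fun k (t powr (1 / \<beta>)) x\<bar> \<le> \<bar>x $ k\<bar>" for t x by (rule abs_test_fun_le)
    qed
  qed
  obtain T u where T: "0 < T" and u: "meas2 u" "\<And>\<tau>. 0 \<le> \<tau> \<Longrightarrow> \<tau> < T \<Longrightarrow> csol \<alpha> v0 \<tau> u"
    and max: "\<And>\<tau> w. 0 \<le> \<tau> \<Longrightarrow> csol \<alpha> v0 \<tau> w \<Longrightarrow> \<tau> \<le> T"
    and blowup: "((\<lambda>t. hs_norm k (u t)) \<longlongrightarrow> \<infinity>) (at_left T)"
    using maximal_solution[OF \<alpha> v0 K no_global] by blast
  have iff: "mild_sol G \<alpha> (oddext k u0) T' w \<longleftrightarrow> meas2 w \<and> (\<forall>\<tau>. 0 \<le> \<tau> \<and> \<tau> < T' \<longrightarrow> csol \<alpha> v0 \<tau> w)" if "0 < T'" for T' w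
    by (rule mild_sol_iff_csol[OF ks _ v0m v_eq that]) measurable
  have "\<not> mild_sol G \<alpha> (oddext k u0) T' w" if "T < T'" for T' w
  proof
    assume "mild_sol G \<alpha> (oddext k u0) T' w"
    \<comment> \<open>The midpoint lies inside [0, T') and beyond \<open>T\<close>, so a closed
      interval exceeding the maximal time would carry a solution.\<close>
    then have "csol \<alpha> v0 ((T + T') / 2) w" using iff[of T' w] T that by simp
    from max[OF _ this] T that show False by simp
  qed
  moreover have "mild_sol G \<alpha> (oddext k u0) T u" using iff[OF T] u by blast
  ultimately show ?thesis using T blowup by blast
qed

end
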